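(* Let $A\in\mathbb{R}^{m\times n}$ have rows sampled independently and uniformly from the unit sphere $\mathbb{S}^{n-1}$. (1) For every $0<q<1$ there exists $\delta>0$, depending only on $q$, such that for every $0\le\beta\le\delta$, with probability (with respect to $A$) tending to $1$ as $m,n,m/n\to\infty$, the $q$-quantile Random Kaczmarz method for $A$ converges for all $\beta$-corruptions. (2) Let $q=0.88$, and assume that the following hypothesis $(\diamond)$ holds: for every $0\le\beta\le 0.0056$, as $m,n,m/n\to\infty$, $$\frac{\sigma_{q-\beta,\min}(A)^2}{\sigma_{\max}(A)^2}\longrightarrow\frac{1}{\sqrt{2\pi}}\int_{-\alpha}^{\alpha}e^{-s^2/2}s^2\,ds\quad\text{in probability},$$ where $\alpha>0$ is defined by $\frac{1}{\sqrt{2\pi}}\int_{-\alpha}^{\alpha}e^{-s^2/2}\,ds=q-\beta$. Then the conclusion of (1) holds for $q=0.88$ with some $\delta\ge 0.0056$.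
   Context: $\|\cdot\|$ is the Euclidean norm, and $\|v\|_{\ell^0}$ is the number of nonzero entries of $v$. The rows of $A$ are denoted $a_1,\dots,a_m$. $\sigma_{\max}(A)$ is the largest singular value of $A$, and $$\sigma_{q-\beta,\min}(A)=\min_{S\subset\{1,\dots,m\},\ |S|=(q-\beta)m}\ \inf_{y\in\mathbb{R}^n,\ y\ne0}\frac{\|A_Sy\|}{\|y\|},$$ where $A_S$ is the submatrix of rows indexed by $S$. When $qm$ or $(q-\beta)m$ is not an integer it is rounded up. The $q$-quantile Random Kaczmarz method for a system $(A,b)$: given $x_k$, let $Q$ be the $q$-quantile of the $m$ numbers $|\langle x_k,a_i\rangle-b_i|$, $1\le i\le m$ (the $(qm)$-th smallest, counted with multiplicity), let $N_2=\{i:\ |\langle x_k,a_i\rangle-b_i|\le Q\}$, choose $i\in N_2$ uniformly at random (independently of previous choices given $x_k$), and set $x_{k+1}=x_k+(b_i-\langle a_i,x_k\rangle)a_i$. "The method converges for all $\beta$-corruptions" means: there is a constant $c\in(0,1]$ (which may depend on $A,\beta,q$) such that for every $x\in\mathbb{R}^n$, every $b\in\mathbb{R}^m$ with $\|b-Ax\|_{\ell^0}\le\beta m$, every $x_0\in\mathbb{R}^n$ and every $k\ge0$, one has $\mathbb{E}\|x_k-x\|^2\le(1-c)^k\|x_0-x\|^2$, the expectation being over the random choices of the algorithm for fixed $A$. "With probability tending to $1$ as $m,n,m/n\to\infty$" means: for every $\varepsilon>0$ there is $N$ such that the probability is at least $1-\varepsilon$ whenever $m,n,m/n\ge N$; the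 convergence in probability in $(\diamond)$ is understood in the same limit. *)

theory Defs
  imports
    "HOL-Probability.Probability"
    "Jordan_Normal_Form.Char_Poly"
    "Jordan_Normal_Form.DL_Submatrix"
begin

no_notation inner (infix "\<bullet>" 70)
no_notation vec_nth (infixl "$" 90)

type_synonym rvec = "real Matrix.vec"
type_synonym rmat = "real Matrix.mat"


definition l2norm :: "rvec \<Rightarrow> real" where
  "l2norm v = L2_set (\<lambda>i. v $ i) {..<dim_vec v}"

definition l0norm :: "rvec \<Rightarrow> nat" where
  "l0norm v = card {i. i < dim_vec v \<and> v $ i \<noteq> 0}"

definition singular_values :: "rmat \<Rightarrow> real set" where
  "singular_values A = {s. 0 \<le> s \<and> eigenvalue (transpose_mat A * A) (s\<^sup>2)}"

definition sigma_max :: "rmat \<Rightarrow> real" where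
  "sigma_max A = Max (singular_values A)"

text \<open>The minimum over row sets \<open>S\<close> of size \<open>\<lceil>p m\<rceil>\<close>; the paper uses \<open>p = q - \<beta>\<close>. Rows are
  numbered from \<open>0\<close>.\<close>

definition sigma_sub_min :: "real \<Rightarrow> rmat \<Rightarrow> real" where
  "sigma_sub_min p A =
     (MIN S \<in> {S. S \<subseteq> {..<dim_row A} \<and> card S = nat \<lceil>p * real (dim_row A)\<rceil>}.
        INF y \<in> carrier_vec (dim_col A) - {0\<^sub>v (dim_col A)}.
          l2norm (submatrix A S UNIV *\<^sub>v y) / l2norm y)"


definition residual :: "rmat \<Rightarrow> rvec \<Rightarrow> rvec \<Rightarrow> nat \<Rightarrow> real" where
  "residual A b x i = \<bar>x \<bullet> Matrix.row A i - b $ i\<bar>"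

text \<open>The \<open>\<lceil>q m\<rceil>\<close>-th smallest residual, counted with multiplicity (list positions start at \<open>0\<close>).\<close>

definition residual_quantile :: "real \<Rightarrow> rmat \<Rightarrow> rvec \<Rightarrow> rvec \<Rightarrow> real" where
  "residual_quantile q A b x =
     sort (map (residual A b x) [0..<dim_row A]) ! (nat \<lceil>q * real (dim_row A)\<rceil> - 1)"

definition admissible_rows :: "real \<Rightarrow> rmat \<Rightarrow> rvec \<Rightarrow> rvec \<Rightarrow> nat set" where
  "admissible_rows q A b x =
     {i. i < dim_row A \<and> residual A b x i \<le> residual_quantile q A b x}"

definition qrk_step :: "real \<Rightarrow> rmat \<Rightarrow> rvec \<Rightarrow> rvec \<Rightarrow> rvec pmf" where
  "qrk_step q A b x =
     map_pmf (\<lambda>i. x + (b $ i - Matrix.row A i \<bullet> x) \<cdot>\<^sub>v Matrix.row A i)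
       (pmf_of_set (admissible_rows q A b x))"

primrec qrk_iterate :: "real \<Rightarrow> rmat \<Rightarrow> rvec \<Rightarrow> rvec \<Rightarrow> nat \<Rightarrow> rvec pmf" where
  "qrk_iterate q A b x0 0 = return_pmf x0"
| "qrk_iterate q A b x0 (Suc k) = bind_pmf (qrk_iterate q A b x0 k) (qrk_step q A b)"

definition converges_for_all_corruptions :: "real \<Rightarrow> real \<Rightarrow> rmat \<Rightarrow> bool" where
  "converges_for_all_corruptions q \<beta> A \<longleftrightarrow>
     (\<exists>c. 0 < c \<and> c \<le> 1 \<and>
       (\<forall>x \<in> carrier_vec (dim_col A). \<forall>b \<in> carrier_vec (dim_row A).
          real (l0norm (b - A *\<^sub>v x)) \<le> \<beta> * real (dim_row A) \<longrightarrow>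
          (\<forall>x0 \<in> carrier_vec (dim_col A). \<forall>k.
             measure_pmf.expectation (qrk_iterate q A b x0 k) (\<lambda>y. (l2norm (y - x))\<^sup>2)
               \<le> (1 - c) ^ k * (l2norm (x0 - x))\<^sup>2)))"


text \<open>The uniform distribution on the unit sphere of \<open>\<real>\<^sup>n\<close>, i.e. normalised surface measure, as the
  radial projection of the uniform distribution on the unit ball. Since the dimension is a natural
  number, points are families of coordinates indexed by \<open>{..<n}\<close>. The origin, which is sent to
  itself, is a null set for \<open>n > 0\<close>.\<close>

definition unit_ball :: "nat \<Rightarrow> (nat \<Rightarrow> real) set" where
  "unit_ball n = {x \<in> {..<n} \<rightarrow>\<^sub>E UNIV. L2_set x {..<n} \<le> 1}"

definition uniform_sphere :: "nat \<Rightarrow> (nat \<Rightarrow> real) measure" where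
  "uniform_sphere n =
     distr (uniform_measure (PiM {..<n} (\<lambda>_. lborel)) (unit_ball n)) (PiM {..<n} (\<lambda>_. borel))
       (\<lambda>x. \<lambda>j\<in>{..<n}. x j / L2_set x {..<n})"

lemma unit_ball_sets: "unit_ball n \<in> sets (PiM {..<n} (\<lambda>_. lborel))"
proof -
  have "unit_ball n = {x \<in> space (PiM {..<n} (\<lambda>_. lborel)). L2_set x {..<n} \<le> 1}"
    by (auto simp: unit_ball_def space_PiM)
  also have "\<dots> \<in> sets (PiM {..<n} (\<lambda>_. lborel))"
    unfolding L2_set_def by measurable
  finally show ?thesis .
qed

lemma emeasure_unit_ball:
  assumes "n > 0"
  shows "emeasure (PiM {..<n} (\<lambda>_. lborel)) (unit_ball n) \<noteq> 0"
    and "emeasure (PiM {..<n} (\<lambda>_. lborel)) (unit_ball n) \<noteq> \<infinity>"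
proof -
  interpret product_sigma_finite "\<lambda>_::nat. lborel :: real measure" ..
  let ?M = "PiM {..<n} (\<lambda>_. lborel :: real measure)"
  have box: "emeasure ?M (PiE {..<n} (\<lambda>_. {-r..r})) = ennreal ((2*r)^n)" if "r \<ge> 0" for r :: real
    using that by (subst emeasure_PiM) (auto simp: prod_ennreal ennreal_power)
  have "PiE {..<n} (\<lambda>_. {-(1/n)..1/n}) \<subseteq> unit_ball n"
  proof
    fix x :: "nat \<Rightarrow> real" assume x: "x \<in> PiE {..<n} (\<lambda>_. {-(1/n)..1/n})"
    have "L2_set x {..<n} \<le> (\<Sum>i<n. \<bar>x i\<bar>)" by (rule L2_set_le_sum_abs)
    also have "\<dots> \<le> (\<Sum>i<n. 1/n)" using x by (intro sum_mono) (force simp: PiE_iff abs_le_iff)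
    also have "\<dots> = 1" using assms by simp
    finally show "x \<in> unit_ball n" using x by (auto simp: unit_ball_def PiE_iff)
  qed
  from emeasure_mono[OF this unit_ball_sets] box[of "1/n"]
  have "ennreal ((2 * (1/n))^n) \<le> emeasure ?M (unit_ball n)" by simp
  moreover have "ennreal ((2 * (1/n))^n) > 0" using assms by (simp add: ennreal_zero_less_divide)
  ultimately show "emeasure ?M (unit_ball n) \<noteq> 0" by auto
  have "unit_ball n \<subseteq> PiE {..<n} (\<lambda>_. {-1..1})"
  proof
    fix x :: "nat \<Rightarrow> real" assume x: "x \<in> unit_ball n"
    have "\<bar>x i\<bar> \<le> 1" if "i < n" for i
    proof -
      have "\<bar>x i\<bar> \<le> L2_set x {..<n}"
        using member_le_L2_set[of "{..<n}" i "\<lambda>i. \<bar>x i\<bar>"] that by (simp add: L2_set_def)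
      then show ?thesis using x by (simp add: unit_ball_def)
    qed
    then show "x \<in> PiE {..<n} (\<lambda>_. {-1..1})" using x by (force simp: unit_ball_def PiE_iff abs_le_iff)
  qed
  moreover have "PiE {..<n} (\<lambda>_. {-1..1::real}) \<in> sets ?M" by (intro sets_PiM_I_finite) auto
  ultimately have "emeasure ?M (unit_ball n) \<le> ennreal (2^n)"
    using emeasure_mono[of "unit_ball n" "PiE {..<n} (\<lambda>_. {-1..1})" ?M] box[of 1] by simp
  then show "emeasure ?M (unit_ball n) \<noteq> \<infinity>" by (auto simp: top_unique)
qed

lemma prob_space_uniform_sphere:
  assumes "n > 0" shows "prob_space (uniform_sphere n)"
  unfolding uniform_sphere_def
proof (rule prob_space.prob_space_distr)
  show "prob_space (uniform_measure (PiM {..<n} (\<lambda>_. lborel)) (unit_ball n))"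
    using emeasure_unit_ball[OF assms] by (intro prob_space_uniform_measure) auto
  show "(\<lambda>x. \<lambda>j\<in>{..<n}. x j / L2_set x {..<n}) \<in>
     uniform_measure (PiM {..<n} (\<lambda>_. lborel)) (unit_ball n) \<rightarrow>\<^sub>M PiM {..<n} (\<lambda>_. borel)"
    unfolding uniform_measure_def L2_set_def by measurable
qed

definition row_law :: "nat \<Rightarrow> nat \<Rightarrow> (nat \<Rightarrow> nat \<Rightarrow> real) measure" where
  "row_law m n = PiM {..<m} (\<lambda>_. uniform_sphere n)"

text \<open>The event that the random matrix satisfies \<open>P\<close> is not required to be measurable: it has
  probability at least \<open>p\<close> if it contains a measurable event that does.\<close>

definition random_matrix_prob_ge :: "nat \<Rightarrow> nat \<Rightarrow> real \<Rightarrow> (rmat \<Rightarrow> bool) \<Rightarrow> bool" where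
  "random_matrix_prob_ge m n p P \<longleftrightarrow>
     (\<exists>E \<in> sets (row_law m n).
        (\<forall>a \<in> E. P (Matrix.mat m n (\<lambda>(i, j). a i j))) \<and> p \<le> measure (row_law m n) E)"

definition prob_tends_to_1 :: "(rmat \<Rightarrow> bool) \<Rightarrow> bool" where
  "prob_tends_to_1 P \<longleftrightarrow>
     (\<forall>\<epsilon>>0. \<exists>N::real. \<forall>m n. N \<le> real m \<and> N \<le> real n \<and> N \<le> real m / real n \<longrightarrow>
        random_matrix_prob_ge m n (1 - \<epsilon>) P)"

definition tends_in_probability :: "(rmat \<Rightarrow> real) \<Rightarrow> real \<Rightarrow> bool" where
  "tends_in_probability X L \<longleftrightarrow> (\<forall>\<eta>>0. prob_tends_to_1 (\<lambda>A. \<bar>X A - L\<bar> < \<eta>))"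

end

theory Submission
  imports Defs
begin

text \<open>
  Let \<open>e\<close> be the error of the current iterate. A step along an uncorrupted unit row \<open>a\<close> removes
  \<open>\<langle>a, e\<rangle>\<^sup>2\<close> from \<open>\<parallel>e\<parallel>\<^sup>2\<close>; a step along a corrupted row of residual at most \<open>Q\<close> adds at most
  \<open>2 Q \<bar>\<langle>a, e\<rangle>\<bar> + Q\<^sup>2\<close>. At least \<open>(1 - q - \<beta>) m\<close> uncorrupted rows have residual at least the quantile
  \<open>Q\<close>, so \<open>Q\<^sup>2 \<le> L \<parallel>e\<parallel>\<^sup>2 / ((1 - q - \<beta>) m)\<close>, where \<open>L\<close> bounds the square of the operator norm. At least
  \<open>(q - \<beta>) m\<close> admissible rows are uncorrupted. Hence, if every such set of rows satisfies
  \<open>\<parallel>A\<^sub>S e\<parallel>\<^sup>2 \<ge> s \<parallel>e\<parallel>\<^sup>2\<close>, the mean squared error contracts as soon as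
  \<open>s / L > w + 2 \<surd>w\<close> with \<open>w = \<beta> / (1 - q - \<beta>)\<close> (locale \<open>quantile_system\<close>). Fewer corruptions are a
  special case of more, so in both parts it suffices to treat one positive \<open>\<beta>\<close>.

  For the first part, constants times \<open>m / n\<close> are found for \<open>L\<close> and \<open>s\<close>. The sphere is covered
  by a net of exponential size in \<open>n\<close>. At a fixed point of the net, the energy
  \<open>\<Sum> n \<langle>a\<^sub>i, z\<rangle>\<^sup>2\<close> is of order \<open>m\<close> and few of the \<open>n \<langle>a\<^sub>i, z\<rangle>\<^sup>2\<close> are small, both
  outside events of probability \<open>exp (- m)\<close>, by an exponential Markov inequality. Since \<open>m / n\<close> is large
  a union bound is affordable (\<open>random_good_rows\<close>). The single-row tail and small-ball estimates
  come from one computation (\<open>uniform_sphere_quadratic_le\<close>): an event for the direction is a cone, the ratio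
  in which a cone cuts the ball is also the ratio in which it cuts any centred isotropic Gaussian weight, and the
  variance of that weight can be chosen so that the defining inequality of the cone turns the integral
  into a one-dimensional Gaussian integral.

  For the second part the same contraction criterion is applied to the singular values themselves, after
  checking that the supremum of the Rayleigh quotient is the square of a singular value
  (\<open>sigma_max_upper\<close>). What remains is the numerical inequality
  \<open>(1 / \<surd>(2 \<pi>)) \<integral> s\<^sup>2 exp (- s\<^sup>2 / 2) ds > w + 2 \<surd>w\<close> at \<open>\<beta> = 0.0056\<close>, roughly \<open>0.496 > 0.491\<close>
  (\<open>second_moment_bound\<close> and \<open>singular_ratio_threshold\<close>).
\<close>

section \<open>Cones under Lebesgue measure\<close>

abbreviation lebesgue_pow :: "nat \<Rightarrow> (nat \<Rightarrow> real) measure" where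
  "lebesgue_pow n \<equiv> PiM {..<n} (\<lambda>_. lborel)"

abbreviation sq :: "nat \<Rightarrow> (nat \<Rightarrow> real) \<Rightarrow> real" where
  "sq n x \<equiv> (\<Sum>j<n. (x j)\<^sup>2)"

abbreviation ip :: "nat \<Rightarrow> (nat \<Rightarrow> real) \<Rightarrow> (nat \<Rightarrow> real) \<Rightarrow> real" where
  "ip n x y \<equiv> (\<Sum>j<n. x j * y j)"

text \<open>Both sides are measures that agree on boxes, where the claim is one-dimensional scaling in each factor.\<close>

lemma emeasure_lebesgue_pow_scale:
  assumes r: "r > 0" and A: "A \<in> sets (lebesgue_pow n)"
  shows "emeasure (lebesgue_pow n) ((\<lambda>x. \<lambda>j\<in>{..<n}. x j / r) -` A \<inter> space (lebesgue_pow n))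
    = ennreal (r ^ n) * emeasure (lebesgue_pow n) A"
proof -
  interpret product_sigma_finite "\<lambda>_::nat. lborel :: real measure" ..
  let ?L = "lebesgue_pow n"
  let ?f = "\<lambda>x::nat\<Rightarrow>real. \<lambda>j\<in>{..<n}. x j / r"
  have f[measurable]: "?f \<in> ?L \<rightarrow>\<^sub>M ?L" by measurable
  have one: "emeasure lborel ((\<lambda>x. x / r) -` B) = ennreal r * emeasure lborel B" if B: "B \<in> sets borel" for B
  proof -
    have "emeasure lborel ((\<lambda>x. x / r) -` B) = emeasure (distr lborel borel ((*) (1/r))) B"
      using B by (subst emeasure_distr) (auto simp: vimage_def)
    also have "distr lborel borel ((*) (1/r)) = density lborel (\<lambda>_. ennreal r)"
      using r by (subst lborel_distr_mult) auto
    also have "emeasure \<dots> B = ennreal r * emeasure lborel B"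
      using B by (subst emeasure_density) (auto simp: nn_integral_cmult_indicator)
    finally show ?thesis .
  qed
  have "scale_measure (ennreal (1 / r ^ n)) (distr ?L ?L ?f) = ?L"
  proof (rule PiM_eqI)
    show "finite {..<n}" by simp
    show "sets (scale_measure (ennreal (1 / r ^ n)) (distr ?L ?L ?f)) = sets ?L" by simp
    fix B :: "nat \<Rightarrow> real set" assume B: "\<And>i. i \<in> {..<n} \<Longrightarrow> B i \<in> sets lborel"
    have BP: "PiE {..<n} B \<in> sets ?L" using B by (intro sets_PiM_I_finite) auto
    have "?f -` PiE {..<n} B \<inter> space ?L = PiE {..<n} (\<lambda>i. (\<lambda>x. x / r) -` B i)"
      by (auto simp: space_PiM PiE_iff)
    moreover have "(\<lambda>x. x / r) -` B i \<in> sets lborel" if "i \<in> {..<n}" for i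
      using measurable_sets_borel[of "\<lambda>x. x / r" borel "B i"] B[OF that] by simp
    ultimately have "emeasure (distr ?L ?L ?f) (PiE {..<n} B) = (\<Prod>i<n. emeasure lborel ((\<lambda>x. x / r) -` B i))"
      using BP by (subst emeasure_distr) (auto intro!: emeasure_PiM)
    also have "\<dots> = (\<Prod>i<n. ennreal r * emeasure lborel (B i))"
      using B by (intro prod.cong refl one) auto
    also have "\<dots> = ennreal (r ^ n) * (\<Prod>i<n. emeasure lborel (B i))"
      using r by (simp add: prod.distrib ennreal_power)
    finally show "emeasure (scale_measure (ennreal (1 / r ^ n)) (distr ?L ?L ?f)) (PiE {..<n} B) = (\<Prod>i\<in>{..<n}. emeasure lborel (B i))"
      using r by (simp add: mult.assoc[symmetric] ennreal_mult[symmetric])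
  qed
  then have "emeasure ?L A = ennreal (1 / r ^ n) * emeasure (distr ?L ?L ?f) A"
    by (metis emeasure_scale_measure)
  also have "emeasure (distr ?L ?L ?f) A = emeasure ?L (?f -` A \<inter> space ?L)"
    using A by (simp add: emeasure_distr)
  finally show ?thesis
    using r by (simp add: mult.assoc[symmetric] ennreal_mult[symmetric])
qed

text \<open>One implication suffices for invariance under scaling, because \<open>r\<close> may be replaced by \<open>1 / r\<close>; see
  \<open>cone_iff\<close>.\<close>

definition cone :: "nat \<Rightarrow> (nat \<Rightarrow> real) set \<Rightarrow> bool" where
  "cone n K \<longleftrightarrow> K \<in> sets (lebesgue_pow n) \<and>
     (\<forall>x\<in>space (lebesgue_pow n). \<forall>r>0. (\<lambda>j\<in>{..<n}. x j / r) \<in> K \<longrightarrow> x \<in> K)"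

lemma unit_ball_sq: "unit_ball n = {x \<in> space (lebesgue_pow n). sq n x \<le> 1}"
  by (auto simp: unit_ball_def L2_set_def space_PiM)

lemma cone_iff:
  assumes "cone n K" "x \<in> space (lebesgue_pow n)" "r > 0"
  shows "(\<lambda>j\<in>{..<n}. x j / r) \<in> K \<longleftrightarrow> x \<in> K"
proof -
  let ?y = "\<lambda>j\<in>{..<n}. x j / r"
  have "(\<lambda>j\<in>{..<n}. ?y j / (1/r)) = x"
    using assms(2,3) by (auto simp: space_PiM PiE_iff extensional_def fun_eq_iff)
  moreover have "?y \<in> space (lebesgue_pow n)" by (auto simp: space_PiM)
  moreover have "1/r > 0" using assms by simp
  ultimately show ?thesis using assms unfolding cone_def by metis
qed

lemma emeasure_cone_ball:
  assumes K: "cone n K" and r: "r > 0"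
  shows "emeasure (lebesgue_pow n) {x \<in> K. sq n x \<le> r\<^sup>2} = ennreal (r ^ n) * emeasure (lebesgue_pow n) (K \<inter> unit_ball n)"
proof -
  have KS: "K \<in> sets (lebesgue_pow n)" using K by (simp add: cone_def)
  have "sq n (\<lambda>j\<in>{..<n}. x j / r) = sq n x / r\<^sup>2" for x
    by (simp add: power_divide sum_divide_distrib)
  then have "(\<lambda>j\<in>{..<n}. x j / r) \<in> unit_ball n \<longleftrightarrow> sq n x \<le> r\<^sup>2" for x
    unfolding unit_ball_sq using r by (auto simp: space_PiM)
  then have "(\<lambda>x. \<lambda>j\<in>{..<n}. x j / r) -` (K \<inter> unit_ball n) \<inter> space (lebesgue_pow n) = {x \<in> K. sq n x \<le> r\<^sup>2}"
    using cone_iff[OF K _ r] sets.sets_into_space[OF KS] by blast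
  then show ?thesis
    using emeasure_lebesgue_pow_scale[OF r, of "K \<inter> unit_ball n" n] KS unit_ball_sets by simp
qed

text \<open>The radius of the superlevel set \<open>{x. s \<le> exp (- k \<parallel>x\<parallel>\<^sup>2 / 2)}\<close> is
  \<open>sqrt (- 2 ln s / k)\<close>. The integral cancels when a cone is compared with the whole space.\<close>

definition radial_mass :: "nat \<Rightarrow> real \<Rightarrow> ennreal" where
  "radial_mass n k = (\<integral>\<^sup>+s\<in>{0<..<1}. ennreal (sqrt (- 2 * ln s / k) ^ n) \<partial>lborel)"

text \<open>Layer-cake: the Gaussian weight is the integral over \<open>s\<close> of the indicators of its superlevel sets,
  which are balls, and the part of a cone in a ball of radius \<open>r\<close> has \<open>r ^ n\<close> times the volume of its part in the
  unit ball.\<close>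

lemma nn_integral_gaussian_cone:
  assumes K: "cone n K" and k: "k > 0"
  shows "(\<integral>\<^sup>+x\<in>K. ennreal (exp (- k * sq n x / 2)) \<partial>lebesgue_pow n)
    = radial_mass n k * emeasure (lebesgue_pow n) (K \<inter> unit_ball n)"
proof -
  interpret product_sigma_finite "\<lambda>_::nat. lborel :: real measure" ..
  interpret fin: finite_product_sigma_finite "\<lambda>_::nat. lborel :: real measure" "{..<n}" by standard simp
  let ?L = "lebesgue_pow n"
  interpret pair_sigma_finite lborel ?L ..
  have KS[measurable]: "K \<in> sets ?L" using K by (simp add: cone_def)
  let ?F = "\<lambda>s x. indicator {0<..<1} s * indicator K x * (if s \<le> exp (- k * sq n x / 2) then 1 else 0) :: ennreal"
  have level: "(\<integral>\<^sup>+s. indicator {0<..<1} s * (if s \<le> exp (- k * u / 2) then 1 else 0) \<partial>lborel)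
      = ennreal (exp (- k * u / 2))" if "u \<ge> 0" for u :: real
  proof -
    have 1: "exp (- k * u / 2) \<le> 1" using k that by (simp add: mult_nonneg_nonneg)
    \<comment> \<open>The level \<open>s = 1\<close>, whose ball has radius \<open>0\<close>, is left out; it is a null set.\<close>
    have "(\<integral>\<^sup>+s. indicator {0<..<1} s * (if s \<le> exp (- k * u / 2) then 1 else 0) \<partial>lborel)
      = (\<integral>\<^sup>+s. indicator {0<..exp (- k * u / 2)} s \<partial>lborel)"
      using AE_lborel_singleton[of "1::real"] order_trans[OF _ 1]
      by (intro nn_integral_cong_AE) (fastforce split: split_indicator elim!: eventually_mono)
    then show ?thesis by simp
  qed
  have "(\<integral>\<^sup>+x\<in>K. ennreal (exp (- k * sq n x / 2)) \<partial>?L) = (\<integral>\<^sup>+x. \<integral>\<^sup>+s. ?F s x \<partial>lborel \<partial>?L)"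
  proof (rule nn_integral_cong)
    fix x
    have "(\<integral>\<^sup>+s. ?F s x \<partial>lborel) = (\<integral>\<^sup>+s. indicator K x * (indicator {0<..<1} s * (if s \<le> exp (- k * sq n x / 2) then 1 else 0)) \<partial>lborel)"
      by (simp add: mult_ac)
    also have "\<dots> = indicator K x * ennreal (exp (- k * sq n x / 2))"
      by (subst nn_integral_cmult, measurable) (subst level, auto simp: sum_nonneg)
    finally show "ennreal (exp (- k * sq n x / 2)) * indicator K x = (\<integral>\<^sup>+s. ?F s x \<partial>lborel)" by (simp add: mult.commute)
  qed
  also have "\<dots> = (\<integral>\<^sup>+s. \<integral>\<^sup>+x. ?F s x \<partial>?L \<partial>lborel)"
    by (rule Fubini') measurable
  also have "\<dots> = (\<integral>\<^sup>+s. (ennreal (sqrt (- 2 * ln s / k) ^ n) * indicator {0<..<1} s) * emeasure ?L (K \<inter> unit_ball n) \<partial>lborel)"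
  proof (rule nn_integral_cong)
    fix s :: real
    show "(\<integral>\<^sup>+x. ?F s x \<partial>?L) = (ennreal (sqrt (- 2 * ln s / k) ^ n) * indicator {0<..<1} s) * emeasure ?L (K \<inter> unit_ball n)"
    proof (cases "0 < s \<and> s < 1")
      case True
      then have pos: "- 2 * ln s / k > 0" using k by (simp add: divide_neg_pos)
      have "s \<le> exp (- k * u / 2) \<longleftrightarrow> u \<le> (sqrt (- 2 * ln s / k))\<^sup>2" for u
      proof -
        have "s \<le> exp (- k * u / 2) \<longleftrightarrow> ln s \<le> - k * u / 2" using True ln_le_cancel_iff[of s "exp (- k * u / 2)"] by simp
        also have "\<dots> \<longleftrightarrow> u \<le> - 2 * ln s / k" using k by (simp add: field_simps) linarith
        finally show ?thesis using pos by simp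
      qed
      then have "(\<integral>\<^sup>+x. ?F s x \<partial>?L) = (\<integral>\<^sup>+x. indicator {x \<in> K. sq n x \<le> (sqrt (- 2 * ln s / k))\<^sup>2} x \<partial>?L)"
        using True by (intro nn_integral_cong) (auto split: split_indicator)
      also have "\<dots> = emeasure ?L {x \<in> K. sq n x \<le> (sqrt (- 2 * ln s / k))\<^sup>2}"
      proof (rule nn_integral_indicator)
        have "{x \<in> K. sq n x \<le> (sqrt (- 2 * ln s / k))\<^sup>2} = K \<inter> {x \<in> space ?L. sq n x \<le> (sqrt (- 2 * ln s / k))\<^sup>2}"
          using sets.sets_into_space[OF KS] by auto
        also have "\<dots> \<in> sets ?L" by measurable
        finally show "{x \<in> K. sq n x \<le> (sqrt (- 2 * ln s / k))\<^sup>2} \<in> sets ?L" .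
      qed
      also have "\<dots> = ennreal (sqrt (- 2 * ln s / k) ^ n) * emeasure ?L (K \<inter> unit_ball n)"
        using pos by (intro emeasure_cone_ball[OF K]) simp
      finally show ?thesis using True by simp
    qed auto
  qed
  also have "\<dots> = radial_mass n k * emeasure ?L (K \<inter> unit_ball n)"
    unfolding radial_mass_def by (subst nn_integral_multc) auto
  finally show ?thesis .
qed

section \<open>Gaussian integrals\<close>

abbreviation gauss1 :: "real measure" where
  "gauss1 \<equiv> density lborel (\<lambda>x. ennreal (std_normal_density x))"

lemma prob_space_gauss1: "prob_space gauss1"
  using prob_space_normal_density[of 1 0] by simp

lemma PiM_gauss1_density:
  "PiM {..<n} (\<lambda>_. gauss1) = density (lebesgue_pow n) (\<lambda>x. \<Prod>j<n. ennreal (std_normal_density (x j)))"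
proof -
  interpret N: product_prob_space "\<lambda>_::nat. gauss1"
    by (intro product_prob_spaceI prob_space_gauss1)
  interpret L: product_sigma_finite "\<lambda>_::nat. lborel :: real measure" ..
  show ?thesis
  proof (rule N.PiM_eqI[symmetric])
    show "sets (density (lebesgue_pow n) (\<lambda>x. \<Prod>j<n. ennreal (std_normal_density (x j)))) = sets (PiM {..<n} (\<lambda>_. gauss1))"
      unfolding sets_density by (intro sets_PiM_cong) auto
    fix A :: "nat \<Rightarrow> real set" assume A: "\<And>i. i \<in> {..<n} \<Longrightarrow> A i \<in> sets gauss1"
    have "emeasure (density (lebesgue_pow n) (\<lambda>x. \<Prod>j<n. ennreal (std_normal_density (x j)))) (PiE {..<n} A)
      = (\<integral>\<^sup>+x. (\<Prod>j<n. ennreal (std_normal_density (x j))) * indicator (PiE {..<n} A) x \<partial>lebesgue_pow n)"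
      using A by (intro emeasure_density sets_PiM_I_finite) auto
    also have "\<dots> = (\<integral>\<^sup>+x. (\<Prod>j<n. ennreal (std_normal_density (x j)) * indicator (A j) (x j)) \<partial>lebesgue_pow n)"
    proof (rule nn_integral_cong)
      fix x assume "x \<in> space (lebesgue_pow n)"
      then have "indicator (PiE {..<n} A) x = (\<Prod>j<n. indicator (A j) (x j) :: ennreal)"
        by (auto simp: space_PiM PiE_iff indicator_def prod_zero_iff)
      then show "(\<Prod>j<n. ennreal (std_normal_density (x j))) * indicator (PiE {..<n} A) x =
         (\<Prod>j<n. ennreal (std_normal_density (x j)) * indicator (A j) (x j))"
        by (simp add: prod.distrib)
    qed
    also have "\<dots> = (\<Prod>j<n. \<integral>\<^sup>+t. ennreal (std_normal_density t) * indicator (A j) t \<partial>lborel)"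
      using A by (intro L.product_nn_integral_prod) auto
    also have "\<dots> = (\<Prod>j\<in>{..<n}. emeasure gauss1 (A j))"
      using A by (intro prod.cong refl emeasure_density[symmetric]) auto
    finally show "emeasure (density (lebesgue_pow n) (\<lambda>x. \<Prod>j<n. ennreal (std_normal_density (x j)))) (PiE {..<n} A)
      = (\<Prod>j\<in>{..<n}. emeasure gauss1 (A j))" .
  qed simp
qed

text \<open>The inner product is a sum of independent centred normal variables with variances \<open>(y j)\<^sup>2\<close>. Coordinates with
  \<open>y j = 0\<close> are dropped first, because the addition theorem for normal variables asks for positive variances.\<close>

lemma distributed_gauss_ip:
  assumes y: "sq n y = 1"
  shows "distributed (PiM {..<n} (\<lambda>_. gauss1)) lborel (\<lambda>x. ip n x y) (normal_density 0 1)"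
proof -
  let ?G = "PiM {..<n} (\<lambda>_. gauss1)"
  interpret N: product_prob_space "\<lambda>_::nat. gauss1"
    by (intro product_prob_spaceI prob_space_gauss1)
  interpret G: prob_space ?G by (intro prob_space_PiM prob_space_gauss1)
  define I where "I = {j \<in> {..<n}. y j \<noteq> 0}"
  have comp: "distr ?G borel (\<lambda>x. x j) = gauss1" if "j < n" for j
  proof -
    have "distr ?G gauss1 (\<lambda>x. x j) = gauss1"
      using that by (intro distr_PiM_component prob_space_gauss1) auto
    then show ?thesis by (metis distr_cong sets_density sets_lborel)
  qed
  have "I \<noteq> {}"
  proof
    assume "I = {}"
    then have "sq n y = 0" by (intro sum.neutral) (auto simp: I_def)
    with y show False by simp
  qed
  then have "n \<noteq> 0" by (auto simp: I_def)
  have "G.indep_vars (\<lambda>_. borel) (\<lambda>j x. x j) {..<n}"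
  proof (subst G.indep_vars_iff_distr_eq_PiM')
    show "{..<n} \<noteq> {}" using \<open>n \<noteq> 0\<close> by auto
    show "(\<lambda>x. x i) \<in> borel_measurable ?G" if "i \<in> {..<n}" for i
      using measurable_component_singleton[OF that, of "\<lambda>_. gauss1"] by simp
    have "distr ?G (PiM {..<n} (\<lambda>_. borel)) (\<lambda>x. \<lambda>j\<in>{..<n}. x j) = distr ?G ?G (\<lambda>x. x)"
      by (intro distr_cong sets_PiM_cong) (auto simp: space_PiM PiE_iff extensional_restrict)
    also have "\<dots> = ?G" by (simp add: distr_id2)
    also have "?G = PiM {..<n} (\<lambda>i. distr ?G borel (\<lambda>x. x i))"
      by (intro PiM_cong) (simp_all add: comp)
    finally show "distr ?G (PiM {..<n} (\<lambda>_. borel)) (\<lambda>x. \<lambda>j\<in>{..<n}. x j) = PiM {..<n} (\<lambda>i. distr ?G borel (\<lambda>x. x i))" .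
  qed
  then have "G.indep_vars (\<lambda>_. borel) (\<lambda>j x. x j) I"
    by (rule G.indep_vars_subset) (auto simp: I_def)
  then have indep: "G.indep_vars (\<lambda>_. borel) (\<lambda>j x. 0 + y j * x j) I"
    by (rule G.indep_vars_compose2) simp
  have normal: "distributed ?G lborel (\<lambda>x. 0 + y j * x j) (normal_density (0 + y j * 0) (\<bar>y j\<bar> * 1))" if "j \<in> I" for j
  proof (rule G.normal_density_affine)
    have "distr ?G lborel (\<lambda>x. x j) = gauss1"
      using comp[of j] that by (metis (no_types, lifting) I_def distr_cong lessThan_iff mem_Collect_eq sets_lborel)
    moreover have "(\<lambda>x. x j) \<in> measurable ?G lborel"
      using that by (auto simp: I_def)
    ultimately show "distributed ?G lborel (\<lambda>x. x j) (normal_density 0 1)"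
      by (simp add: distributed_def)
  qed (use that in \<open>auto simp: I_def\<close>)
  have "distributed ?G lborel (\<lambda>x. \<Sum>j\<in>I. 0 + y j * x j)
     (normal_density (\<Sum>j\<in>I. 0 + y j * 0) (sqrt (\<Sum>j\<in>I. (\<bar>y j\<bar> * 1)\<^sup>2)))"
    by (rule G.sum_indep_normal[OF _ \<open>I \<noteq> {}\<close> indep _ normal]) (auto simp: I_def)
  moreover have "(\<Sum>j\<in>I. (y j)\<^sup>2) = 1"
    unfolding y[symmetric] by (rule sum.mono_neutral_left) (auto simp: I_def)
  moreover have "(\<Sum>j\<in>I. y j * x j) = ip n x y" for x
    unfolding mult.commute[of "x _"] by (rule sum.mono_neutral_left) (auto simp: I_def)
  ultimately show ?thesis by simp
qed

lemma nn_integral_gauss_ip: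
  assumes y: "sq n y = 1" and v: "v < 1"
  shows "(\<integral>\<^sup>+x. ennreal (exp (v * (ip n x y)\<^sup>2 / 2 - sq n x / 2)) \<partial>lebesgue_pow n)
    = ennreal (sqrt (2 * pi) ^ n / sqrt (1 - v))"
proof -
  let ?G = "PiM {..<n} (\<lambda>_. gauss1)"
  define c where "c = sqrt (2 * pi) ^ n"
  have c: "c > 0" by (simp add: c_def)
  have dens: "(\<Prod>j<n. ennreal (std_normal_density (x j))) = ennreal (exp (- sq n x / 2) / c)" for x :: "nat \<Rightarrow> real"
  proof -
    have "(\<Prod>j<n. std_normal_density (x j)) = exp (- sq n x / 2) / c"
      unfolding normal_density_def c_def
      by (simp add: prod.distrib exp_sum[symmetric] sum_negf sum_divide_distrib power_divide prod_dividef)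
    then show ?thesis by (simp add: prod_ennreal)
  qed
  have "(\<integral>\<^sup>+x. ennreal (exp (v * (ip n x y)\<^sup>2 / 2 - sq n x / 2)) \<partial>lebesgue_pow n)
    = (\<integral>\<^sup>+x. ennreal c * (ennreal (exp (- sq n x / 2) / c) * ennreal (exp (v * (ip n x y)\<^sup>2 / 2))) \<partial>lebesgue_pow n)"
  proof (rule nn_integral_cong)
    fix x
    have "exp (v * (ip n x y)\<^sup>2 / 2 - sq n x / 2) = c * (exp (- sq n x / 2) / c * exp (v * (ip n x y)\<^sup>2 / 2))"
      using c by (simp add: exp_add[symmetric])
    then show "ennreal (exp (v * (ip n x y)\<^sup>2 / 2 - sq n x / 2)) = ennreal c * (ennreal (exp (- sq n x / 2) / c) * ennreal (exp (v * (ip n x y)\<^sup>2 / 2)))"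
      using c by (simp add: ennreal_mult[symmetric])
  qed
  also have "\<dots> = ennreal c * (\<integral>\<^sup>+x. ennreal (exp (- sq n x / 2) / c) * ennreal (exp (v * (ip n x y)\<^sup>2 / 2)) \<partial>lebesgue_pow n)"
    by (rule nn_integral_cmult) measurable
  also have "(\<integral>\<^sup>+x. ennreal (exp (- sq n x / 2) / c) * ennreal (exp (v * (ip n x y)\<^sup>2 / 2)) \<partial>lebesgue_pow n)
    = (\<integral>\<^sup>+x. ennreal (exp (v * (ip n x y)\<^sup>2 / 2)) \<partial>?G)"
    unfolding PiM_gauss1_density dens by (rule nn_integral_density[symmetric]) measurable
  also have "\<dots> = (\<integral>\<^sup>+z. ennreal (normal_density 0 1 z) * ennreal (exp (v * z\<^sup>2 / 2)) \<partial>lborel)"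
    by (rule distributed_nn_integral[OF distributed_gauss_ip[OF y], symmetric]) measurable
  also have "\<dots> = (\<integral>\<^sup>+z. ennreal (1 / sqrt (1 - v)) * ennreal (normal_density 0 (1 / sqrt (1 - v)) z) \<partial>lborel)"
  proof (rule nn_integral_cong)
    fix z :: real
    have "normal_density 0 1 z * exp (v * z\<^sup>2 / 2) = 1 / sqrt (1 - v) * normal_density 0 (1 / sqrt (1 - v)) z"
      using v unfolding normal_density_def
      by (simp add: power_divide real_sqrt_divide exp_add[symmetric] field_simps)
    then show "ennreal (normal_density 0 1 z) * ennreal (exp (v * z\<^sup>2 / 2)) = ennreal (1 / sqrt (1 - v)) * ennreal (normal_density 0 (1 / sqrt (1 - v)) z)"
      using v by (simp add: ennreal_mult[symmetric])
  qed
  also have "\<dots> = ennreal (1 / sqrt (1 - v))"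
  proof -
    interpret prob_space "density lborel (\<lambda>x. ennreal (normal_density 0 (1 / sqrt (1 - v)) x))"
      using v by (intro prob_space_normal_density) simp
    have "(\<integral>\<^sup>+z. ennreal (normal_density 0 (1 / sqrt (1 - v)) z) \<partial>lborel) = 1"
      using emeasure_space_1 by (simp add: emeasure_density)
    then show ?thesis by (subst nn_integral_cmult) auto
  qed
  finally show ?thesis using c v by (simp add: ennreal_mult[symmetric] c_def)
qed

section \<open>Quadratic events on the sphere\<close>

lemma nn_integral_gauss_total:
  assumes k: "k > 0" and n: "n > 0"
  shows "(\<integral>\<^sup>+x. ennreal (exp (- k * sq n x / 2)) \<partial>lebesgue_pow n) = ennreal (sqrt (2 * pi / k) ^ n)"
proof -
  interpret L: product_sigma_finite "\<lambda>_::nat. lborel :: real measure" ..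
  have one: "(\<integral>\<^sup>+t. ennreal (exp (- k * t\<^sup>2 / 2)) \<partial>lborel) = ennreal (sqrt (2 * pi / k))"
  proof -
    interpret prob_space "density lborel (\<lambda>x. ennreal (normal_density 0 (1 / sqrt k) x))"
      using k by (intro prob_space_normal_density) simp
    have "(\<integral>\<^sup>+t. ennreal (exp (- k * t\<^sup>2 / 2)) \<partial>lborel)
      = (\<integral>\<^sup>+t. ennreal (sqrt (2 * pi / k)) * ennreal (normal_density 0 (1 / sqrt k) t) \<partial>lborel)"
    proof (rule nn_integral_cong)
      fix t :: real
      have "exp (- k * t\<^sup>2 / 2) = sqrt (2 * pi / k) * normal_density 0 (1 / sqrt k) t"
        using k unfolding normal_density_def by (simp add: power_divide)
      then show "ennreal (exp (- k * t\<^sup>2 / 2)) = ennreal (sqrt (2 * pi / k)) * ennreal (normal_density 0 (1 / sqrt k) t)"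
        using k by (simp add: ennreal_mult[symmetric])
    qed
    also have "\<dots> = ennreal (sqrt (2 * pi / k)) * (\<integral>\<^sup>+t. ennreal (normal_density 0 (1 / sqrt k) t) \<partial>lborel)"
      by (rule nn_integral_cmult) measurable
    also have "(\<integral>\<^sup>+t. ennreal (normal_density 0 (1 / sqrt k) t) \<partial>lborel) = 1"
      using emeasure_space_1 by (simp add: emeasure_density)
    finally show ?thesis by simp
  qed
  have "(\<integral>\<^sup>+x. ennreal (exp (- k * sq n x / 2)) \<partial>lebesgue_pow n)
    = (\<integral>\<^sup>+x. (\<Prod>j<n. ennreal (exp (- k * (x j)\<^sup>2 / 2))) \<partial>lebesgue_pow n)"
    by (intro nn_integral_cong) (simp add: prod_ennreal exp_sum[symmetric] sum_distrib_left sum_negf sum_divide_distrib)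
  also have "\<dots> = (\<Prod>j<n. \<integral>\<^sup>+t. ennreal (exp (- k * t\<^sup>2 / 2)) \<partial>lborel)"
    by (intro L.product_nn_integral_prod) auto
  also have "\<dots> = ennreal (sqrt (2 * pi / k) ^ n)"
    unfolding one using k by (simp add: ennreal_power)
  finally show ?thesis .
qed

abbreviation uniform_ball :: "nat \<Rightarrow> (nat \<Rightarrow> real) measure" where
  "uniform_ball n \<equiv> uniform_measure (lebesgue_pow n) (unit_ball n)"

text \<open>Compare \<open>K\<close> with the whole space under the weight \<open>exp (- (1 - u) \<parallel>x\<parallel>\<^sup>2 / 2)\<close>. On \<open>K\<close> the surplus
  \<open>u \<parallel>x\<parallel>\<^sup>2 / 2\<close> in the exponent is at most \<open>v \<langle>x, y\<rangle>\<^sup>2 / 2\<close>, which leaves a standard Gaussian expectation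
  in one dimension. Both \<open>u\<close> and \<open>v\<close> may be negative; that case gives the small-ball estimate.\<close>

lemma uniform_ball_cone_le:
  assumes K: "cone n K" and n: "n > 0" and y: "sq n y = 1" and u: "u < 1" and v: "v < 1"
    and le: "\<And>x. x \<in> K \<Longrightarrow> u * sq n x \<le> v * (ip n x y)\<^sup>2"
  shows "emeasure (uniform_ball n) K \<le> ennreal (sqrt (1 - u) ^ n / sqrt (1 - v))"
proof -
  let ?L = "lebesgue_pow n"
  define R where "R = radial_mass n (1 - u)"
  have k: "1 - u > 0" using u by simp
  have KS[measurable]: "K \<in> sets ?L" using K by (simp add: cone_def)
  have "cone n (space ?L)" unfolding cone_def by auto
  from nn_integral_gaussian_cone[OF this k] 
  have tot: "R * emeasure ?L (unit_ball n) = ennreal (sqrt (2 * pi / (1 - u)) ^ n)"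
    using nn_integral_gauss_total[OF k n] sets.sets_into_space[OF unit_ball_sets]
    by (simp add: R_def Int_absorb1 nn_integral_set_ennreal[symmetric] cong: nn_integral_cong_simp)
  have "R * emeasure ?L (K \<inter> unit_ball n) = (\<integral>\<^sup>+x\<in>K. ennreal (exp (- (1 - u) * sq n x / 2)) \<partial>?L)"
    unfolding R_def by (rule nn_integral_gaussian_cone[OF K k, symmetric])
  also have "\<dots> \<le> (\<integral>\<^sup>+x. ennreal (exp (v * (ip n x y)\<^sup>2 / 2 - sq n x / 2)) \<partial>?L)"
  proof (rule nn_integral_mono)
    fix x
    show "ennreal (exp (- (1 - u) * sq n x / 2)) * indicator K x \<le> ennreal (exp (v * (ip n x y)\<^sup>2 / 2 - sq n x / 2))"
    proof -
      have "- (1 - u) * sq n x / 2 = u * sq n x / 2 - sq n x / 2"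
        by (simp add: left_diff_distrib diff_divide_distrib)
      then show ?thesis
        using le[of x] by (auto split: split_indicator intro!: ennreal_leI)
    qed
  qed
  also have "\<dots> = ennreal (sqrt (2 * pi) ^ n / sqrt (1 - v))"
    by (rule nn_integral_gauss_ip[OF y v])
  finally have RK: "R * emeasure ?L (K \<inter> unit_ball n) \<le> ennreal (sqrt (2 * pi) ^ n / sqrt (1 - v))" .
  define a b where "a = measure ?L (unit_ball n)" and "b = measure ?L (K \<inter> unit_ball n)"
  have fin: "emeasure ?L (unit_ball n) < \<infinity>" using emeasure_unit_ball(2)[OF n] by (simp add: top.not_eq_extremum)
  have a: "emeasure ?L (unit_ball n) = ennreal a" using fin by (simp add: a_def emeasure_eq_ennreal_measure less_top[symmetric])
  have "emeasure ?L (K \<inter> unit_ball n) \<le> emeasure ?L (unit_ball n)" by (intro emeasure_mono unit_ball_sets) auto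
  then have b: "emeasure ?L (K \<inter> unit_ball n) = ennreal b" using fin
    by (metis b_def emeasure_eq_ennreal_measure infinity_ennreal_def leD)
  have apos: "a > 0" using emeasure_unit_ball(1)[OF n] a by (metis a_def ennreal_0 measure_nonneg order_less_le)
  have b0: "b \<ge> 0" by (simp add: b_def)
  have "R \<noteq> \<infinity>" using tot a apos by (auto simp: ennreal_top_mult)
  then obtain r where r: "R = ennreal r" "r \<ge> 0" by (cases R) auto
  have ra: "r * a = sqrt (2 * pi / (1 - u)) ^ n"
    using tot k r apos unfolding a by (simp add: ennreal_mult[symmetric])
  have rb: "r * b \<le> sqrt (2 * pi) ^ n / sqrt (1 - v)"
    using RK v r b0 unfolding b by (simp add: ennreal_mult[symmetric])
  have "sqrt (2 * pi / (1 - u)) ^ n > 0" using k by simp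
  then have rpos: "r > 0" using ra apos r by (metis mult_eq_0_iff order_less_le)
  have "b / a = (r * b) / (r * a)" using rpos by simp
  also have "\<dots> \<le> (sqrt (2 * pi) ^ n / sqrt (1 - v)) / (r * a)" using rb rpos apos by (intro divide_right_mono) auto
  also have "\<dots> = sqrt (1 - u) ^ n / sqrt (1 - v)"
    unfolding ra using k by (simp add: real_sqrt_divide power_divide)
  finally have "b / a \<le> sqrt (1 - u) ^ n / sqrt (1 - v)" .
  moreover have "emeasure (uniform_ball n) K = ennreal (b / a)"
    using emeasure_unit_ball[OF n] apos b0 by (subst emeasure_uniform_measure) (auto simp: unit_ball_sets Int_commute a b divide_ennreal)
  ultimately show ?thesis by (simp add: ennreal_leI)
qed

text \<open>The origin is projected to itself and not to the sphere, hence an inclusion instead of an equality of events.\<close>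

lemma uniform_sphere_le_ball:
  assumes S: "S \<in> sets (PiM {..<n} (\<lambda>_. borel :: real measure))" and K: "K \<in> sets (lebesgue_pow n)"
    and sub: "\<And>x. x \<in> space (lebesgue_pow n) \<Longrightarrow> (\<lambda>j\<in>{..<n}. x j / L2_set x {..<n}) \<in> S \<Longrightarrow> x \<in> K"
  shows "emeasure (uniform_sphere n) S \<le> emeasure (uniform_ball n) K"
proof -
  have "(\<lambda>x. \<lambda>j\<in>{..<n}. x j / L2_set x {..<n}) \<in> uniform_ball n \<rightarrow>\<^sub>M PiM {..<n} (\<lambda>_. borel)"
    unfolding uniform_measure_def L2_set_def by measurable
  then have "emeasure (uniform_sphere n) S = emeasure (uniform_ball n) ((\<lambda>x. \<lambda>j\<in>{..<n}. x j / L2_set x {..<n}) -` S \<inter> space (uniform_ball n))"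
    unfolding uniform_sphere_def using S by (rule emeasure_distr)
  also have "\<dots> \<le> emeasure (uniform_ball n) K"
    using K sub by (intro emeasure_mono) auto
  finally show ?thesis .
qed

lemma sets_uniform_sphere[simp, measurable_cong]: "sets (uniform_sphere n) = sets (PiM {..<n} (\<lambda>_. borel))"
  by (simp add: uniform_sphere_def)

lemma space_uniform_sphere[simp]: "space (uniform_sphere n) = PiE {..<n} (\<lambda>_. UNIV)"
  by (simp add: uniform_sphere_def space_PiM)

lemma L2_set_sq: "(L2_set x {..<n})\<^sup>2 = sq n x"
  by (simp add: L2_set_def sum_nonneg)

lemma cone_quadratic:
  "cone n {x \<in> space (lebesgue_pow n). c * sq n x \<le> d * (ip n x y)\<^sup>2}"
proof -
  have "{x \<in> space (lebesgue_pow n). c * sq n x \<le> d * (ip n x y)\<^sup>2} \<in> sets (lebesgue_pow n)"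
    by measurable
  moreover have "c * sq n x \<le> d * (ip n x y)\<^sup>2"
    if "r > 0" "c * sq n (\<lambda>j\<in>{..<n}. x j / r) \<le> d * (ip n (\<lambda>j\<in>{..<n}. x j / r) y)\<^sup>2" for x r
  proof -
    have 1: "sq n (\<lambda>j\<in>{..<n}. x j / r) = sq n x / r\<^sup>2" by (simp add: power_divide sum_divide_distrib)
    have "ip n (\<lambda>j\<in>{..<n}. x j / r) y = ip n x y / r" by (simp add: sum_divide_distrib)
    then have 2: "(ip n (\<lambda>j\<in>{..<n}. x j / r) y)\<^sup>2 = (ip n x y)\<^sup>2 / r\<^sup>2" by (simp add: power_divide)
    from that(2) have "(c * sq n x) / r\<^sup>2 \<le> (d * (ip n x y)\<^sup>2) / r\<^sup>2" unfolding 1 2 by simp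
    then show ?thesis using that(1) by (simp add: divide_le_cancel)
  qed
  ultimately show ?thesis unfolding cone_def by auto
qed

lemma uniform_sphere_quadratic_le:
  assumes n: "n > 0" and y: "sq n y = 1" and u: "u < 1" and v: "v < 1"
  shows "emeasure (uniform_sphere n) {a \<in> space (uniform_sphere n). u \<le> v * (ip n a y)\<^sup>2}
     \<le> ennreal (sqrt (1 - u) ^ n / sqrt (1 - v))"
proof -
  let ?S = "{a \<in> space (uniform_sphere n). u \<le> v * (ip n a y)\<^sup>2}"
  let ?K = "{x \<in> space (lebesgue_pow n). u * sq n x \<le> v * (ip n x y)\<^sup>2}"
  have "emeasure (uniform_sphere n) ?S \<le> emeasure (uniform_ball n) ?K"
  proof (rule uniform_sphere_le_ball)
    show "?S \<in> sets (PiM {..<n} (\<lambda>_. borel))"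
      unfolding sets_uniform_sphere[symmetric] by measurable
    show "?K \<in> sets (lebesgue_pow n)" by measurable
    fix x assume x: "x \<in> space (lebesgue_pow n)" and "(\<lambda>j\<in>{..<n}. x j / L2_set x {..<n}) \<in> ?S"
    then have le: "u \<le> v * (ip n (\<lambda>j\<in>{..<n}. x j / L2_set x {..<n}) y)\<^sup>2" by simp
    have "ip n (\<lambda>j\<in>{..<n}. x j / L2_set x {..<n}) y = ip n x y / L2_set x {..<n}"
      by (simp add: sum_divide_distrib)
    then have le': "u \<le> v * (ip n x y)\<^sup>2 / sq n x" using le by (simp add: power_divide L2_set_sq)
    show "x \<in> ?K"
    proof (cases "sq n x = 0")
      case True
      then have "\<forall>j<n. x j = 0" by (simp add: sum_nonneg_eq_0_iff)
      then show ?thesis using x by simp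
    next
      case False
      then have "sq n x > 0" by (simp add: sum_nonneg order_less_le)
      then show ?thesis using x le' by (simp add: field_simps)
    qed
  qed
  also have "\<dots> \<le> ennreal (sqrt (1 - u) ^ n / sqrt (1 - v))"
    by (rule uniform_ball_cone_le[OF cone_quadratic n y u v]) simp
  finally show ?thesis .
qed

text \<open>The quadratic estimate with \<open>u = - 1 / n\<close> and \<open>v = - 1 / t\<^sup>2\<close>.\<close>

lemma uniform_sphere_small_ball:
  assumes n: "n > 0" and y: "sq n y = 1" and t: "t > 0"
  shows "emeasure (uniform_sphere n) {a \<in> space (uniform_sphere n). real n * (ip n a y)\<^sup>2 \<le> t\<^sup>2} \<le> ennreal (2 * t)"
proof -
  let ?S = "{a \<in> space (uniform_sphere n). real n * (ip n a y)\<^sup>2 \<le> t\<^sup>2}"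
  let ?S' = "{a \<in> space (uniform_sphere n). - 1 / real n \<le> - 1 / t\<^sup>2 * (ip n a y)\<^sup>2}"
  have "?S = ?S'"
    using n t by (auto simp: field_simps)
  then have "emeasure (uniform_sphere n) {a \<in> space (uniform_sphere n). real n * (ip n a y)\<^sup>2 \<le> t\<^sup>2}
    \<le> ennreal (sqrt (1 - - 1 / real n) ^ n / sqrt (1 - - 1 / t\<^sup>2))"
  proof -
    have "0 < 1 / real n" "0 < 1 / t\<^sup>2" using n t by auto
    then have "- 1 / real n < 1" "- 1 / t\<^sup>2 < 1" by linarith+
    then show ?thesis unfolding \<open>?S = ?S'\<close> by (rule uniform_sphere_quadratic_le[OF n y])
  qed
  also have "sqrt (1 - - 1 / real n) ^ n / sqrt (1 - - 1 / t\<^sup>2) \<le> 2 / (1 / t)"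
  proof (rule frac_le)
    have "(1 + 1 / real n) ^ n \<le> exp (1 / real n) ^ n"
      by (intro power_mono) (auto simp: exp_ge_add_one_self)
    also have "\<dots> = exp 1" using n by (simp add: exp_of_nat_mult[symmetric])
    also have "\<dots> \<le> 2\<^sup>2" using exp_le by simp
    finally have "sqrt ((1 + 1 / real n) ^ n) \<le> sqrt (2\<^sup>2)" by (rule real_sqrt_le_mono)
    then show "sqrt (1 - - 1 / real n) ^ n \<le> 2" by (simp add: real_sqrt_power)
    have "1 / t = sqrt (1 / t\<^sup>2)" using t by (simp add: real_sqrt_divide)
    also have "\<dots> \<le> sqrt (1 - - 1 / t\<^sup>2)" by simp
    finally show "1 / t \<le> sqrt (1 - - 1 / t\<^sup>2)" .
  qed (use t in auto)
  finally show ?thesis by (simp add: ennreal_leI)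
qed

text \<open>The quadratic estimate with \<open>v = 1 / 2\<close>; the choice of \<open>u\<close> makes the bound exactly exponential and stays
  below \<open>1\<close> even for \<open>s > n\<close>, where the event is null.\<close>

lemma uniform_sphere_tail:
  assumes n: "n > 0" and y: "sq n y = 1"
  shows "emeasure (uniform_sphere n) {a \<in> space (uniform_sphere n). s \<le> real n * (ip n a y)\<^sup>2} \<le> ennreal (sqrt 2 * exp (- s / 4))"
proof -
  define u where "u = 1 - exp (- s / (2 * real n))"
  have "u < 1" by (simp add: u_def)
  have u: "u \<le> s / (2 * real n)" using exp_ge_add_one_self[of "- s / (2 * real n)"] by (simp add: u_def)
  have "u \<le> 1/2 * (ip n a y)\<^sup>2" if "s \<le> real n * (ip n a y)\<^sup>2" for a
  proof -
    have "s / (2 * real n) \<le> real n * (ip n a y)\<^sup>2 / (2 * real n)" using that by (intro divide_right_mono) auto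
    then show ?thesis using u n by simp
  qed
  then have "emeasure (uniform_sphere n) {a \<in> space (uniform_sphere n). s \<le> real n * (ip n a y)\<^sup>2}
    \<le> emeasure (uniform_sphere n) {a \<in> space (uniform_sphere n). u \<le> 1/2 * (ip n a y)\<^sup>2}"
    by (intro emeasure_mono) auto
  also have "\<dots> \<le> ennreal (sqrt (1 - u) ^ n / sqrt (1 - 1/2))"
    using \<open>u < 1\<close> by (intro uniform_sphere_quadratic_le[OF n y]) auto
  also have "sqrt (1 - u) ^ n / sqrt (1 - 1/2) = sqrt 2 * exp (- s / 4)"
  proof -
    have "sqrt (1 - u) = exp (- s / (4 * real n))"
    proof (rule real_sqrt_unique)
      show "(exp (- s / (4 * real n)))\<^sup>2 = 1 - u"
        unfolding u_def by (simp add: exp_double[symmetric])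
    qed simp
    then have "sqrt (1 - u) ^ n = exp (- s / 4)" using n by (simp add: exp_of_nat_mult[symmetric])
    then show ?thesis by (simp add: real_sqrt_divide)
  qed
  finally show ?thesis .
qed

text \<open>Sum of the geometric series that arises when \<open>exp (Y / 8)\<close> is cut at the integer values of
  \<open>Y = n \<langle>a, y\<rangle>\<^sup>2\<close>. The bound is uniform in the dimension and in \<open>y\<close>.\<close>

definition moment_bound :: real where
  "moment_bound = sqrt 2 * exp (1/8) / (1 - exp (- 1/8))"

lemma moment_bound_ge_1: "moment_bound \<ge> 1"
proof -
  have "1 - exp (- 1/8 :: real) \<le> sqrt 2 * exp (1/8)"
  proof -
    have "1 - exp (- 1/8 :: real) \<le> 1 * 1" by simp
    also have "\<dots> \<le> sqrt 2 * exp (1/8)" by (intro mult_mono) auto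
    finally show ?thesis .
  qed
  then show ?thesis by (simp add: moment_bound_def)
qed

lemma uniform_sphere_exp_moment:
  assumes n: "n > 0" and y: "sq n y = 1"
  shows "(\<integral>\<^sup>+a. ennreal (exp (real n * (ip n a y)\<^sup>2 / 8)) \<partial>uniform_sphere n) \<le> ennreal moment_bound"
proof -
  let ?M = "uniform_sphere n"
  let ?Y = "\<lambda>a. real n * (ip n a y)\<^sup>2"
  let ?A = "\<lambda>j::nat. {a \<in> space ?M. real j \<le> ?Y a}"
  have meas: "?A j \<in> sets ?M" for j by measurable
  have "(\<integral>\<^sup>+a. ennreal (exp (?Y a / 8)) \<partial>?M) \<le> (\<integral>\<^sup>+a. (\<Sum>j. ennreal (exp ((real j + 1) / 8)) * indicator (?A j) a) \<partial>?M)"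
  proof (rule nn_integral_mono)
    fix a assume a: "a \<in> space ?M"
    define j where "j = nat \<lfloor>?Y a\<rfloor>"
    have j: "real j \<le> ?Y a" "?Y a \<le> real j + 1" unfolding j_def by (auto simp: of_nat_nat)
    have "ennreal (exp (?Y a / 8)) \<le> ennreal (exp ((real j + 1) / 8)) * indicator (?A j) a"
      using j a by (simp add: ennreal_leI)
    also have "\<dots> \<le> (\<Sum>j. ennreal (exp ((real j + 1) / 8)) * indicator (?A j) a)"
    proof -
      define f where "f = (\<lambda>j::nat. ennreal (exp ((real j + 1) / 8)) * indicator (?A j) a)"
      have "sum f {j} \<le> suminf f" by (rule sum_le_suminf) auto
      then have "f j \<le> suminf f" by simp
      then show ?thesis unfolding f_def .
    qed
    finally show "ennreal (exp (?Y a / 8)) \<le> (\<Sum>j. ennreal (exp ((real j + 1) / 8)) * indicator (?A j) a)" .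
  qed
  also have "\<dots> = (\<Sum>j. \<integral>\<^sup>+a. ennreal (exp ((real j + 1) / 8)) * indicator (?A j) a \<partial>?M)"
    using meas by (intro nn_integral_suminf) measurable
  also have "\<dots> = (\<Sum>j. ennreal (exp ((real j + 1) / 8)) * emeasure ?M (?A j))"
    using meas by (simp add: nn_integral_cmult_indicator)
  also have "\<dots> \<le> (\<Sum>j. ennreal (sqrt 2 * exp (1/8) * exp (- 1/8) ^ j))"
  proof (intro suminf_le allI summableI)
    fix j :: nat
    have "ennreal (exp ((real j + 1) / 8)) * emeasure ?M (?A j) \<le> ennreal (exp ((real j + 1) / 8)) * ennreal (sqrt 2 * exp (- real j / 4))"
      by (intro mult_left_mono uniform_sphere_tail n y) auto
    also have "\<dots> = ennreal (sqrt 2 * exp (1/8) * exp (- 1/8) ^ j)"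
    proof -
      have "exp ((real j + 1) / 8) * exp (- real j / 4) = exp (1/8) * exp (- 1/8) ^ j"
        by (simp add: exp_of_nat_mult[symmetric] exp_add[symmetric] field_simps)
      then show ?thesis by (simp add: ennreal_mult[symmetric])
    qed
    finally show "ennreal (exp ((real j + 1) / 8)) * emeasure ?M (?A j) \<le> ennreal (sqrt 2 * exp (1/8) * exp (- 1/8) ^ j)" .
  qed
  also have "\<dots> = ennreal (sqrt 2 * exp (1/8) * (1 / (1 - exp (- 1/8))))"
    by (intro suminf_ennreal_eq sums_mult geometric_sums) auto
  finally show ?thesis by (simp add: moment_bound_def)
qed

lemma exponential_markov_PiM:
  fixes h :: "'a \<Rightarrow> real"
  assumes M: "prob_space M" and h[measurable]: "h \<in> borel_measurable M"
    and K: "K > 0" and moment: "(\<integral>\<^sup>+x. ennreal (exp (h x)) \<partial>M) \<le> ennreal K"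
  shows "emeasure (PiM {..<m} (\<lambda>_. M)) {a \<in> space (PiM {..<m} (\<lambda>_. M)). real m * (1 + ln K) \<le> (\<Sum>i<m. h (a i))}
    \<le> ennreal (exp (- real m))"
proof -
  let ?P = "PiM {..<m} (\<lambda>_. M)"
  interpret product_prob_space "\<lambda>_::nat. M" using M by (intro product_prob_spaceI)
  let ?S = "{a \<in> space ?P. real m * (1 + ln K) \<le> (\<Sum>i<m. h (a i))}"
  have S: "?S \<in> sets ?P" by measurable
  have "emeasure ?P ?S = (\<integral>\<^sup>+a. indicator ?S a \<partial>?P)" using S by simp
  also have "\<dots> \<le> (\<integral>\<^sup>+a. ennreal (exp (- (real m * (1 + ln K)))) * (\<Prod>i<m. ennreal (exp (h (a i)))) \<partial>?P)"
  proof (rule nn_integral_mono)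
    fix a
    have "ennreal (exp (- (real m * (1 + ln K)))) * (\<Prod>i<m. ennreal (exp (h (a i))))
      = ennreal (exp ((\<Sum>i<m. h (a i)) - real m * (1 + ln K)))"
      by (simp add: prod_ennreal exp_sum[symmetric] ennreal_mult[symmetric] exp_add[symmetric])
    then show "indicator ?S a \<le> ennreal (exp (- (real m * (1 + ln K)))) * (\<Prod>i<m. ennreal (exp (h (a i))))"
      by (auto split: split_indicator)
  qed
  also have "\<dots> = ennreal (exp (- (real m * (1 + ln K)))) * (\<Prod>i<m. \<integral>\<^sup>+x. ennreal (exp (h x)) \<partial>M)"
    by (subst nn_integral_cmult, measurable) (subst product_nn_integral_prod, auto)
  also have "\<dots> \<le> ennreal (exp (- (real m * (1 + ln K)))) * (\<Prod>i<m. ennreal K)"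
    by (intro mult_left_mono prod_mono_ennreal moment) auto
  also have "\<dots> = ennreal (exp (- (real m * (1 + ln K))) * K ^ m)"
    using K by (simp add: ennreal_power ennreal_mult[symmetric])
  also have "exp (- (real m * (1 + ln K))) * K ^ m = exp (- real m)"
  proof -
    have "K ^ m = exp (real m * ln K)" using K by (simp add: exp_of_nat_mult)
    then show ?thesis by (simp add: exp_add[symmetric] algebra_simps)
  qed
  finally show ?thesis .
qed

section \<open>A finite net of the sphere\<close>

lemma sum_half_powers_le: "(\<Sum>i\<in>{- int B..int B}. (1/2::real) ^ nat \<bar>i\<bar>) = 3 - 2 * (1/2) ^ B"
proof (induction B)
  case (Suc B)
  define S where "S = {- int B..int B}"
  have S: "{- int (Suc B)..int (Suc B)} = insert (- int (Suc B)) (insert (int (Suc B)) S)"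
    unfolding S_def by auto
  have "(\<Sum>i\<in>insert (- int (Suc B)) (insert (int (Suc B)) S). (1/2::real) ^ nat \<bar>i\<bar>)
      = (1/2) ^ Suc B + ((1/2) ^ Suc B + (\<Sum>i\<in>S. (1/2::real) ^ nat \<bar>i\<bar>))"
    by (subst sum.insert; (simp add: S_def del: of_nat_Suc power_Suc)?) 
  then show ?case unfolding S using Suc unfolding S_def[symmetric] by simp
qed simp

text \<open>Each lattice point of the \<open>l1\<close> ball has weight at least \<open>1\<close> under
  \<open>2 ^ (r n) \<Prod> 2 ^ (- \<bar>k j\<bar>)\<close>, and the total weight factorises over the coordinates. The cut-off \<open>B\<close>
  makes the set finite.\<close>

lemma card_lattice_l1_ball:
  "real (card {k \<in> PiE {..<n} (\<lambda>_. {- int B..int B}). (\<Sum>j<n. nat \<bar>k j\<bar>) \<le> r * n}) \<le> (2 ^ r * 3) ^ n"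
proof -
  define P where "P = PiE {..<n} (\<lambda>_. {- int B..int B})"
  define F where "F = {k \<in> P. (\<Sum>j<n. nat \<bar>k j\<bar>) \<le> r * n}"
  have fin: "finite P" unfolding P_def by (intro finite_PiE) auto
  define h where "h = (\<lambda>k. 2 ^ (r * n) * (\<Prod>j<n. (1/2::real) ^ nat \<bar>k j :: int\<bar>))"
  have h0: "h k \<ge> 0" for k unfolding h_def by (intro mult_nonneg_nonneg prod_nonneg) auto
  have h1: "1 \<le> h k" if k: "k \<in> F" for k
  proof -
    have "(1::real) = (2 * (1/2)) ^ (r * n)" by simp
    also have "\<dots> = 2 ^ (r * n) * (1/2) ^ (r * n)" by (rule power_mult_distrib)
    also have "\<dots> \<le> 2 ^ (r * n) * (1/2) ^ (\<Sum>j<n. nat \<bar>k j\<bar>)"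
      using k unfolding F_def by (intro mult_left_mono power_decreasing) auto
    also have "\<dots> = h k" unfolding h_def power_sum ..
    finally show ?thesis .
  qed
  have "real (card F) = (\<Sum>k\<in>F. 1)" by simp
  also have "\<dots> \<le> sum h F" by (intro sum_mono h1)
  also have "\<dots> \<le> sum h P" using fin h0 by (intro sum_mono2) (auto simp: F_def)
  also have "\<dots> = 2 ^ (r * n) * (\<Sum>k\<in>P. \<Prod>j<n. (1/2) ^ nat \<bar>k j\<bar>)" unfolding h_def sum_distrib_left ..
  also have "(\<Sum>k\<in>P. \<Prod>j<n. (1/2) ^ nat \<bar>k j\<bar>) = (\<Prod>j<n. \<Sum>i\<in>{- int B..int B}. (1/2::real) ^ nat \<bar>i\<bar>)"
    unfolding P_def by (rule prod_sum_PiE[symmetric]) auto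
  also have "\<dots> \<le> (\<Prod>j<n. 3)"
    unfolding sum_half_powers_le by (intro prod_mono) (auto intro: order_trans[OF mult_left_mono[of _ 1]] simp: power_le_one)
  finally show ?thesis unfolding F_def P_def by (simp add: power_mult power_mult_distrib)
qed

text \<open>Normalised points of the lattice of mesh \<open>1 / (N \<surd>n)\<close>. Rounding the coordinates of a unit vector
  costs \<open>1 / N\<close>, and normalising costs no more than that again. A lattice point has integer coordinates, so its
  \<open>l1\<close> norm is at most its squared Euclidean norm, here \<open>N\<^sup>2 n\<close>; this makes the cardinality exponential in \<open>n\<close>.\<close>

lemma sphere_net:
  assumes n: "n > 0" and N: "N \<ge> 2"
  obtains Z :: "(nat \<Rightarrow> real) set" where "finite Z" "real (card Z) \<le> (2 ^ (N\<^sup>2) * 3) ^ n"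
    "\<And>z. z \<in> Z \<Longrightarrow> sq n z = 1"
    "\<And>y. sq n y = 1 \<Longrightarrow> \<exists>z\<in>Z. sq n (\<lambda>j. y j - z j) \<le> (2 / real N)\<^sup>2"
proof -
  let ?P = "PiE {..<n} (\<lambda>_. {- int (N\<^sup>2 * n)..int (N\<^sup>2 * n)})"
  let ?F = "{k \<in> ?P. (\<Sum>j<n. nat \<bar>k j\<bar>) \<le> N\<^sup>2 * n}"
  define R where "R = (\<lambda>(k :: nat \<Rightarrow> int) j. real_of_int (k j))"
  define unit where "unit = (\<lambda>k j. R k j / L2_set (R k) {..<n})"
  define Z where "Z = unit ` {k \<in> ?F. sq n (R k) \<noteq> 0}"
  have finP: "finite ?P" by (intro finite_PiE) auto
  have "finite Z" unfolding Z_def using finP by simp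
  moreover have "real (card Z) \<le> (2 ^ (N\<^sup>2) * 3) ^ n"
  proof -
    have "card Z \<le> card {k \<in> ?F. sq n (R k) \<noteq> 0}" unfolding Z_def using finP by (intro card_image_le) simp
    also have "\<dots> \<le> card ?F" using finP by (intro card_mono) auto
    finally show ?thesis using card_lattice_l1_ball[of n "N\<^sup>2 * n" "N\<^sup>2"] by simp
  qed
  moreover have "sq n z = 1" if z: "z \<in> Z" for z
  proof -
    obtain k where k: "z = unit k" "sq n (R k) \<noteq> 0" using z by (auto simp: Z_def)
    have "sq n z = sq n (R k) / (L2_set (R k) {..<n})\<^sup>2"
      unfolding k(1) unit_def power_divide by (rule sum_divide_distrib[symmetric])
    then show ?thesis using k(2) by (simp add: L2_set_sq)
  qed
  moreover have "\<exists>z\<in>Z. sq n (\<lambda>j. y j - z j) \<le> (2 / real N)\<^sup>2" if y: "sq n y = 1" for y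
  proof -
    define c where "c = real N * sqrt (real n)"
    have c: "c > 0" using n N by (simp add: c_def)
    have c2: "c\<^sup>2 = real (N\<^sup>2 * n)" by (simp add: c_def power_mult_distrib)
    \<comment> \<open>Rounding towards zero, so that the lattice point is not longer than \<open>c y\<close>; this gives the
      \<open>l1\<close> bound needed for the count.\<close>
    define k where "k = (\<lambda>j\<in>{..<n}. if y j \<ge> 0 then \<lfloor>c * y j\<rfloor> else \<lceil>c * y j\<rceil>)"
    have close: "\<bar>c * y j - R k j\<bar> \<le> 1" and shrink: "\<bar>R k j\<bar> \<le> \<bar>c * y j\<bar>" if "j < n" for j
    proof -
      show "\<bar>c * y j - R k j\<bar> \<le> 1" using that by (auto simp: R_def k_def) linarith+
      show "\<bar>R k j\<bar> \<le> \<bar>c * y j\<bar>"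
      proof (cases "y j \<ge> 0")
        case True
        then have "c * y j \<ge> 0" using c by simp
        then show ?thesis using that True by (simp add: R_def k_def) 
      next
        case False
        then have "c * y j \<le> 0" using c by (simp add: mult_nonneg_nonpos)
        moreover have "real_of_int \<lceil>c * y j\<rceil> \<le> 0" using \<open>c * y j \<le> 0\<close> by simp
        moreover have "c * y j \<le> real_of_int \<lceil>c * y j\<rceil>" by (rule le_of_int_ceiling)
        moreover have "R k j = real_of_int \<lceil>c * y j\<rceil>" using that False by (simp add: R_def k_def)
        ultimately show ?thesis by linarith
      qed
    qed
    have sqk: "sq n (R k) \<le> c\<^sup>2"
    proof -
      have "sq n (R k) \<le> (\<Sum>j<n. (c * y j)\<^sup>2)" using shrink by (intro sum_mono) (simp add: abs_le_square_iff)
      also have "\<dots> = c\<^sup>2" using y by (simp add: power_mult_distrib sum_distrib_left[symmetric])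
      finally show ?thesis .
    qed
    have l1: "(\<Sum>j<n. nat \<bar>k j\<bar>) \<le> N\<^sup>2 * n"
    proof -
      have "real (\<Sum>j<n. nat \<bar>k j\<bar>) \<le> sq n (R k)"
      proof -
        have "real (nat \<bar>i\<bar>) \<le> (real_of_int i)\<^sup>2" for i :: int
        proof -
          have "\<bar>i\<bar> * 1 \<le> \<bar>i\<bar> * \<bar>i\<bar>"
          proof (cases "i = 0")
            case False
            then have "1 \<le> \<bar>i\<bar>" by simp
            then show ?thesis by (intro mult_left_mono) auto
          qed simp
          then have "\<bar>i\<bar> \<le> i\<^sup>2" by (simp add: power2_eq_square abs_mult_self_eq)
          then have "real_of_int \<bar>i\<bar> \<le> real_of_int (i\<^sup>2)" by (simp only: of_int_le_iff)
          then show ?thesis by simp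
        qed
        then show ?thesis by (simp add: R_def sum_mono)
      qed
      with sqk have "real (\<Sum>j<n. nat \<bar>k j\<bar>) \<le> real (N\<^sup>2 * n)" unfolding c2 by linarith
      then show ?thesis by (simp only: of_nat_le_iff)
    qed
    have kF: "k \<in> ?F"
    proof -
      have bd: "\<bar>k j\<bar> \<le> int (N\<^sup>2 * n)" if "j < n" for j
      proof -
        have "nat \<bar>k j\<bar> \<le> (\<Sum>j<n. nat \<bar>k j\<bar>)" using that by (intro member_le_sum) auto
        with l1 have "nat \<bar>k j\<bar> \<le> N\<^sup>2 * n" by linarith
        then show ?thesis by linarith
      qed
      have "k j \<in> {- int (N\<^sup>2 * n)..int (N\<^sup>2 * n)}" if "j < n" for j
        unfolding atLeastAtMost_iff using bd[OF that] by (intro conjI; linarith)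
      moreover have "k \<in> extensional {..<n}" by (simp add: k_def)
      ultimately have "k \<in> ?P" unfolding PiE_iff by blast
      with l1 show ?thesis by simp
    qed
    let ?n = "\<lambda>x. L2_set x {..<n}"
    have n1: "?n y = 1" using y by (simp add: L2_set_def)
    have diff: "?n (\<lambda>j. c * y j - R k j) \<le> sqrt (real n)"
    proof -
      have "(\<Sum>j<n. (c * y j - R k j)\<^sup>2) \<le> (\<Sum>j<n. 1)"
        using close by (intro sum_mono) (simp add: abs_square_le_1)
      then show ?thesis by (simp add: L2_set_def)
    qed
    have cy: "?n (\<lambda>j. c * y j) = c" using n1 c L2_set_right_distrib[of c y "{..<n}"] by simp
    have tri1: "c \<le> ?n (\<lambda>j. c * y j - R k j) + ?n (R k)"
      using L2_set_triangle_ineq[of "\<lambda>j. c * y j - R k j" "R k" "{..<n}"] cy by simp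
    have "sqrt (real n) > 0" using n by simp
    have "2 * sqrt (real n) \<le> c" unfolding c_def using N by (intro mult_right_mono) auto
    then have kpos: "?n (R k) > 0" using tri1 diff \<open>sqrt (real n) > 0\<close> by linarith
    then have "(?n (R k))\<^sup>2 \<noteq> 0" by simp
    then have "sq n (R k) \<noteq> 0" by (simp only: L2_set_sq not_False_eq_True)
    then have zZ: "unit k \<in> Z" unfolding Z_def using kF by blast
    have kc: "?n (R k) \<le> c" using sqk c by - (rule power2_le_imp_le, simp_all add: L2_set_sq)
    define t where "t = 1 - c / ?n (R k)"
    have split: "c * (y j - unit k j) = (c * y j - R k j) + t * R k j" for j
      unfolding unit_def t_def by (simp add: left_diff_distrib right_diff_distrib)
    have "c * ?n (\<lambda>j. y j - unit k j) = ?n (\<lambda>j. c * (y j - unit k j))"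
      using c by (intro L2_set_right_distrib) simp
    also have "\<dots> \<le> ?n (\<lambda>j. c * y j - R k j) + ?n (\<lambda>j. t * R k j)"
      unfolding split by (rule L2_set_triangle_ineq)
    finally have "c * ?n (\<lambda>j. y j - unit k j) \<le> ?n (\<lambda>j. c * y j - R k j) + ?n (\<lambda>j. t * R k j)" .
    moreover have "?n (\<lambda>j. t * R k j) = c - ?n (R k)"
    proof -
      have "t \<le> 0" unfolding t_def using kc kpos by simp
      have "?n (\<lambda>j. t * R k j) = ?n (\<lambda>j. (- t) * R k j)" by (simp add: L2_set_def power_mult_distrib)
      also have "\<dots> = (- t) * ?n (R k)" using \<open>t \<le> 0\<close> by (intro L2_set_right_distrib[symmetric]) simp
      also have "\<dots> = c - ?n (R k)" unfolding t_def using kpos by (simp add: left_diff_distrib)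
      finally show ?thesis .
    qed
    ultimately have "c * ?n (\<lambda>j. y j - unit k j) \<le> 2 * sqrt (real n)" using tri1 diff by linarith
    then have "(real N * ?n (\<lambda>j. y j - unit k j)) * sqrt (real n) \<le> 2 * sqrt (real n)"
      by (simp add: c_def mult_ac)
    then have "real N * ?n (\<lambda>j. y j - unit k j) \<le> 2"
      using \<open>sqrt (real n) > 0\<close> by (rule mult_right_le_imp_le)
    then have "?n (\<lambda>j. y j - unit k j) \<le> 2 / real N"
      using N by (simp add: pos_le_divide_eq mult.commute)
    then have "(?n (\<lambda>j. y j - unit k j))\<^sup>2 \<le> (2 / real N)\<^sup>2" by (intro power_mono) auto
    then have "sq n (\<lambda>j. y j - unit k j) \<le> (2 / real N)\<^sup>2" by (simp only: L2_set_sq)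
    with zZ show ?thesis by blast
  qed
  ultimately show ?thesis using that by blast
qed

section \<open>Extending estimates from a net\<close>

text \<open>The Euclidean norm of the image of \<open>y\<close> under the rows indexed by \<open>S\<close>.\<close>

abbreviation resp :: "nat \<Rightarrow> (nat \<Rightarrow> nat \<Rightarrow> real) \<Rightarrow> nat set \<Rightarrow> (nat \<Rightarrow> real) \<Rightarrow> real" where
  "resp n a S y \<equiv> L2_set (\<lambda>i. ip n (a i) y) S"

lemma resp_sq: "(resp n a S y)\<^sup>2 = (\<Sum>i\<in>S. (ip n (a i) y)\<^sup>2)"
  by (simp add: L2_set_def sum_nonneg)

lemma resp_triangle: "resp n a S y \<le> resp n a S z + resp n a S (\<lambda>j. y j - z j)"
proof -
  have "ip n (a i) y = ip n (a i) z + ip n (a i) (\<lambda>j. y j - z j)" for i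
    by (simp add: right_diff_distrib sum_subtractf)
  then show ?thesis using L2_set_triangle_ineq[of "\<lambda>i. ip n (a i) z" "\<lambda>i. ip n (a i) (\<lambda>j. y j - z j)" S] by simp
qed

lemma resp_scale: "c \<ge> 0 \<Longrightarrow> resp n a S (\<lambda>j. c * y j) = c * resp n a S y"
  by (simp add: L2_set_right_distrib sum_distrib_left mult_ac)

lemma unit_direction:
  assumes "sq n y \<noteq> 0"
  obtains u where "sq n u = 1" "y = (\<lambda>j. L2_set y {..<n} * u j)"
proof
  have "L2_set y {..<n} \<noteq> 0" using assms by (simp add: L2_set_def)
  then show "y = (\<lambda>j. L2_set y {..<n} * (y j / L2_set y {..<n}))" by simp
  show "sq n (\<lambda>j. y j / L2_set y {..<n}) = 1"
    using assms by (simp add: power_divide L2_set_sq sum_divide_distrib[symmetric])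
qed

lemma zero_norm_coords: "sq n y = 0 \<Longrightarrow> j < n \<Longrightarrow> y j = 0"
  by (simp add: sum_nonneg_eq_0_iff)

lemma resp_zero: "sq n y = 0 \<Longrightarrow> resp n a S y = 0"
  using zero_norm_coords[where n = n and y = y] by (simp add: L2_set_def)

lemma resp_le_from_sphere:
  assumes "\<And>u. sq n u = 1 \<Longrightarrow> resp n a S u \<le> K"
  shows "resp n a S y \<le> K * L2_set y {..<n}"
proof (cases "sq n y = 0")
  case True
  then show ?thesis by (simp add: resp_zero) (simp add: L2_set_def)
next
  case False
  then obtain u where u: "sq n u = 1" "y = (\<lambda>j. L2_set y {..<n} * u j)" by (rule unit_direction)
  define c where "c = L2_set y {..<n}"
  have yu: "y = (\<lambda>j. c * u j)" using u(2) unfolding c_def .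
  have "resp n a S y = c * resp n a S u"
    by (subst yu, rule resp_scale) (simp add: c_def)
  then have "resp n a S y = L2_set y {..<n} * resp n a S u" unfolding c_def .
  also have "\<dots> \<le> L2_set y {..<n} * K" using assms[OF u(1)] by (intro mult_left_mono) auto
  finally show ?thesis by (simp add: mult.commute)
qed

lemma resp_ge_from_sphere:
  assumes "\<And>u. sq n u = 1 \<Longrightarrow> K \<le> resp n a S u"
  shows "K * L2_set y {..<n} \<le> resp n a S y"
proof (cases "sq n y = 0")
  case True
  then show ?thesis by (simp add: resp_zero) (simp add: L2_set_def)
next
  case False
  then obtain u where u: "sq n u = 1" "y = (\<lambda>j. L2_set y {..<n} * u j)" by (rule unit_direction)
  define c where "c = L2_set y {..<n}"
  have yu: "y = (\<lambda>j. c * u j)" using u(2) unfolding c_def .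
  have "resp n a S y = c * resp n a S u"
    by (subst yu, rule resp_scale) (simp add: c_def)
  then have "resp n a S y = L2_set y {..<n} * resp n a S u" unfolding c_def .
  also have "\<dots> \<ge> L2_set y {..<n} * K" using assms[OF u(1)] by (intro mult_left_mono) auto
  finally show ?thesis by (simp add: mult.commute)
qed

text \<open>With \<open>K\<close> the supremum over the sphere, going to the nearest net point gives \<open>K \<le> M + K / 2\<close>. The crude
  Cauchy--Schwarz bound \<open>B\<close> guarantees that \<open>K\<close> is finite.\<close>

lemma resp_upper_from_net:
  assumes net: "\<And>y. sq n y = 1 \<Longrightarrow> \<exists>z\<in>Z. sq n (\<lambda>j. y j - z j) \<le> (1/2)\<^sup>2"
    and M: "\<And>z. z \<in> Z \<Longrightarrow> resp n a S z \<le> M"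
  shows "resp n a S y \<le> 2 * M * L2_set y {..<n}"
proof -
  define B where "B = sqrt (\<Sum>i\<in>S. sq n (a i))"
  have B: "resp n a S u \<le> B" if "sq n u = 1" for u
  proof -
    have "(\<Sum>i\<in>S. (ip n (a i) u)\<^sup>2) \<le> (\<Sum>i\<in>S. sq n (a i) * sq n u)"
      by (intro sum_mono Cauchy_Schwarz_ineq_sum)
    then show ?thesis using that by (simp add: B_def L2_set_def)
  qed
  define K where "K = (SUP u\<in>{u. sq n u = 1}. resp n a S u)"
  have bdd: "bdd_above (resp n a S ` {u. sq n u = 1})" using B by (intro bdd_aboveI[of _ B]) auto
  have K: "resp n a S u \<le> K" if "sq n u = 1" for u
    unfolding K_def using that by (intro cSUP_upper bdd) auto
  have step: "resp n a S u \<le> M + K / 2" if u: "sq n u = 1" for u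
  proof -
    obtain z where z: "z \<in> Z" "sq n (\<lambda>j. u j - z j) \<le> (1/2)\<^sup>2" using net[OF u] by auto
    have "L2_set (\<lambda>j. u j - z j) {..<n} \<le> 1/2"
      using real_sqrt_le_mono[OF z(2)] by (simp add: L2_set_def)
    have "K \<ge> 0" using K[OF u] L2_set_nonneg order_trans by blast
    have "resp n a S u \<le> resp n a S z + resp n a S (\<lambda>j. u j - z j)" by (rule resp_triangle)
    also have "resp n a S (\<lambda>j. u j - z j) \<le> K * L2_set (\<lambda>j. u j - z j) {..<n}"
      by (rule resp_le_from_sphere[OF K])
    also have "\<dots> \<le> K * (1/2)"
      using \<open>K \<ge> 0\<close> \<open>L2_set (\<lambda>j. u j - z j) {..<n} \<le> 1/2\<close> by (rule mult_left_mono[rotated])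
    finally show ?thesis using M[OF z(1)] by simp
  qed
  have "resp n a S u \<le> 2 * M" if u: "sq n u = 1" for u
  proof -
    have "K \<le> M + K / 2" unfolding K_def
      by (rule cSUP_least) (use u step in \<open>auto simp: K_def\<close>)
    then show ?thesis using K[OF u] by linarith
  qed
  then show ?thesis by (rule resp_le_from_sphere)
qed

text \<open>At a net point at most \<open>\<theta>\<close> responses are small, so at least \<open>\<theta>\<close> members of \<open>S\<close> contribute \<open>t\<^sup>2 / n\<close> each;
  moving to an arbitrary point of the sphere costs the operator norm times the mesh.\<close>

lemma resp_lower_from_net:
  assumes net: "\<And>y. sq n y = 1 \<Longrightarrow> \<exists>z\<in>Z. sq n (\<lambda>j. y j - z j) \<le> \<epsilon>\<^sup>2" and \<epsilon>: "\<epsilon> \<ge> 0"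
    and small: "\<And>z. z \<in> Z \<Longrightarrow> real (card {i. i < m \<and> real n * (ip n (a i) z)\<^sup>2 \<le> t\<^sup>2}) \<le> \<theta>"
    and K: "\<And>y. resp n a {..<m} y \<le> K * L2_set y {..<n}" and K0: "K \<ge> 0"
    and S: "S \<subseteq> {..<m}" and cS: "2 * \<theta> \<le> real (card S)" and n: "n > 0" and t: "t \<ge> 0"
  shows "(t * sqrt (\<theta> / n) - K * \<epsilon>) * L2_set y {..<n} \<le> resp n a S y"
proof (rule resp_ge_from_sphere)
  fix u assume u: "sq n u = 1"
  have finS: "finite S" using S by (rule finite_subset) simp
  obtain z where z: "z \<in> Z" "sq n (\<lambda>j. u j - z j) \<le> \<epsilon>\<^sup>2" using net[OF u] by auto
  have "L2_set (\<lambda>j. u j - z j) {..<n} \<le> \<epsilon>"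
    using real_sqrt_le_mono[OF z(2)] \<epsilon> by (simp add: L2_set_def)
  have "resp n a S (\<lambda>j. z j - u j) = resp n a S (\<lambda>j. u j - z j)"
  proof -
    have "ip n (a i) (\<lambda>j. z j - u j) = - ip n (a i) (\<lambda>j. u j - z j)" for i
      by (simp add: right_diff_distrib sum_subtractf)
    then show ?thesis by (simp add: L2_set_def)
  qed
  also have "\<dots> \<le> resp n a {..<m} (\<lambda>j. u j - z j)"
    unfolding L2_set_def using S by (intro real_sqrt_le_mono sum_mono2) auto
  also have "\<dots> \<le> K * L2_set (\<lambda>j. u j - z j) {..<n}" by (rule K)
  also have "\<dots> \<le> K * \<epsilon>" using K0 \<open>L2_set (\<lambda>j. u j - z j) {..<n} \<le> \<epsilon>\<close> by (intro mult_left_mono)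
  finally have near: "resp n a S z \<le> resp n a S u + K * \<epsilon>"
    using resp_triangle[where n = n and a = a and S = S and y = z and z = u] by linarith
  define D where "D = {i. i < m \<and> real n * (ip n (a i) z)\<^sup>2 \<le> t\<^sup>2}"
  have finD: "finite D" by (simp add: D_def)
  have "real (card S) \<le> real (card (S - D)) + real (card D)"
    using card_Diff_subset_Int[of S D] card_mono[OF finD, of "S \<inter> D"] finS by simp
  then have cSD: "\<theta> \<le> real (card (S - D))" using small[OF z(1)] cS unfolding D_def by linarith
  have "\<theta> * (t\<^sup>2 / n) \<le> real (card (S - D)) * (t\<^sup>2 / n)" using cSD by (intro mult_right_mono) auto
  also have "\<dots> = (\<Sum>i\<in>S - D. t\<^sup>2 / n)" by simp
  also have "\<dots> \<le> (\<Sum>i\<in>S - D. (ip n (a i) z)\<^sup>2)"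
  proof (rule sum_mono)
    fix i assume "i \<in> S - D"
    then have "t\<^sup>2 < real n * (ip n (a i) z)\<^sup>2" using S by (auto simp: D_def)
    then show "t\<^sup>2 / n \<le> (ip n (a i) z)\<^sup>2" using n by (simp add: pos_divide_le_eq mult.commute)
  qed
  also have "\<dots> \<le> (\<Sum>i\<in>S. (ip n (a i) z)\<^sup>2)" using finS by (intro sum_mono2) auto
  finally have "sqrt (t\<^sup>2 * (\<theta> / n)) \<le> resp n a S z"
    unfolding L2_set_def by (intro real_sqrt_le_mono) (simp add: mult_ac)
  then have "t * sqrt (\<theta> / n) \<le> resp n a S z" using t by (simp only: real_sqrt_mult real_sqrt_abs abs_of_nonneg)
  then show "t * sqrt (\<theta> / n) - K * \<epsilon> \<le> resp n a S u" using near by linarith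
qed

section \<open>Random rows\<close>

lemma uniform_sphere_unit: 
  assumes n: "n > 0"
  shows "emeasure (uniform_sphere n) {a \<in> space (uniform_sphere n). sq n a = 1} = 1"
proof -
  interpret product_sigma_finite "\<lambda>_::nat. lborel :: real measure" ..
  interpret prob_space "uniform_sphere n" using n by (rule prob_space_uniform_sphere)
  let ?B = "{a \<in> space (uniform_sphere n). sq n a \<noteq> 1}"
  let ?O = "PiE {..<n} (\<lambda>_. {0::real})"
  have O: "?O \<in> sets (lebesgue_pow n)" by (intro sets_PiM_I_finite) auto
  have "emeasure (lebesgue_pow n) ?O = 0" using n by (subst emeasure_PiM) auto
  then have O0: "emeasure (uniform_ball n) ?O = 0"
    using O emeasure_unit_ball[OF n] emeasure_mono[of "unit_ball n \<inter> ?O" ?O "lebesgue_pow n"]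
    by (simp add: emeasure_uniform_measure unit_ball_sets)
  have B: "?B \<in> sets (uniform_sphere n)" by measurable
  have "emeasure (uniform_sphere n) ?B \<le> emeasure (uniform_ball n) ?O"
  proof (rule uniform_sphere_le_ball[OF _ O])
    show "?B \<in> sets (PiM {..<n} (\<lambda>_. borel))" using B by simp
    fix x assume x: "x \<in> space (lebesgue_pow n)" and "(\<lambda>j\<in>{..<n}. x j / L2_set x {..<n}) \<in> ?B"
    then have "(\<Sum>j<n. (x j / L2_set x {..<n})\<^sup>2) \<noteq> 1" by simp
    then have "sq n x / sq n x \<noteq> 1" by (simp add: power_divide L2_set_sq sum_divide_distrib[symmetric])
    then have "sq n x = 0" by (cases "sq n x = 0") auto
    then show "x \<in> ?O" using x zero_norm_coords[where n = n and y = x]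
      by (intro PiE_I) (auto simp: space_PiM PiE_iff extensional_def)
  qed
  then have "emeasure (uniform_sphere n) ?B = 0" using O0 by simp
  then have "AE a in uniform_sphere n. sq n a = 1" using B by (intro AE_I[of _ _ ?B]) auto
  with AE_space have "AE a in uniform_sphere n. a \<in> {a \<in> space (uniform_sphere n). sq n a = 1}"
    by eventually_elim simp
  moreover have "{a \<in> space (uniform_sphere n). sq n a = 1} \<in> sets (uniform_sphere n)" by measurable
  ultimately show ?thesis by (intro emeasure_eq_1_AE)
qed

lemma prob_space_row_law: "n > 0 \<Longrightarrow> prob_space (row_law m n)"
  unfolding row_law_def by (intro prob_space_PiM prob_space_uniform_sphere)

lemma row_law_unit:
  assumes n: "n > 0"
  shows "{a \<in> space (row_law m n). \<forall>i<m. sq n (a i) = 1} \<in> sets (row_law m n)"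
    and "emeasure (row_law m n) {a \<in> space (row_law m n). \<forall>i<m. sq n (a i) = 1} = 1"
proof -
  interpret product_prob_space "\<lambda>_::nat. uniform_sphere n"
    using prob_space_uniform_sphere[OF n] by (intro product_prob_spaceI)
  define U where "U = {a \<in> space (uniform_sphere n). sq n a = 1}"
  have U: "U \<in> sets (uniform_sphere n)" unfolding U_def by measurable
  have U1: "emeasure (uniform_sphere n) U = 1" unfolding U_def by (rule uniform_sphere_unit[OF n])
  have "a \<in> space (row_law m n) \<and> (\<forall>i<m. sq n (a i) = 1) \<longleftrightarrow> a \<in> PiE {..<m} (\<lambda>_. U)" for a
    unfolding row_law_def space_PiM PiE_iff U_def by blast
  then have eq: "{a \<in> space (row_law m n). \<forall>i<m. sq n (a i) = 1} = PiE {..<m} (\<lambda>_. U)"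
    by blast
  show "{a \<in> space (row_law m n). \<forall>i<m. sq n (a i) = 1} \<in> sets (row_law m n)"
    unfolding eq unfolding row_law_def by (rule sets_PiM_I_finite[OF finite_lessThan U])
  have "emeasure (row_law m n) (PiE {..<m} (\<lambda>_. U)) = (\<Prod>i<m. emeasure (uniform_sphere n) U)"
    unfolding row_law_def by (rule emeasure_PiM[OF finite_lessThan U])
  then show "emeasure (row_law m n) {a \<in> space (row_law m n). \<forall>i<m. sq n (a i) = 1} = 1"
    unfolding eq U1 by simp
qed

text \<open>The level, per row, that \<open>exponential_markov_PiM\<close> yields for \<open>n \<langle>a, z\<rangle>\<^sup>2\<close>; the factor \<open>8\<close> undoes the
  scaling in \<open>uniform_sphere_exp_moment\<close>.\<close>

definition energy_level :: real where "energy_level = 8 * (1 + ln moment_bound)"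

lemma energy_level: "energy_level \<ge> 8"
  using ln_ge_zero[OF moment_bound_ge_1] by (simp add: energy_level_def)

lemma row_law_energy:
  assumes n: "n > 0" and z: "sq n z = 1"
  shows "emeasure (row_law m n) {a \<in> space (row_law m n). energy_level * m \<le> (\<Sum>i<m. real n * (ip n (a i) z)\<^sup>2)}
    \<le> ennreal (exp (- real m))"
proof -
  let ?h = "\<lambda>x. real n * (ip n x z)\<^sup>2 / 8"
  have h: "?h \<in> borel_measurable (uniform_sphere n)" by measurable
  have "real m * (1 + ln moment_bound) \<le> (\<Sum>i<m. ?h (a i)) \<longleftrightarrow> energy_level * m \<le> (\<Sum>i<m. real n * (ip n (a i) z)\<^sup>2)" for a
    by (simp add: energy_level_def sum_divide_distrib[symmetric] field_simps)
  then show ?thesis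
    using exponential_markov_PiM[OF prob_space_uniform_sphere[OF n] h _ uniform_sphere_exp_moment[OF n z], of m] moment_bound_ge_1
    by (simp add: row_law_def)
qed

text \<open>Markov's inequality for \<open>exp\<close> of the count weighted by \<open>2 / \<theta>\<close>. The radius \<open>t\<close> is chosen such that the
  small-ball probability \<open>2 t\<close> exactly compensates the factor \<open>exp (2 / \<theta>)\<close>, so each row contributes at most \<open>2\<close>
  to the moment.\<close>

lemma row_law_small_count:
  fixes \<theta> :: real
  assumes n: "n > 0" and z: "sq n z = 1" and \<theta>: "\<theta> > 0"
  defines "t \<equiv> exp (- 2 / \<theta>) / 2"
  shows "emeasure (row_law m n) {a \<in> space (row_law m n). \<theta> * m \<le> card {i. i < m \<and> real n * (ip n (a i) z)\<^sup>2 \<le> t\<^sup>2}}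
    \<le> ennreal (exp (- real m))"
proof -
  let ?M = "uniform_sphere n"
  define D where "D = {x \<in> space ?M. real n * (ip n x z)\<^sup>2 \<le> t\<^sup>2}"
  define h where "h = (\<lambda>x. 2 / \<theta> * indicator D x :: real)"
  interpret prob_space ?M using n by (rule prob_space_uniform_sphere)
  have t: "t > 0" by (simp add: t_def)
  have D: "D \<in> sets ?M" unfolding D_def by measurable
  have h[measurable]: "h \<in> borel_measurable ?M"
    unfolding h_def by (intro borel_measurable_times borel_measurable_const borel_measurable_indicator D)
  have "(\<integral>\<^sup>+x. ennreal (exp (h x)) \<partial>?M) \<le> (\<integral>\<^sup>+x. 1 + ennreal (exp (2 / \<theta>)) * indicator D x \<partial>?M)"
  proof (rule nn_integral_mono)
    show "ennreal (exp (h x)) \<le> 1 + ennreal (exp (2 / \<theta>)) * indicator D x" for x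
      by (cases "x \<in> D") (simp_all add: h_def)
  qed
  also have "\<dots> = (\<integral>\<^sup>+x. 1 \<partial>?M) + (\<integral>\<^sup>+x. ennreal (exp (2 / \<theta>)) * indicator D x \<partial>?M)"
    using D by (intro nn_integral_add) auto
  also have "\<dots> = 1 + ennreal (exp (2 / \<theta>)) * emeasure ?M D"
    using D by (simp add: nn_integral_cmult_indicator emeasure_space_1 del: space_uniform_sphere sets_uniform_sphere)
  also have "\<dots> \<le> 1 + ennreal (exp (2 / \<theta>)) * ennreal (2 * t)"
    unfolding D_def by (intro add_left_mono mult_left_mono uniform_sphere_small_ball n z t) simp
  also have "\<dots> = 1 + ennreal 1"
    using t by (simp add: t_def ennreal_mult[symmetric] exp_minus)
  also have "\<dots> = ennreal 2"
    by simp
  finally have mom: "(\<integral>\<^sup>+x. ennreal (exp (h x)) \<partial>?M) \<le> ennreal 2" .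
  have sub: "real m * (1 + ln 2) \<le> (\<Sum>i<m. h (a i))"
    if a: "a \<in> space (row_law m n)" and c: "\<theta> * m \<le> card {i. i < m \<and> real n * (ip n (a i) z)\<^sup>2 \<le> t\<^sup>2}" for a
  proof -
    have "a i \<in> space ?M" if "i < m" for i
      using a that unfolding row_law_def space_PiM PiE_iff by blast
    then have eq: "{i. i < m \<and> real n * (ip n (a i) z)\<^sup>2 \<le> t\<^sup>2} = {i \<in> {..<m}. a i \<in> D}"
      unfolding D_def by blast
    have "real m * (1 + ln 2) \<le> real m * 2" using ln_2_less_1 by (intro mult_left_mono) auto
    also have "\<dots> = 2 / \<theta> * (\<theta> * m)" using \<theta> by simp
    also have "\<dots> \<le> 2 / \<theta> * card {i \<in> {..<m}. a i \<in> D}" using c \<theta> unfolding eq by (intro mult_left_mono) auto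
    also have "real (card {i \<in> {..<m}. a i \<in> D}) = (\<Sum>i\<in>{i \<in> {..<m}. a i \<in> D}. 1)" by simp
    also have "\<dots> = (\<Sum>i<m. if a i \<in> D then 1 else 0)" by (rule sum.inter_filter) simp
    also have "\<dots> = (\<Sum>i<m. indicator D (a i))" by (intro sum.cong) auto
    finally show ?thesis by (simp add: sum_distrib_left h_def)
  qed
  have "emeasure (row_law m n) {a \<in> space (row_law m n). \<theta> * m \<le> card {i. i < m \<and> real n * (ip n (a i) z)\<^sup>2 \<le> t\<^sup>2}}
    \<le> emeasure (row_law m n) {a \<in> space (row_law m n). real m * (1 + ln 2) \<le> (\<Sum>i<m. h (a i))}"
  proof (rule emeasure_mono)
    show "{a \<in> space (row_law m n). real m * (1 + ln 2) \<le> (\<Sum>i<m. h (a i))} \<in> sets (row_law m n)"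
      unfolding row_law_def by measurable
  qed (use sub in blast)
  also have "\<dots> \<le> ennreal (exp (- real m))"
    unfolding row_law_def by (rule exponential_markov_PiM[OF prob_space_axioms h _ mom]) simp
  finally show ?thesis .
qed

text \<open>The two singular value bounds are relative to a common scale \<open>L\<close>, which is of order \<open>m / n\<close> for random
  rows; only their ratio \<open>\<rho>\<close> enters the contraction criterion.\<close>

definition good_rows :: "real \<Rightarrow> real \<Rightarrow> nat \<Rightarrow> nat \<Rightarrow> (nat \<Rightarrow> nat \<Rightarrow> real) \<Rightarrow> bool" where
  "good_rows p \<rho> m n a \<longleftrightarrow> (\<forall>i<m. sq n (a i) = 1) \<and>
     (\<exists>L>0. (\<forall>y. (\<Sum>i<m. (ip n (a i) y)\<^sup>2) \<le> L * sq n y) \<and>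
        (\<forall>y S. S \<subseteq> {..<m} \<and> p * m \<le> card S \<longrightarrow> \<rho> * L * sq n y \<le> (\<Sum>i\<in>S. (ip n (a i) y)\<^sup>2)))"

text \<open>Hypothesis \<open>N'\<close> makes the mesh so fine that the loss in \<open>resp_lower_from_net\<close> is at most
  half of the gain. Squaring the other half and dividing by the scale \<open>L = 4 energy_level (m / n)\<close> gives the
  constant \<open>32\<close>.\<close>

lemma good_rows_from_net:
  fixes p :: real
  assumes p: "0 < p" and N: "N \<ge> 4" and n: "n > 0" and m: "m > 0"
  defines "t \<equiv> exp (- 4 / p) / 2"
  assumes N': "16 * sqrt energy_level \<le> t * sqrt p * real N"
    and unit: "\<And>i. i < m \<Longrightarrow> sq n (a i) = 1"
    and net: "\<And>y. sq n y = 1 \<Longrightarrow> \<exists>z\<in>Z. sq n (\<lambda>j. y j - z j) \<le> (2 / real N)\<^sup>2"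
    and energy: "\<And>z. z \<in> Z \<Longrightarrow> (\<Sum>i<m. real n * (ip n (a i) z)\<^sup>2) < energy_level * m"
    and small: "\<And>z. z \<in> Z \<Longrightarrow> real (card {i. i < m \<and> real n * (ip n (a i) z)\<^sup>2 \<le> t\<^sup>2}) < p / 2 * m"
  shows "good_rows p (t\<^sup>2 * p / (32 * energy_level)) m n a"
proof -
  define M where "M = sqrt (energy_level * m / n)"
  have el: "energy_level > 0" using energy_level by simp
  have M: "M > 0" unfolding M_def using el n m by simp
  have t: "t > 0" by (simp add: t_def)
  have M2: "(2 * M)\<^sup>2 = 4 * energy_level * (m / n)" using el by (simp add: M_def power_mult_distrib)
  have netM: "resp n a {..<m} z \<le> M" if "z \<in> Z" for z
  proof -
    have "real n * (\<Sum>i<m. (ip n (a i) z)\<^sup>2) \<le> energy_level * m"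
      using energy[OF that] by (simp add: sum_distrib_left)
    then have "(\<Sum>i<m. (ip n (a i) z)\<^sup>2) \<le> energy_level * m / n"
      using n by (simp add: pos_le_divide_eq mult.commute)
    then show ?thesis unfolding L2_set_def M_def by (rule real_sqrt_le_mono)
  qed
  have half: "(2 / real N)\<^sup>2 \<le> (1/2)\<^sup>2" using N by (intro power_mono) (auto simp: field_simps)
  have up: "resp n a {..<m} y \<le> 2 * M * L2_set y {..<n}" for y
  proof (rule resp_upper_from_net[of n Z])
    show "\<exists>z\<in>Z. sq n (\<lambda>j. y j - z j) \<le> (1/2)\<^sup>2" if "sq n y = 1" for y
      using net[OF that] half by (meson order_trans)
  qed (use netM M in auto)
  define L where "L = 4 * energy_level * (m / n)"
  have L: "L > 0" using el n m by (simp add: L_def)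
  have "(\<Sum>i<m. (ip n (a i) y)\<^sup>2) \<le> L * sq n y" for y
  proof -
    have "(resp n a {..<m} y)\<^sup>2 \<le> (2 * M * L2_set y {..<n})\<^sup>2" by (intro power_mono up) auto
    then show ?thesis unfolding power_mult_distrib[of "2 * M"] M2 L2_set_sq resp_sq L_def by simp
  qed
  moreover have "t\<^sup>2 * p / (32 * energy_level) * L * sq n y \<le> (\<Sum>i\<in>S. (ip n (a i) y)\<^sup>2)"
    if S: "S \<subseteq> {..<m}" "p * m \<le> card S" for y S
  proof -
    define k where "k = t * sqrt (p / 2 * m / n) - 2 * M * (2 / real N)"
    define r where "r = sqrt (m / n)"
    have r: "r > 0" using n m by (simp add: r_def)
    have "k * L2_set y {..<n} \<le> resp n a S y"
      unfolding k_def
    proof (rule resp_lower_from_net[OF net _ _ up])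
      show "real (card {i. i < m \<and> real n * (ip n (a i) z)\<^sup>2 \<le> t\<^sup>2}) \<le> p / 2 * real m" if "z \<in> Z" for z
        using small[OF that] by simp
    qed (use M S t n in auto)
    moreover have k: "k \<ge> t * sqrt p * r / (2 * sqrt 2)"
    proof -
      have "M = sqrt energy_level * r" by (simp add: M_def r_def real_sqrt_mult real_sqrt_divide)
      moreover have "sqrt (p / 2 * m / n) = sqrt p * r / sqrt 2"
        by (simp add: r_def real_sqrt_mult real_sqrt_divide)
      ultimately have k: "k = t * sqrt p * r / sqrt 2 - (4 * sqrt energy_level / real N) * r"
        by (simp add: k_def)
      have "4 * sqrt energy_level / real N \<le> t * sqrt p / 4"
        using N' N by (simp add: pos_divide_le_eq)
      also have "\<dots> \<le> t * sqrt p / (2 * sqrt 2)"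
      proof (rule divide_left_mono)
        have "sqrt 2 \<le> sqrt (2\<^sup>2)" by (rule real_sqrt_le_mono) simp
        then show "2 * sqrt 2 \<le> (4::real)" by simp
      qed (use t p in auto)
      finally have "(4 * sqrt energy_level / real N) * r \<le> t * sqrt p / (2 * sqrt 2) * r"
        using r by (intro mult_right_mono) auto
      moreover have "t * sqrt p * r / sqrt 2 = 2 * (t * sqrt p / (2 * sqrt 2) * r)" by simp
      moreover have "t * sqrt p * r / (2 * sqrt 2) = t * sqrt p / (2 * sqrt 2) * r" by simp
      ultimately show ?thesis unfolding k by linarith
    qed
    ultimately have "t * sqrt p * r / (2 * sqrt 2) * L2_set y {..<n} \<le> resp n a S y"
      by (meson L2_set_nonneg mult_right_mono order_trans)
    then have "(t * sqrt p * r / (2 * sqrt 2) * L2_set y {..<n})\<^sup>2 \<le> (resp n a S y)\<^sup>2"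
      using t p r by (intro power_mono) auto
    then have "(t * sqrt p * r / (2 * sqrt 2))\<^sup>2 * sq n y \<le> (\<Sum>i\<in>S. (ip n (a i) y)\<^sup>2)"
      unfolding power_mult_distrib[of _ "L2_set y {..<n}"] L2_set_sq resp_sq .
    moreover have "(t * sqrt p * r / (2 * sqrt 2))\<^sup>2 = t\<^sup>2 * p / (32 * energy_level) * L"
      using p el by (simp add: power_divide power_mult_distrib r_def L_def mult_ac)
    ultimately show ?thesis by simp
  qed
  ultimately show ?thesis unfolding good_rows_def using unit L by (intro conjI allI impI exI[of _ L]) auto
qed

lemma real_card_Collect:
  fixes m :: nat
  shows "real (card {i. i < m \<and> P i}) = (\<Sum>i<m. if P i then 1 else 0)"
proof -
  have "{i. i < m \<and> P i} = {i \<in> {..<m}. P i}" by auto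
  then have "real (card {i. i < m \<and> P i}) = real (card {i \<in> {..<m}. P i})"
    by (rule arg_cong[where f = "\<lambda>S. real (card S)"])
  also have "\<dots> = (\<Sum>i\<in>{i \<in> {..<m}. P i}. 1)" by simp
  also have "\<dots> = (\<Sum>i<m. if P i then 1 else 0)" by (rule sum.inter_filter) simp
  finally show ?thesis .
qed

text \<open>Union bound: the net has at most \<open>D ^ n\<close> points, each fails with probability at most \<open>2 exp (- m)\<close>, and
  \<open>m \<ge> n (ln D + 1)\<close> leaves a total of at most \<open>2 exp (- n)\<close>.\<close>

lemma random_good_rows:
  fixes p :: real
  assumes p: "0 < p"
  shows "\<exists>\<rho>>0. \<forall>\<epsilon>>0. \<exists>N::real. \<forall>m n. N \<le> real m \<and> N \<le> real n \<and> N \<le> real m / real n \<longrightarrow>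
    (\<exists>E\<in>sets (row_law m n). (\<forall>a\<in>E. good_rows p \<rho> m n a) \<and> 1 - \<epsilon> \<le> measure (row_law m n) E)"
proof -
  define t where "t = exp (- 4 / p) / 2"
  define \<rho> where "\<rho> = t\<^sup>2 * p / (32 * energy_level)"
  have el: "energy_level > 0" using energy_level by simp
  have t: "t > 0" by (simp add: t_def)
  have "\<rho> > 0" unfolding \<rho>_def using el t p by simp
  obtain k :: nat where k: "16 * sqrt energy_level / (t * sqrt p) \<le> real k" using real_arch_simple by blast
  define K where "K = max 4 k"
  have K4: "K \<ge> 4" by (simp add: K_def)
  then have K2: "K \<ge> 2" by simp
  have "16 * sqrt energy_level \<le> t * sqrt p * real k"
    using k t p by (simp add: pos_divide_le_eq mult.commute)
  also have "\<dots> \<le> t * sqrt p * real K" using t p by (intro mult_left_mono) (auto simp: K_def)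
  finally have K: "16 * sqrt energy_level \<le> t * sqrt p * real K" .
  define D :: real where "D = 2 ^ (K\<^sup>2) * 3"
  have D: "D > 0" by (simp add: D_def)
  have "\<exists>E\<in>sets (row_law m n). (\<forall>a\<in>E. good_rows p \<rho> m n a) \<and> 1 - \<epsilon> \<le> measure (row_law m n) E"
    if \<epsilon>: "\<epsilon> > 0" and N: "max 1 (max (ln (2 / \<epsilon>)) (ln D + 1)) \<le> real m" 
      "max 1 (max (ln (2 / \<epsilon>)) (ln D + 1)) \<le> real n" "max 1 (max (ln (2 / \<epsilon>)) (ln D + 1)) \<le> real m / real n"
    for \<epsilon> :: real and m n :: nat
  proof -
    have n: "n > 0" and m: "m > 0" and nl: "ln (2 / \<epsilon>) \<le> real n" and ml: "ln D + 1 \<le> real m / real n"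
      using N by auto
    interpret P: prob_space "row_law m n" by (rule prob_space_row_law[OF n])
    obtain Z :: "(nat \<Rightarrow> real) set" where Z: "finite Z" "real (card Z) \<le> D ^ n"
      "\<And>z. z \<in> Z \<Longrightarrow> sq n z = 1"
      "\<And>y. sq n y = 1 \<Longrightarrow> \<exists>z\<in>Z. sq n (\<lambda>j. y j - z j) \<le> (2 / real K)\<^sup>2"
    proof (rule sphere_net[OF n K2])
      fix Z :: "(nat \<Rightarrow> real) set"
      assume "finite Z" "real (card Z) \<le> (2 ^ (K\<^sup>2) * 3) ^ n" "\<And>z. z \<in> Z \<Longrightarrow> sq n z = 1"
        "\<And>y. sq n y = 1 \<Longrightarrow> \<exists>z\<in>Z. sq n (\<lambda>j. y j - z j) \<le> (2 / real K)\<^sup>2"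
      then show thesis by (rule that[unfolded D_def])
    qed
    define B1 where "B1 z = {a \<in> space (row_law m n). energy_level * m \<le> (\<Sum>i<m. real n * (ip n (a i) z)\<^sup>2)}" for z
    define B2 where "B2 z = {a \<in> space (row_law m n). p / 2 * m \<le> card {i. i < m \<and> real n * (ip n (a i) z)\<^sup>2 \<le> t\<^sup>2}}" for z
    define U where "U = {a \<in> space (row_law m n). \<forall>i<m. sq n (a i) = 1}"
    have U: "U \<in> sets (row_law m n)" "emeasure (row_law m n) U = 1"
      unfolding U_def by (rule row_law_unit[OF n])+
    have B1: "B1 z \<in> sets (row_law m n)" for z
    proof -
      have [measurable]: "(\<lambda>x. real n * (ip n x z)\<^sup>2) \<in> borel_measurable (uniform_sphere n)" by measurable
      show ?thesis unfolding B1_def row_law_def by measurable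
    qed
    have B2: "B2 z \<in> sets (row_law m n)" for z
    proof -
      define g where "g = (\<lambda>x. if real n * (ip n x z)\<^sup>2 \<le> t\<^sup>2 then 1 else 0 :: real)"
      have [measurable]: "g \<in> borel_measurable (uniform_sphere n)" unfolding g_def by measurable
      have "B2 z = {a \<in> space (PiM {..<m} (\<lambda>_. uniform_sphere n)). p / 2 * m \<le> (\<Sum>i<m. g (a i))}"
        unfolding B2_def row_law_def real_card_Collect g_def ..
      also have "\<dots> \<in> sets (row_law m n)" unfolding row_law_def by measurable
      finally show ?thesis .
    qed
    define B where "B = (\<Union>z\<in>Z. B1 z \<union> B2 z)"
    have B: "B \<in> sets (row_law m n)" unfolding B_def using Z(1) B1 B2 by (intro sets.finite_UN sets.Un)
    have b1: "measure (row_law m n) (B1 z) \<le> exp (- real m)" if "z \<in> Z" for z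
      using row_law_energy[OF n Z(3)[OF that], of m] unfolding B1_def by (simp add: P.emeasure_eq_measure)
    have b2: "measure (row_law m n) (B2 z) \<le> exp (- real m)" if "z \<in> Z" for z
      using row_law_small_count[OF n Z(3)[OF that], of "p / 2" m] p unfolding B2_def t_def by (simp add: P.emeasure_eq_measure)
    have "measure (row_law m n) B \<le> (\<Sum>z\<in>Z. measure (row_law m n) (B1 z \<union> B2 z))"
      unfolding B_def using Z(1) B1 B2 by (intro P.finite_measure_subadditive_finite) auto
    also have "\<dots> \<le> (\<Sum>z\<in>Z. 2 * exp (- real m))"
    proof (rule sum_mono)
      fix z assume z: "z \<in> Z"
      have "measure (row_law m n) (B1 z \<union> B2 z) \<le> measure (row_law m n) (B1 z) + measure (row_law m n) (B2 z)"
        by (rule measure_Un_le[OF B1 B2])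
      then show "measure (row_law m n) (B1 z \<union> B2 z) \<le> 2 * exp (- real m)" using b1[OF z] b2[OF z] by linarith
    qed
    also have "\<dots> \<le> D ^ n * (2 * exp (- real m))" using Z(2) by (simp add: mult_right_mono)
    also have "\<dots> \<le> \<epsilon>"
    proof -
      have "D ^ n = exp (real n * ln D)" using D by (simp add: exp_of_nat_mult)
      then have "D ^ n * exp (- real m) = exp (real n * ln D - real m)" by (simp add: exp_diff exp_minus field_simps)
      also have "\<dots> \<le> exp (- ln (2 / \<epsilon>))"
      proof -
        have "real n * (ln D + 1) \<le> real m" using ml n by (simp add: pos_le_divide_eq mult.commute)
        then show ?thesis using nl by (simp add: algebra_simps)
      qed
      also have "\<dots> = \<epsilon> / 2" using \<epsilon> by (simp add: exp_minus)
      finally show ?thesis by simp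
    qed
    finally have Bm: "measure (row_law m n) B \<le> \<epsilon>" .
    have "measure (row_law m n) (U - B) = measure (row_law m n) U - measure (row_law m n) (U \<inter> B)"
      by (rule P.finite_measure_Diff'[OF U(1) B])
    also have "measure (row_law m n) U = 1" using U(2) by (simp add: measure_def)
    also have "1 - measure (row_law m n) (U \<inter> B) \<ge> 1 - measure (row_law m n) B"
      using U(1) B by (intro diff_left_mono P.finite_measure_mono) auto
    finally have "1 - \<epsilon> \<le> measure (row_law m n) (U - B)" using Bm by linarith
    moreover have "good_rows p \<rho> m n a" if a: "a \<in> U - B" for a
      unfolding \<rho>_def t_def
    proof (rule good_rows_from_net[OF p K4 n m K[unfolded t_def]])
      have as: "a \<in> space (row_law m n)" using a by (simp add: U_def)
      show "sq n (a i) = 1" if "i < m" for i using a that by (simp add: U_def)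
      show "\<exists>z\<in>Z. sq n (\<lambda>j. y j - z j) \<le> (2 / real K)\<^sup>2" if "sq n y = 1" for y using Z(4)[OF that] .
      fix z assume "z \<in> Z"
      then have "a \<notin> B1 z" "a \<notin> B2 z" using a by (auto simp: B_def)
      then show "(\<Sum>i<m. real n * (ip n (a i) z)\<^sup>2) < energy_level * m"
        and "real (card {i. i < m \<and> real n * (ip n (a i) z)\<^sup>2 \<le> (exp (- 4 / p) / 2)\<^sup>2}) < p / 2 * m"
        using as unfolding B1_def B2_def t_def by auto
    qed
    ultimately show ?thesis using U(1) B by blast
  qed
  note bound = this
  show ?thesis
  proof (rule exI[of _ \<rho>], intro conjI allI impI)
    fix \<epsilon> :: real assume \<epsilon>: "\<epsilon> > 0"
    show "\<exists>N::real. \<forall>m n. N \<le> real m \<and> N \<le> real n \<and> N \<le> real m / real n \<longrightarrow>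
      (\<exists>E\<in>sets (row_law m n). (\<forall>a\<in>E. good_rows p \<rho> m n a) \<and> 1 - \<epsilon> \<le> measure (row_law m n) E)"
      by (rule exI[of _ "max 1 (max (ln (2 / \<epsilon>)) (ln D + 1))"], intro allI impI bound[OF \<epsilon>]) auto
  qed fact
qed

section \<open>One step of the method\<close>

text \<open>Sorting permutes the values, hence any count can be read off from the sorted list.\<close>

lemma card_sort_nth:
  "card {i. i < m \<and> P (f i)} = card {j. j < m \<and> P (sort (map f [0..<m]) ! j)}"
proof -
  have "card {i. i < m \<and> P (f i)} = length (filter P (map f [0..<m]))"
    by (simp add: length_filter_conv_card cong: conj_cong)
  also have "\<dots> = length (filter P (sort (map f [0..<m])))"
    by (metis mset_filter mset_sort size_mset)
  also have "\<dots> = card {j. j < m \<and> P (sort (map f [0..<m]) ! j)}"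
    by (simp add: length_filter_conv_card)
  finally show ?thesis .
qed

lemma order_statistic_counts:
  fixes f :: "nat \<Rightarrow> 'a::linorder"
  assumes "1 \<le> k" "k \<le> m"
  defines "Q \<equiv> sort (map f [0..<m]) ! (k - 1)"
  shows "k \<le> card {i. i < m \<and> f i \<le> Q}" and "m - k + 1 \<le> card {i. i < m \<and> Q \<le> f i}"
proof -
  let ?xs = "sort (map f [0..<m])"
  have mono: "?xs ! i \<le> ?xs ! j" if "i \<le> j" "j < m" for i j
    using that by (intro sorted_nth_mono) auto
  have "card {..<k} \<le> card {j. j < m \<and> ?xs ! j \<le> Q}"
    using assms(1,2) mono unfolding Q_def by (intro card_mono) auto
  then show "k \<le> card {i. i < m \<and> f i \<le> Q}" using card_sort_nth[of m "\<lambda>t. t \<le> Q" f] by simp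
  have "card {k-1..<m} \<le> card {j. j < m \<and> Q \<le> ?xs ! j}"
    using assms(1,2) mono unfolding Q_def by (intro card_mono) auto
  then show "m - k + 1 \<le> card {i. i < m \<and> Q \<le> f i}"
    using card_sort_nth[of m "\<lambda>t. Q \<le> t" f] assms(1,2) by simp
qed

text \<open>Ties can make the admissible set larger than \<open>\<lceil>q m\<rceil>\<close>, so only inequalities hold. Rounding up is harmless in
  both directions, since the quantile itself is counted on each side.\<close>

lemma residual_quantile_counts:
  fixes A :: rmat and b z :: rvec
  assumes m: "dim_row A > 0" and q: "0 < q" "q \<le> 1"
  defines "m \<equiv> dim_row A" and "Q \<equiv> residual_quantile q A b z"
  shows "q * m \<le> card (admissible_rows q A b z)"
    and "(1 - q) * m \<le> card {i. i < m \<and> Q \<le> residual A b z i}"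
    and "admissible_rows q A b z \<noteq> {}"
proof -
  let ?k = "nat \<lceil>q * real m\<rceil>"
  have "q * real m \<le> real m" using q by (simp add: mult_left_le_one_le)
  then have "\<lceil>q * real m\<rceil> \<le> int m" by (simp add: ceiling_le_iff)
  moreover have "0 < q * real m" using m q by (simp add: m_def)
  then have "0 < \<lceil>q * real m\<rceil>" by simp
  ultimately have k: "1 \<le> ?k" "?k \<le> m" by linarith+
  have kk: "q * real m \<le> real ?k" "real ?k < q * real m + 1"
    using \<open>0 < \<lceil>q * real m\<rceil>\<close> by linarith+
  have Q: "Q = sort (map (residual A b z) [0..<m]) ! (?k - 1)"
    by (simp add: Q_def residual_quantile_def m_def)
  note cnt = order_statistic_counts[OF k, of "residual A b z", folded Q]
  have adm: "admissible_rows q A b z = {i. i < m \<and> residual A b z i \<le> Q}"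
    by (simp add: admissible_rows_def m_def Q_def)
  show "q * m \<le> card (admissible_rows q A b z)"
    using cnt(1) kk unfolding adm by linarith
  have "real (m - ?k + 1) = real m - real ?k + 1" using k by simp
  then show "(1 - q) * m \<le> card {i. i < m \<and> Q \<le> residual A b z i}"
    using cnt(2) kk by (simp add: left_diff_distrib)
  have "card (admissible_rows q A b z) \<noteq> 0" using cnt(1) k unfolding adm by linarith
  then show "admissible_rows q A b z \<noteq> {}" by auto
qed

lemma l2norm_sq: "(l2norm v)\<^sup>2 = v \<bullet> v"
  by (simp add: l2norm_def L2_set_def sum_nonneg scalar_prod_def power2_eq_square lessThan_atLeast0)

lemma l2norm_nonneg: "l2norm v \<ge> 0"
  by (simp add: l2norm_def)

lemma scalar_prod_self_update:
  fixes a e :: rvec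
  assumes "a \<in> carrier_vec n" "e \<in> carrier_vec n" "a \<bullet> a = 1"
  shows "(e - r \<cdot>\<^sub>v a) \<bullet> (e - r \<cdot>\<^sub>v a) = e \<bullet> e - 2 * r * (a \<bullet> e) + r\<^sup>2"
proof -
  have "(e - r \<cdot>\<^sub>v a) \<bullet> (e - r \<cdot>\<^sub>v a) = e \<bullet> e - r * (e \<bullet> a) - (r * (a \<bullet> e) - r * (r * (a \<bullet> a)))"
    using assms(1,2) by (simp add: minus_scalar_prod_distrib[of _ n] scalar_prod_minus_distrib[of _ n] algebra_simps)
  moreover have "e \<bullet> a = a \<bullet> e" using assms by (intro comm_scalar_prod)
  ultimately show ?thesis using assms(3) by (simp add: power2_eq_square algebra_simps)
qed

lemma update_minus:
  fixes a x z :: rvec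
  assumes "a \<in> carrier_vec n" "x \<in> carrier_vec n" "z \<in> carrier_vec n"
  shows "z + (c - d) \<cdot>\<^sub>v a - x = (z - x) - (d - c) \<cdot>\<^sub>v a"
  using assms by (intro eq_vecI) (auto simp: algebra_simps)

lemma sum_abs_le_sqrt_card:
  fixes f :: "'a \<Rightarrow> real"
  shows "(\<Sum>i\<in>S. \<bar>f i\<bar>) \<le> sqrt (card S) * sqrt (\<Sum>i\<in>S. (f i)\<^sup>2)"
  using L2_set_mult_ineq[of "\<lambda>_. 1" f S] by (simp add: L2_set_def)

text \<open>Here \<open>L\<close> plays the role of the squared largest singular value and \<open>s\<close> that of the squared smallest singular
  value over all sets of at least \<open>(q - \<beta>) m\<close> rows.\<close>

locale quantile_system =
  fixes A :: rmat and m n :: nat and q \<beta> s L :: real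
  assumes A: "A \<in> carrier_mat m n" and m: "m > 0"
    and q: "0 < q" and \<beta>: "0 \<le> \<beta>" and q\<beta>: "\<beta> < 1 - q"
    and unit_rows: "\<And>i. i < m \<Longrightarrow> Matrix.row A i \<bullet> Matrix.row A i = 1"
    and upper: "\<And>v. v \<in> carrier_vec n \<Longrightarrow> (\<Sum>i<m. (Matrix.row A i \<bullet> v)\<^sup>2) \<le> L * (v \<bullet> v)"
    and lower: "\<And>v S. v \<in> carrier_vec n \<Longrightarrow> S \<subseteq> {..<m} \<Longrightarrow> (q - \<beta>) * real m \<le> real (card S) \<Longrightarrow>
        s * (v \<bullet> v) \<le> (\<Sum>i\<in>S. (Matrix.row A i \<bullet> v)\<^sup>2)"
    and gap: "L * (\<beta> / (1 - q - \<beta>) + 2 * sqrt (\<beta> / (1 - q - \<beta>))) < s"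
    and L: "0 \<le> L"
begin

abbreviation "a i \<equiv> Matrix.row A i"
text \<open>\<open>odds\<close> bounds the number of corrupted rows per uncorrupted row with residual at least the quantile;
  \<open>\<kappa>\<close> is the guaranteed decrease relative to the squared error, summed over the admissible rows.\<close>

definition "odds = \<beta> / (1 - q - \<beta>)"
definition "\<kappa> = s - L * (odds + 2 * sqrt odds)"

lemma \<kappa>: "\<kappa> > 0" using gap by (simp add: \<kappa>_def odds_def)
lemma odds: "odds \<ge> 0" using \<beta> q\<beta> by (simp add: odds_def)
lemma a: "i < m \<Longrightarrow> a i \<in> carrier_vec n" using A by auto

context
  fixes b x z :: rvec
  assumes b: "b \<in> carrier_vec m" and x: "x \<in> carrier_vec n" and z: "z \<in> carrier_vec n"
    and corr: "real (l0norm (b - A *\<^sub>v x)) \<le> \<beta> * real m"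
begin

definition "corrupted = {i. i < m \<and> b $ i \<noteq> a i \<bullet> x}"
definition "selected = admissible_rows q A b z"
definition "threshold = residual_quantile q A b z"
definition "err i = a i \<bullet> (z - x)"
definition "err_sq = (z - x) \<bullet> (z - x)"

lemma err_sq_nonneg: "err_sq \<ge> 0" unfolding err_sq_def l2norm_sq[symmetric] by simp

lemma card_corrupted: "real (card corrupted) \<le> \<beta> * real m"
proof -
  have "corrupted = {i. i < dim_vec (b - A *\<^sub>v x) \<and> (b - A *\<^sub>v x) $ i \<noteq> 0}"
    using A b x by (auto simp: corrupted_def)
  then show ?thesis using corr by (simp add: l0norm_def)
qed

lemma selected: "finite selected" "selected \<noteq> {}" "selected \<subseteq> {..<m}"
  and card_selected: "q * real m \<le> real (card selected)"
  and card_large: "(1 - q) * real m \<le> card {i. i < m \<and> threshold \<le> residual A b z i}"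
proof -
  have q1: "q \<le> 1" using \<beta> q\<beta> by simp
  have dim: "dim_row A = m" using A by simp
  show "selected \<noteq> {}" "q * real m \<le> real (card selected)" "(1 - q) * real m \<le> card {i. i < m \<and> threshold \<le> residual A b z i}"
    using residual_quantile_counts[of A q b z] m q q1 unfolding dim selected_def threshold_def by auto
  show "selected \<subseteq> {..<m}" using dim by (auto simp: selected_def admissible_rows_def)
  then show "finite selected" by (rule finite_subset) simp
qed

lemma finite_corrupted: "finite corrupted" by (simp add: corrupted_def)

lemma residual_uncorrupted: "i < m \<Longrightarrow> i \<notin> corrupted \<Longrightarrow> residual A b z i = \<bar>err i\<bar>"
  using a[of i] x z unfolding residual_def corrupted_def err_def
  by (simp add: scalar_prod_minus_distrib[of _ n] comm_scalar_prod[of z n])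

lemma upper_err: "(\<Sum>i<m. (err i)\<^sup>2) \<le> L * err_sq"
  using upper[of "z - x"] x z by (simp add: err_def err_sq_def)

lemma threshold_nonneg: "threshold \<ge> 0"
proof -
  obtain i where "i \<in> selected" using selected by auto
  then show ?thesis by (auto simp: selected_def admissible_rows_def threshold_def residual_def)
qed

text \<open>At least \<open>(1 - q) m\<close> residuals reach the quantile and at most \<open>\<beta> m\<close> of them belong to corrupted rows. For the
  others the residual is \<open>\<bar>err i\<bar>\<close>, whose squares sum to at most \<open>L err_sq\<close>.\<close>

lemma threshold_bound: "(1 - q - \<beta>) * real m * threshold\<^sup>2 \<le> L * err_sq"
proof -
  let ?B = "{i. i < m \<and> threshold \<le> residual A b z i} - corrupted"
  have "real (card {i. i < m \<and> threshold \<le> residual A b z i}) \<le> real (card ?B) + real (card corrupted)"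
    using card_Diff_subset_Int[of "{i. i < m \<and> threshold \<le> residual A b z i}" corrupted] card_mono[OF finite_corrupted, of "{i. i < m \<and> threshold \<le> residual A b z i} \<inter> corrupted"] 
    by (simp add: finite_corrupted)
  then have "(1 - q - \<beta>) * real m \<le> real (card ?B)"
    using card_large card_corrupted by (simp add: left_diff_distrib)
  then have "(1 - q - \<beta>) * real m * threshold\<^sup>2 \<le> (\<Sum>i\<in>?B. threshold\<^sup>2)" by (simp add: mult_right_mono)
  also have "\<dots> \<le> (\<Sum>i\<in>?B. (err i)\<^sup>2)"
  proof (rule sum_mono)
    fix i assume i: "i \<in> ?B"
    then have "threshold \<le> \<bar>err i\<bar>" using residual_uncorrupted[of i] by auto
    then show "threshold\<^sup>2 \<le> (err i)\<^sup>2" using threshold_nonneg by (metis power2_abs power_mono)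
  qed
  also have "\<dots> \<le> (\<Sum>i<m. (err i)\<^sup>2)" by (intro sum_mono2) auto
  finally show ?thesis using upper_err by linarith
qed

text \<open>The harm done by the corrupted rows. The linear term is estimated by the Cauchy--Schwarz inequality, which uses that
  there are at most \<open>\<beta> m\<close> of them.\<close>

lemma corrupted_sum: "2 * threshold * (\<Sum>i\<in>selected \<inter> corrupted. \<bar>err i\<bar>) + real (card (selected \<inter> corrupted)) * threshold\<^sup>2 \<le> L * (odds + 2 * sqrt odds) * err_sq"
proof -
  have d: "(1 - q - \<beta>) * real m > 0" using q\<beta> m by simp
  have c: "real (card (selected \<inter> corrupted)) \<le> \<beta> * real m"
    using card_corrupted card_mono[OF finite_corrupted, of "selected \<inter> corrupted"] by simp
  have wm: "\<beta> * real m = odds * ((1 - q - \<beta>) * real m)" using q\<beta> by (simp add: odds_def)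
  have LE: "L * err_sq \<ge> 0" using L err_sq_nonneg by simp
  have "real (card (selected \<inter> corrupted)) * threshold\<^sup>2 \<le> \<beta> * real m * threshold\<^sup>2" using c by (intro mult_right_mono) auto
  also have "\<dots> = odds * ((1 - q - \<beta>) * real m * threshold\<^sup>2)" unfolding wm by simp
  also have "\<dots> \<le> odds * (L * err_sq)" using threshold_bound odds by (intro mult_left_mono) auto
  finally have 1: "real (card (selected \<inter> corrupted)) * threshold\<^sup>2 \<le> odds * (L * err_sq)" .
  have "(\<Sum>i\<in>selected \<inter> corrupted. \<bar>err i\<bar>) \<le> sqrt (card (selected \<inter> corrupted)) * sqrt (\<Sum>i\<in>selected \<inter> corrupted. (err i)\<^sup>2)"
    by (rule sum_abs_le_sqrt_card)
  also have "\<dots> \<le> sqrt (\<beta> * real m) * sqrt (L * err_sq)"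
  proof (intro mult_mono real_sqrt_le_mono c)
    have "(\<Sum>i\<in>selected \<inter> corrupted. (err i)\<^sup>2) \<le> (\<Sum>i<m. (err i)\<^sup>2)" using selected by (intro sum_mono2) auto
    then show "(\<Sum>i\<in>selected \<inter> corrupted. (err i)\<^sup>2) \<le> L * err_sq" using upper_err by linarith
  qed (auto simp: \<beta> sum_nonneg)
  finally have "threshold * (\<Sum>i\<in>selected \<inter> corrupted. \<bar>err i\<bar>) \<le> threshold * (sqrt (\<beta> * real m) * sqrt (L * err_sq))"
    using threshold_nonneg by (intro mult_left_mono)
  also have "\<dots> = sqrt odds * (sqrt ((1 - q - \<beta>) * real m * threshold\<^sup>2) * sqrt (L * err_sq))"
    unfolding wm using threshold_nonneg by (simp add: real_sqrt_mult)
  also have "\<dots> \<le> sqrt odds * (sqrt (L * err_sq) * sqrt (L * err_sq))"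
    using threshold_bound odds LE by (intro mult_left_mono mult_right_mono real_sqrt_le_mono) auto
  also have "\<dots> = sqrt odds * (L * err_sq)" using LE by simp
  finally show ?thesis using 1 by (simp add: algebra_simps)
qed

text \<open>The benefit from the uncorrupted rows: at least \<open>(q - \<beta>) m\<close> of them are admissible.\<close>

lemma uncorrupted_sum: "s * err_sq \<le> (\<Sum>i\<in>selected - corrupted. (err i)\<^sup>2)"
proof -
  have "real (card selected) \<le> real (card (selected - corrupted)) + real (card corrupted)"
    using card_Diff_subset_Int[of selected corrupted] card_mono[OF finite_corrupted, of "selected \<inter> corrupted"] selected by simp
  then have "(q - \<beta>) * real m \<le> real (card (selected - corrupted))"
    using card_selected card_corrupted by (simp add: left_diff_distrib)
  moreover have "selected - corrupted \<subseteq> {..<m}" using selected by auto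
  ultimately show ?thesis using lower[of "z - x" "selected - corrupted"] x z by (simp add: err_def err_sq_def)
qed

lemma update_norm:
  assumes i: "i \<in> selected"
  defines "z' \<equiv> z + (b $ i - a i \<bullet> z) \<cdot>\<^sub>v a i"
  shows "i \<notin> corrupted \<Longrightarrow> (l2norm (z' - x))\<^sup>2 = err_sq - (err i)\<^sup>2"
    and "(l2norm (z' - x))\<^sup>2 \<le> err_sq + 2 * threshold * \<bar>err i\<bar> + threshold\<^sup>2"
proof -
  have im: "i < m" using i selected by auto
  define r where "r = a i \<bullet> z - b $ i"
  have z': "z' - x = (z - x) - r \<cdot>\<^sub>v a i"
    using update_minus[OF a[OF im] x z] unfolding z'_def r_def .
  have n: "(l2norm (z' - x))\<^sup>2 = err_sq - 2 * r * err i + r\<^sup>2"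
    unfolding l2norm_sq z' err_sq_def err_def
    using a[OF im] x z unit_rows[OF im] by (intro scalar_prod_self_update) auto
  show "(l2norm (z' - x))\<^sup>2 = err_sq - (err i)\<^sup>2" if "i \<notin> corrupted"
  proof -
    have "r = err i" using that im a[OF im] x z unfolding r_def err_def corrupted_def
      by (simp add: scalar_prod_minus_distrib[of _ n])
    then show ?thesis using n by (simp add: power2_eq_square)
  qed
  have "\<bar>r\<bar> \<le> threshold"
    using i a[OF im] z by (simp add: selected_def admissible_rows_def threshold_def residual_def r_def comm_scalar_prod[of z n])
  then have "r\<^sup>2 \<le> threshold\<^sup>2" and "\<bar>r\<bar> * \<bar>err i\<bar> \<le> threshold * \<bar>err i\<bar>"
    using threshold_nonneg by (auto intro: mult_right_mono simp: abs_le_square_iff[symmetric])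
  moreover have "- (r * err i) \<le> \<bar>r\<bar> * \<bar>err i\<bar>" by (simp add: abs_mult[symmetric])
  ultimately show "(l2norm (z' - x))\<^sup>2 \<le> err_sq + 2 * threshold * \<bar>err i\<bar> + threshold\<^sup>2" unfolding n by linarith
qed

text \<open>The number of admissible rows varies with the iterate, but it is at most \<open>m\<close>, so the average decrease is at least
  \<open>\<kappa> err_sq / m\<close> whatever that number is.\<close>

lemma expected_step:
  "measure_pmf.expectation (qrk_step q A b z) (\<lambda>y. (l2norm (y - x))\<^sup>2) \<le> (1 - \<kappa> / real m) * (l2norm (z - x))\<^sup>2"
proof -
  let ?f = "\<lambda>i. (l2norm (z + (b $ i - a i \<bullet> z) \<cdot>\<^sub>v a i - x))\<^sup>2"
  have cpos: "real (card selected) > 0" using selected by (simp add: card_gt_0_iff)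
  have cm: "real (card selected) \<le> real m" using card_mono[OF _ selected(3)] by simp
  have "(\<Sum>i\<in>selected. ?f i) = (\<Sum>i\<in>selected - corrupted. ?f i) + (\<Sum>i\<in>selected \<inter> corrupted. ?f i)"
    using sum.Int_Diff[OF selected(1), of ?f corrupted] by linarith
  also have "(\<Sum>i\<in>selected - corrupted. ?f i) = real (card (selected - corrupted)) * err_sq - (\<Sum>i\<in>selected - corrupted. (err i)\<^sup>2)"
    using update_norm(1) by (simp add: sum_subtractf)
  also have "(\<Sum>i\<in>selected \<inter> corrupted. ?f i) \<le> (\<Sum>i\<in>selected \<inter> corrupted. err_sq + 2 * threshold * \<bar>err i\<bar> + threshold\<^sup>2)"
    using update_norm(2) by (intro sum_mono) auto
  also have "\<dots> = real (card (selected \<inter> corrupted)) * err_sq + (2 * threshold * (\<Sum>i\<in>selected \<inter> corrupted. \<bar>err i\<bar>) + real (card (selected \<inter> corrupted)) * threshold\<^sup>2)"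
    by (simp add: sum.distrib sum_distrib_left)
  finally have "(\<Sum>i\<in>selected. ?f i) \<le> (real (card (selected - corrupted)) + real (card (selected \<inter> corrupted))) * err_sq - s * err_sq + L * (odds + 2 * sqrt odds) * err_sq"
    using uncorrupted_sum corrupted_sum by (simp add: algebra_simps)
  also have "real (card (selected - corrupted)) + real (card (selected \<inter> corrupted)) = real (card selected)"
    using selected by (metis add.commute card_Int_Diff of_nat_add)
  finally have "(\<Sum>i\<in>selected. ?f i) \<le> real (card selected) * err_sq - \<kappa> * err_sq" by (simp add: \<kappa>_def algebra_simps)
  then have "(\<Sum>i\<in>selected. ?f i) / real (card selected) \<le> (real (card selected) * err_sq - \<kappa> * err_sq) / real (card selected)"
    using cpos by (intro divide_right_mono) auto
  also have "\<dots> = err_sq - \<kappa> * err_sq / real (card selected)" using cpos by (simp add: diff_divide_distrib)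
  also have "\<dots> \<le> err_sq - \<kappa> * err_sq / real m"
    using cpos cm \<kappa> err_sq_nonneg by (intro diff_left_mono divide_left_mono) auto
  also have "\<dots> = (1 - \<kappa> / real m) * err_sq" by (simp add: left_diff_distrib)
  finally show ?thesis
    using selected unfolding qrk_step_def selected_def[symmetric]
    by (simp add: integral_pmf_of_set err_sq_def[folded l2norm_sq])
qed

lemma finite_step: "finite (set_pmf (qrk_step q A b z))"
  and step_carrier: "set_pmf (qrk_step q A b z) \<subseteq> carrier_vec n"
  unfolding qrk_step_def selected_def[symmetric] using selected a z by (auto simp: set_pmf_of_set)

end

lemma converges: "converges_for_all_corruptions q \<beta> A"
proof -
  define c where "c = min 1 (\<kappa> / real m)"
  have c: "0 < c" "c \<le> 1" "1 - \<kappa> / real m \<le> 1 - c" using \<kappa> m by (auto simp: c_def)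
  have dim: "dim_row A = m" "dim_col A = n" using A by auto
  have "finite (set_pmf (qrk_iterate q A b x0 k)) \<and> set_pmf (qrk_iterate q A b x0 k) \<subseteq> carrier_vec n \<and>
      measure_pmf.expectation (qrk_iterate q A b x0 k) (\<lambda>y. (l2norm (y - x))\<^sup>2) \<le> (1 - c) ^ k * (l2norm (x0 - x))\<^sup>2"
    if x: "x \<in> carrier_vec n" and b: "b \<in> carrier_vec m" and corr: "real (l0norm (b - A *\<^sub>v x)) \<le> \<beta> * real m"
      and x0: "x0 \<in> carrier_vec n" for x b x0 k
  proof (induction k)
    case 0
    then show ?case using x0 by simp
  next
    case (Suc k)
    let ?p = "qrk_iterate q A b x0 k"
    let ?h = "\<lambda>y. (l2norm (y - x))\<^sup>2"
    have fin: "finite (set_pmf ?p)" and car: "\<And>y. y \<in> set_pmf ?p \<Longrightarrow> y \<in> carrier_vec n"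
      and IH: "measure_pmf.expectation ?p ?h \<le> (1 - c) ^ k * (l2norm (x0 - x))\<^sup>2"
      using Suc by auto
    have "measure_pmf.expectation (bind_pmf ?p (qrk_step q A b)) ?h
        = (\<Sum>y\<in>set_pmf ?p. pmf ?p y *\<^sub>R measure_pmf.expectation (qrk_step q A b y) ?h)"
      using fin car finite_step[OF b x _ corr] by (intro pmf_expectation_bind) auto
    also have "\<dots> \<le> (\<Sum>y\<in>set_pmf ?p. pmf ?p y *\<^sub>R ((1 - c) * ?h y))"
    proof (intro sum_mono scaleR_left_mono)
      fix y assume "y \<in> set_pmf ?p"
      then have "measure_pmf.expectation (qrk_step q A b y) ?h \<le> (1 - \<kappa> / real m) * ?h y"
        using car by (intro expected_step[OF b x _ corr])
      also have "\<dots> \<le> (1 - c) * ?h y" using c by (intro mult_right_mono) auto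
      finally show "measure_pmf.expectation (qrk_step q A b y) ?h \<le> (1 - c) * ?h y" .
    qed auto
    also have "\<dots> = (1 - c) * (\<Sum>y\<in>set_pmf ?p. pmf ?p y * ?h y)"
      by (simp add: sum_distrib_left mult_ac)
    also have "(\<Sum>y\<in>set_pmf ?p. pmf ?p y * ?h y) = measure_pmf.expectation ?p ?h"
      using fin by (subst integral_measure_pmf[of "set_pmf ?p"]) (auto simp: mult.commute)
    also have "(1 - c) * \<dots> \<le> (1 - c) * ((1 - c) ^ k * (l2norm (x0 - x))\<^sup>2)"
      using IH c by (intro mult_left_mono) auto
    finally show ?case
      using fin car finite_step[OF b x _ corr] step_carrier[OF b x _ corr]
      by (auto simp: mult.assoc)
  qed
  then show ?thesis unfolding converges_for_all_corruptions_def dim using c(1,2) by blast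
qed

end

lemma converges_antimono:
  assumes "converges_for_all_corruptions q \<beta> A" "\<beta>' \<le> \<beta>"
  shows "converges_for_all_corruptions q \<beta>' A"
  using assms mult_right_mono[OF assms(2), of "real (dim_row A)"]
  unfolding converges_for_all_corruptions_def by (meson of_nat_0_le_iff order_trans)

section \<open>Singular values\<close>

text \<open>Vectors with \<open>n\<close> coordinates live in \<open>nat \<Rightarrow> real\<close>; fixing the irrelevant coordinates to \<open>0\<close> makes the sphere
  a closed subset of a product of compact intervals.\<close>

lemma compact_unit_sphere: "compact {x :: nat \<Rightarrow> real. sq n x = 1 \<and> (\<forall>j\<ge>n. x j = 0)}"
proof -
  let ?K = "PiE UNIV (\<lambda>j. if j < n then {-1..1::real} else {0})"
  have "compactin (product_topology (\<lambda>_. euclidean) UNIV) ?K"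
    unfolding compactin_PiE by simp
  then have K: "compact ?K" unfolding euclidean_product_topology by simp
  have coord: "\<bar>x j\<bar> \<le> 1" if "sq n x = 1" "j < n" for x :: "nat \<Rightarrow> real" and j
  proof -
    have "(x j)\<^sup>2 \<le> sq n x" using that(2) by (intro member_le_sum) auto
    then show ?thesis using that(1) by (simp add: abs_square_le_1)
  qed
  have "{x. sq n x = 1 \<and> (\<forall>j\<ge>n. x j = 0)} = ?K \<inter> {x. sq n x = 1}"
  proof (intro equalityI subsetI)
    fix x assume x: "x \<in> {x. sq n x = 1 \<and> (\<forall>j\<ge>n. x j = 0)}"
    then have "x j \<in> (if j < n then {-1..1} else {0})" for j using coord[of x j] by (simp add: abs_le_iff)
    then show "x \<in> ?K \<inter> {x. sq n x = 1}" using x by (simp add: PiE_iff)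
  next
    fix x assume x: "x \<in> ?K \<inter> {x. sq n x = 1}"
    then have "x j \<in> (if j < n then {-1..1} else {0})" for j by (simp add: PiE_iff)
    from this[of j for j] have "x j = 0" if "j \<ge> n" for j using that by (metis not_le singletonD)
    then show "x \<in> {x. sq n x = 1 \<and> (\<forall>j\<ge>n. x j = 0)}" using x by simp
  qed
  moreover have "closed {x :: nat \<Rightarrow> real. sq n x = 1}"
    by (intro closed_Collect_eq continuous_intros) (auto intro: continuous_on_product_coordinates)
  ultimately show ?thesis using K by (simp add: compact_Int_closed)
qed

lemma sum_power2_line:
  fixes f g :: "'a \<Rightarrow> real"
  shows "(\<Sum>i\<in>S. (f i + t * g i)\<^sup>2) = (\<Sum>i\<in>S. (f i)\<^sup>2) + 2 * t * (\<Sum>i\<in>S. f i * g i) + t\<^sup>2 * (\<Sum>i\<in>S. (g i)\<^sup>2)"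
  by (simp add: power2_sum sum.distrib sum_distrib_left power_mult_distrib mult_ac)

text \<open>The nonnegative form \<open>\<mu> \<parallel>y\<parallel>\<^sup>2 - \<Sum> \<langle>a\<^sub>i, y\<rangle>\<^sup>2\<close> vanishes at a maximiser \<open>e\<close> of the Rayleigh
  quotient, so its derivative there vanishes in every direction. This is the eigenvalue equation in weak form.\<close>

lemma rayleigh_maximizer:
  fixes a :: "nat \<Rightarrow> nat \<Rightarrow> real"
  assumes n: "n > 0"
  obtains e \<mu> where "sq n e = 1" "\<mu> \<ge> 0" 
    "\<And>y. (\<Sum>i<m. (ip n (a i) y)\<^sup>2) \<le> \<mu> * sq n y"
    "\<And>y. (\<Sum>i<m. ip n (a i) e * ip n (a i) y) = \<mu> * ip n e y"
proof -
  let ?S = "{x :: nat \<Rightarrow> real. sq n x = 1 \<and> (\<forall>j\<ge>n. x j = 0)}"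
  let ?f = "\<lambda>y. resp n a {..<m} y"
  have "(\<Sum>j<n. (if j = 0 then 1 else 0 :: real)\<^sup>2) = (\<Sum>j<n. if j = 0 then 1 else 0)"
    by (intro sum.cong) auto
  also have "\<dots> = 1" using n by simp
  finally have "(\<lambda>j. if j = 0 then 1 else 0) \<in> ?S" using n by simp
  then have ne: "?S \<noteq> {}" by (metis empty_iff)
  have cont: "continuous_on ?S ?f"
  proof (rule continuous_on_subset)
    show "continuous_on UNIV ?f"
      unfolding L2_set_def 
      by (intro continuous_on_real_sqrt continuous_on_sum continuous_on_power continuous_on_mult continuous_on_const continuous_on_product_coordinates)
  qed simp
  from continuous_attains_sup[OF compact_unit_sphere ne cont]
  obtain e where e: "e \<in> ?S" and max_e: "\<forall>y\<in>?S. ?f y \<le> ?f e" ..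
  note max = bspec[OF max_e]
  define \<mu> where "\<mu> = (?f e)\<^sup>2"
  have sphere: "?f u \<le> ?f e" if u: "sq n u = 1" for u
  proof -
    define u' where "u' = (\<lambda>j. if j < n then u j else 0)"
    have "sq n u' = 1" using u by (simp add: u'_def)
    then have "?f u' \<le> ?f e" by (intro max) (simp add: u'_def)
    moreover have "ip n (a i) u' = ip n (a i) u" for i by (simp add: u'_def)
    ultimately show ?thesis by (simp add: L2_set_def)
  qed
  have upper: "(\<Sum>i<m. (ip n (a i) y)\<^sup>2) \<le> \<mu> * sq n y" for y
  proof -
    have "?f y \<le> ?f e * L2_set y {..<n}" by (rule resp_le_from_sphere[OF sphere])
    then have "(?f y)\<^sup>2 \<le> (?f e * L2_set y {..<n})\<^sup>2" by (rule power_mono) simp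
    then show ?thesis unfolding power_mult_distrib L2_set_sq resp_sq \<mu>_def .
  qed
  have \<mu>e: "(\<Sum>i<m. (ip n (a i) e)\<^sup>2) = \<mu>" unfolding \<mu>_def resp_sq ..
  have e1: "sq n e = 1" using e by simp
  have "(\<Sum>i<m. ip n (a i) e * ip n (a i) y) = \<mu> * ip n e y" for y
  proof -
    define \<beta> where "\<beta> = \<mu> * ip n e y - (\<Sum>i<m. ip n (a i) e * ip n (a i) y)"
    define \<gamma> where "\<gamma> = \<mu> * sq n y - (\<Sum>i<m. (ip n (a i) y)\<^sup>2)"
    have \<gamma>: "\<gamma> \<ge> 0" using upper[of y] by (simp add: \<gamma>_def)
    have quad: "0 \<le> 2 * t * \<beta> + t\<^sup>2 * \<gamma>" for t
    proof -
      have 1: "ip n (a i) (\<lambda>j. e j + t * y j) = ip n (a i) e + t * ip n (a i) y" for i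
        by (simp add: distrib_left sum.distrib sum_distrib_left mult_ac)
      have 2: "sq n (\<lambda>j. e j + t * y j) = sq n e + 2 * t * ip n e y + t\<^sup>2 * sq n y"
        by (rule sum_power2_line)
      have 3: "(\<Sum>i<m. (ip n (a i) e + t * ip n (a i) y)\<^sup>2)
         = (\<Sum>i<m. (ip n (a i) e)\<^sup>2) + 2 * t * (\<Sum>i<m. ip n (a i) e * ip n (a i) y) + t\<^sup>2 * (\<Sum>i<m. (ip n (a i) y)\<^sup>2)"
        by (rule sum_power2_line)
      have "(\<Sum>i<m. (ip n (a i) (\<lambda>j. e j + t * y j))\<^sup>2) \<le> \<mu> * sq n (\<lambda>j. e j + t * y j)" by (rule upper)
      then show ?thesis unfolding 1 2 3 \<mu>e e1 \<beta>_def \<gamma>_def by (simp add: algebra_simps)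
    qed
    have "\<beta> = 0"
    proof (rule ccontr)
      assume "\<beta> \<noteq> 0"
      \<comment> \<open>At \<open>t = - c \<beta>\<close> the linear term beats the quadratic one.\<close>
      define c where "c = 1 / (\<gamma> + 1)"
      have c: "c > 0" "c * (\<gamma> + 1) = 1" using \<gamma> by (auto simp: c_def)
      have "2 * (- c * \<beta>) * \<beta> + (- c * \<beta>)\<^sup>2 * \<gamma> = c * \<beta>\<^sup>2 * (c * (\<gamma> + 1) - c - 2)"
        by (simp add: algebra_simps power2_eq_square)
      also have "\<dots> = - (c * \<beta>\<^sup>2 * (1 + c))" unfolding c(2) by (simp add: algebra_simps)
      also have "\<dots> < 0" using c(1) \<open>\<beta> \<noteq> 0\<close> by (simp add: mult_pos_pos)
      finally show False using quad[of "- c * \<beta>"] by linarith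
    qed
    then show ?thesis by (simp add: \<beta>_def)
  qed
  then show ?thesis using that[OF e1 _ upper] by (simp add: \<mu>_def)
qed

lemma row_scalar_prod:
  assumes "A \<in> carrier_mat m n" "i < m" "v \<in> carrier_vec n"
  shows "Matrix.row A i \<bullet> v = ip n (\<lambda>j. A $$ (i, j)) (\<lambda>j. v $ j)"
  using assms by (simp add: scalar_prod_def lessThan_atLeast0)

lemma self_scalar_prod:
  assumes "v \<in> carrier_vec n"
  shows "v \<bullet> v = sq n (\<lambda>j. v $ j)"
  using assms by (simp add: scalar_prod_def lessThan_atLeast0 power2_eq_square)

lemma finite_singular_values:
  assumes A: "A \<in> carrier_mat m n"
  shows "finite (singular_values A)"
proof -
  let ?B = "transpose_mat A * A"
  have B: "?B \<in> carrier_mat n n" using A by simp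
  have "char_poly ?B \<noteq> 0" using degree_monic_char_poly[OF B] by auto
  then have "finite {k. eigenvalue ?B k}"
    unfolding eigenvalue_root_char_poly[OF B] by (rule poly_roots_finite)
  moreover have "(\<lambda>s. s\<^sup>2) ` singular_values A \<subseteq> {k. eigenvalue ?B k}"
    by (auto simp: singular_values_def)
  moreover have "inj_on (\<lambda>s. s\<^sup>2) (singular_values A)"
    by (rule inj_onI) (simp add: singular_values_def)
  ultimately show ?thesis by (meson finite_imageD finite_subset)
qed

text \<open>The maximum of the Rayleigh quotient is an eigenvalue of \<open>A\<^sup>T A\<close>, so its root is one of the finitely many singular
  values and hence at most the largest.\<close>

lemma sigma_max_upper:
  assumes A: "A \<in> carrier_mat m n" and n: "n > 0"
  shows "\<And>v. v \<in> carrier_vec n \<Longrightarrow> (\<Sum>i<m. (Matrix.row A i \<bullet> v)\<^sup>2) \<le> (sigma_max A)\<^sup>2 * (v \<bullet> v)"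
proof -
  define a where "a = (\<lambda>i j. A $$ (i, j))"
  obtain e \<mu> where e: "sq n e = 1" and \<mu>: "\<mu> \<ge> 0"
    and up: "\<And>y. (\<Sum>i<m. (ip n (a i) y)\<^sup>2) \<le> \<mu> * sq n y"
    and ev: "\<And>y. (\<Sum>i<m. ip n (a i) e * ip n (a i) y) = \<mu> * ip n e y"
    by (rule rayleigh_maximizer[OF n, where m = m and a = a]) blast
  let ?B = "transpose_mat A * A"
  let ?v = "Matrix.vec n e"
  have v: "?v \<in> carrier_vec n" by simp
  have eigen: "?B *\<^sub>v ?v = \<mu> \<cdot>\<^sub>v ?v"
  proof (rule eq_vecI)
    show "dim_vec (?B *\<^sub>v ?v) = dim_vec (\<mu> \<cdot>\<^sub>v ?v)" using A by simp
    fix k assume "k < dim_vec (\<mu> \<cdot>\<^sub>v ?v)"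
    then have k: "k < n" by simp
    define d :: "nat \<Rightarrow> real" where "d = (\<lambda>j. if j = k then 1 else 0)"
    have ipd: "ip n x d = x k" for x :: "nat \<Rightarrow> real" using k by (simp add: d_def sum.delta if_distrib cong: if_cong)
    have "(?B *\<^sub>v ?v) $ k = (transpose_mat A *\<^sub>v (A *\<^sub>v ?v)) $ k"
      using A v by (subst assoc_mult_mat_vec[of _ n m _ n]) auto
    also have "\<dots> = (\<Sum>i<m. A $$ (i, k) * ip n (a i) e)"
      using A k by (simp add: scalar_prod_def a_def lessThan_atLeast0)
    also have "\<dots> = (\<Sum>i<m. ip n (a i) e * ip n (a i) d)"
      unfolding ipd by (simp add: a_def mult.commute)
    also have "\<dots> = \<mu> * ip n e d" by (rule ev)
    also have "\<dots> = \<mu> * e k" unfolding ipd ..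
    finally show "(?B *\<^sub>v ?v) $ k = (\<mu> \<cdot>\<^sub>v ?v) $ k" using k by simp
  qed
  have nonzero: "?v \<noteq> 0\<^sub>v n"
  proof
    assume z: "?v = 0\<^sub>v n"
    have "e j = 0" if "j < n" for j using arg_cong[OF z, of "\<lambda>w. w $ j"] that by simp
    then have "sq n e = 0" by simp
    with e show False by simp
  qed
  have dimB: "dim_row ?B = n" using A by simp
  have "eigenvalue ?B \<mu>"
    unfolding eigenvalue_def eigenvector_def dimB using v nonzero eigen by blast
  then have "sqrt \<mu> \<in> singular_values A" using \<mu> by (simp add: singular_values_def)
  then have "sqrt \<mu> \<le> sigma_max A"
    unfolding sigma_max_def by (intro Max_ge finite_singular_values[OF A])
  then have "(sqrt \<mu>)\<^sup>2 \<le> (sigma_max A)\<^sup>2" using \<mu> by (intro power_mono) auto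
  then have le: "\<mu> \<le> (sigma_max A)\<^sup>2" using \<mu> by simp
  fix v :: rvec assume v: "v \<in> carrier_vec n"
  have "(\<Sum>i<m. (Matrix.row A i \<bullet> v)\<^sup>2) = (\<Sum>i<m. (ip n (a i) (\<lambda>j. v $ j))\<^sup>2)"
    using row_scalar_prod[OF A _ v] by (intro sum.cong) (auto simp: a_def)
  also have "\<dots> \<le> \<mu> * (v \<bullet> v)" using up[of "\<lambda>j. v $ j"] self_scalar_prod[OF v] by simp
  also have "\<dots> \<le> (sigma_max A)\<^sup>2 * (v \<bullet> v)"
    using le by (intro mult_right_mono) (auto simp: l2norm_sq[symmetric])
  finally show "(\<Sum>i<m. (Matrix.row A i \<bullet> v)\<^sup>2) \<le> (sigma_max A)\<^sup>2 * (v \<bullet> v)" .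
qed

text \<open>\<open>pick S\<close> enumerates \<open>S\<close> increasingly; it indexes the rows of a submatrix.\<close>

lemma pick_bij:
  assumes "finite S"
  shows "bij_betw (pick S) {..<card S} S"
proof -
  have "pick S ` {..<card S} = S"
  proof
    show "pick S ` {..<card S} \<subseteq> S" using pick_in_set_le by auto
    show "S \<subseteq> pick S ` {..<card S}"
    proof
      fix i assume i: "i \<in> S"
      then have "{a \<in> S. a < i} \<subset> S" by auto
      then have "card {a \<in> S. a < i} < card S" using assms by (rule psubset_card_mono[rotated])
      then show "i \<in> pick S ` {..<card S}"
        by (intro image_eqI[where x = "card {a \<in> S. a < i}"] pick_card_in_set[OF i, symmetric] lessThan_iff[THEN iffD2])
    qed
  qed
  moreover from this have "inj_on (pick S) {..<card S}" by (intro eq_card_imp_inj_on) simp_all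
  ultimately show ?thesis unfolding bij_betw_def by blast
qed

lemma l2norm_submatrix_mult:
  assumes A: "A \<in> carrier_mat m n" and S: "S \<subseteq> {..<m}" and v: "v \<in> carrier_vec n"
  shows "(l2norm (submatrix A S UNIV *\<^sub>v v))\<^sup>2 = (\<Sum>i\<in>S. (Matrix.row A i \<bullet> v)\<^sup>2)"
proof -
  have finS: "finite S" using S by (rule finite_subset) simp
  have SI: "{i. i < m \<and> i \<in> S} = S" using S by auto
  have dims: "dim_row (submatrix A S UNIV) = card S" "dim_col (submatrix A S UNIV) = n"
    using A by (simp_all add: dim_submatrix SI)
  have entry: "(submatrix A S UNIV *\<^sub>v v) $ k = Matrix.row A (pick S k) \<bullet> v" if k: "k < card S" for k
  proof -
    have p: "pick S k < m" using pick_in_set_le[OF k] S by auto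
    have "submatrix A S UNIV $$ (k, j) = A $$ (pick S k, j)" if "j < n" for j
      using A k that by (subst submatrix_index) (simp_all add: SI pick_UNIV)
    then show ?thesis using A p v k dims
      by (simp add: scalar_prod_def)
  qed
  have "(l2norm (submatrix A S UNIV *\<^sub>v v))\<^sup>2 = (\<Sum>k<card S. ((submatrix A S UNIV *\<^sub>v v) $ k)\<^sup>2)"
    by (simp add: l2norm_def L2_set_def sum_nonneg dims)
  also have "\<dots> = (\<Sum>k<card S. (Matrix.row A (pick S k) \<bullet> v)\<^sup>2)" using entry by simp
  also have "\<dots> = (\<Sum>i\<in>S. (Matrix.row A i \<bullet> v)\<^sup>2)"
    by (rule sum.reindex_bij_betw[OF pick_bij[OF finS]])
  finally show ?thesis .
qed

lemma sigma_sub_min_lower: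
  assumes A: "A \<in> carrier_mat m n" and S: "S \<subseteq> {..<m}" and cS: "p * real m \<le> real (card S)" and v: "v \<in> carrier_vec n"
  shows "(sigma_sub_min p A)\<^sup>2 * (v \<bullet> v) \<le> (\<Sum>i\<in>S. (Matrix.row A i \<bullet> v)\<^sup>2)"
proof (cases "v = 0\<^sub>v n")
  case True
  then have "v \<bullet> v = 0" by simp
  then show ?thesis by (simp add: sum_nonneg)
next
  case False
  let ?V = "carrier_vec n - {0\<^sub>v n} :: rvec set"
  define R where "R = (\<lambda>S (y::rvec). l2norm (submatrix A S UNIV *\<^sub>v y) / l2norm y)"
  define F where "F = {S. S \<subseteq> {..<m} \<and> card S = nat \<lceil>p * real m\<rceil>}"
  have sm: "sigma_sub_min p A = (MIN S\<in>F. INF y\<in>?V. R S y)"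
    using A by (simp add: sigma_sub_min_def R_def F_def)
  have R0: "R T y \<ge> 0" for T y by (simp add: R_def l2norm_nonneg)
  have "nat \<lceil>p * real m\<rceil> \<le> card S" using cS by (simp add: nat_le_iff ceiling_le_iff)
  then obtain T where T: "T \<subseteq> S" "card T = nat \<lceil>p * real m\<rceil>"
    using obtain_subset_with_card_n by metis
  have finF: "finite F" by (rule finite_subset[of _ "Pow {..<m}"]) (auto simp: F_def)
  have TF: "T \<in> F" using T S by (auto simp: F_def)
  have vV: "v \<in> ?V" using v False by simp
  have "sigma_sub_min p A \<le> (INF y\<in>?V. R T y)" unfolding sm using finF TF by (intro Min_le) auto
  also have "\<dots> \<le> R T v" using vV R0 by (intro cINF_lower bdd_belowI[of _ 0]) auto
  finally have le: "sigma_sub_min p A \<le> R T v" .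
  have "sigma_sub_min p A \<in> (\<lambda>S. INF y\<in>?V. R S y) ` F" unfolding sm using finF TF by (intro Min_in) auto
  then obtain T' where "sigma_sub_min p A = (INF y\<in>?V. R T' y)" by auto
  also have "\<dots> \<ge> 0" using vV R0 by (intro cINF_greatest) auto
  finally have nonneg: "sigma_sub_min p A \<ge> 0" .
  have "(sigma_sub_min p A)\<^sup>2 \<le> (R T v)\<^sup>2" using le nonneg by (rule power_mono)
  have "v \<bullet> v \<noteq> 0"
  proof
    assume "v \<bullet> v = 0"
    then have "sq n (\<lambda>j. v $ j) = 0" using self_scalar_prod[OF v] by simp
    then have "v $ j = 0" if "j < n" for j using zero_norm_coords[where y = "\<lambda>j. v $ j" and n = n] that by simp
    then have "v = 0\<^sub>v n" using v by (intro eq_vecI) auto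
    with False show False by simp
  qed
  then have vv: "v \<bullet> v > 0" using l2norm_sq[of v] by (metis order_less_le zero_le_power2)
  have "(sigma_sub_min p A)\<^sup>2 * (v \<bullet> v) \<le> (R T v)\<^sup>2 * (v \<bullet> v)"
    using \<open>(sigma_sub_min p A)\<^sup>2 \<le> (R T v)\<^sup>2\<close> vv by (intro mult_right_mono) auto
  also have "\<dots> = (l2norm (submatrix A T UNIV *\<^sub>v v))\<^sup>2"
    using vv by (simp add: R_def power_divide l2norm_sq)
  also have "\<dots> = (\<Sum>i\<in>T. (Matrix.row A i \<bullet> v)\<^sup>2)"
    using T S by (intro l2norm_submatrix_mult[OF A _ v]) auto
  also have "\<dots> \<le> (\<Sum>i\<in>S. (Matrix.row A i \<bullet> v)\<^sup>2)"
    using T(1) S by (intro sum_mono2 finite_subset[OF S]) auto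
  finally show ?thesis .
qed

section \<open>The truncated Gaussian second moment at corruption level 0.0056\<close>

abbreviation (input) gauss :: "real \<Rightarrow> real" where
  "gauss s \<equiv> exp (- (s\<^sup>2 / 2))"

lemma exp_minus_le_taylor4:
  fixes u :: real
  assumes "u \<ge> 0"
  shows "exp (- u) \<le> 1 - u + u^2 / 2 - u^3 / 6 + u^4 / 24"
proof -
  obtain t where "exp (- u) = (\<Sum>m<5. (- u) ^ m / fact m) + exp t / fact 5 * (- u) ^ 5"
    using Maclaurin_exp_le[of "- u" 5] by blast
  moreover have "exp t / fact 5 * (- u) ^ 5 \<le> 0"
    using assms by (intro mult_nonneg_nonpos) auto
  ultimately show ?thesis by (simp add: lessThan_nat_numeral fact_numeral power_minus_odd power_minus_even)
qed

lemma exp_minus_ge_taylor5: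
  fixes u :: real
  shows "1 - u + u^2 / 2 - u^3 / 6 + u^4 / 24 - u^5 / 120 \<le> exp (- u)"
proof -
  obtain t where "exp (- u) = (\<Sum>m<6. (- u) ^ m / fact m) + exp t / fact 6 * (- u) ^ 6"
    using Maclaurin_exp_le[of "- u" 6] by blast
  moreover have "exp t / fact 6 * (- u) ^ 6 \<ge> 0" by simp
  ultimately show ?thesis by (simp add: lessThan_nat_numeral fact_numeral power_minus_odd power_minus_even)
qed

lemma gauss_integrable: "(\<lambda>s. gauss s) integrable_on {a..b}"
  by (intro integrable_continuous_real continuous_intros) auto

lemma gauss2_integrable: "(\<lambda>s. gauss s * s\<^sup>2) integrable_on {a..b}"
  by (intro integrable_continuous_real continuous_intros) auto

lemma weighted_gauss_integrable: "(\<lambda>s. (9/4 - s\<^sup>2) * gauss s) integrable_on {a..b}"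
  by (intro integrable_continuous_real continuous_intros) auto

lemma polynomial_integral:
  fixes P p :: "real \<Rightarrow> real"
  assumes "a \<le> b" "\<And>x. (P has_real_derivative p x) (at x)"
  shows "(p has_integral (P b - P a)) {a..b}"
  using assms by (intro fundamental_theorem_of_calculus)
    (auto simp: has_real_derivative_iff_has_vector_derivative[symmetric] intro: has_field_derivative_at_within)

lemma bathtub_integral_bound: "integral {-3/2..3/2} (\<lambda>s. (9/4 - s\<^sup>2) * gauss s) \<le> 369/100"
proof -
  define P :: "real \<Rightarrow> real" where "P = (\<lambda>s. 9/4 * (s - s^3/6 + s^5/40 - s^7/336 + s^9/3456) - (s^3/3 - s^5/10 + s^7/56 - s^9/432 + s^11/4224))"
  define p :: "real \<Rightarrow> real" where "p = (\<lambda>s. 9/4 * (1 - s^2/2 + s^4/8 - s^6/48 + s^8/384) - (s^2 - s^4/2 + s^6/8 - s^8/48 + s^10/384))"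
  have "(P has_real_derivative p x) (at x)" for x
    unfolding P_def p_def by (auto intro!: derivative_eq_intros)
  then have I: "(p has_integral (P (3/2) - P (-3/2))) {-3/2..3/2}"
    by (intro polynomial_integral) auto
  have "integral {-3/2..3/2} (\<lambda>s. (9/4 - s\<^sup>2) * gauss s) \<le> P (3/2) - P (-3/2)"
  proof (rule has_integral_le[OF integrable_integral[OF weighted_gauss_integrable] I])
    fix s :: real assume "s \<in> {-3/2..3/2}"
    then have "\<bar>s\<bar> \<le> 3/2" by (auto simp: abs_le_iff)
    then have "s\<^sup>2 \<le> (3/2)\<^sup>2" by (metis abs_ge_zero power2_abs power_mono)
    then have "9/4 - s\<^sup>2 \<ge> 0" by (simp add: power2_eq_square)
    moreover have "gauss s \<le> 1 - s^2/2 + s^4/8 - s^6/48 + s^8/384"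
      using exp_minus_le_taylor4[of "s\<^sup>2 / 2"] by (simp add: power_divide power_mult[symmetric])
    ultimately have "(9/4 - s\<^sup>2) * gauss s \<le> (9/4 - s\<^sup>2) * (1 - s^2/2 + s^4/8 - s^6/48 + s^8/384)"
      by (rule mult_left_mono[rotated])
    also have "\<dots> = p s" unfolding p_def by (simp add: algebra_simps power_add[symmetric] diff_divide_distrib)
    finally show "(9/4 - s\<^sup>2) * gauss s \<le> p s" .
  qed
  also have "\<dots> \<le> 369/100" unfolding P_def by (simp add: power_numeral_reduce)
  finally show ?thesis .
qed

text \<open>Since \<open>0.8744 \<surd>(2 \<pi>) < 2.2\<close>, the mass \<open>0.8744\<close> is reached before \<open>\<alpha> = 2\<close>.\<close>

lemma gauss_integral_lower: "integral {-2..2} gauss \<ge> 22/10"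
proof -
  define P :: "real \<Rightarrow> real" where "P = (\<lambda>s. s - s^3/6 + s^5/40 - s^7/336 + s^9/3456 - s^11/42240)"
  define p :: "real \<Rightarrow> real" where "p = (\<lambda>s. 1 - s^2/2 + s^4/8 - s^6/48 + s^8/384 - s^10/3840)"
  have "(P has_real_derivative p x) (at x)" for x
    unfolding P_def p_def by (auto intro!: derivative_eq_intros)
  then have I: "(p has_integral (P 2 - P (-2))) {-2..2}"
    by (intro polynomial_integral) auto
  have "22/10 \<le> P 2 - P (-2)" unfolding P_def by (simp add: power_numeral_reduce)
  also have "\<dots> \<le> integral {-2..2} gauss"
  proof (rule has_integral_le[OF I integrable_integral[OF gauss_integrable]])
    fix s :: real
    show "p s \<le> gauss s" unfolding p_def
      using exp_minus_ge_taylor5[of "s\<^sup>2 / 2"] by (simp add: power_divide power_mult[symmetric])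
  qed
  finally show ?thesis .
qed

text \<open>The integrand is positive exactly on \<open>(- 3/2, 3/2)\<close>, so that interval maximises its integral. This bounds
  the truncated second moment by the truncated mass without any knowledge of \<open>\<alpha>\<close>. The bound would be an equality at
  \<open>\<alpha> = 3/2\<close>; the true value is about \<open>1.53\<close>, so little is lost.\<close>

lemma bathtub:
  assumes "\<alpha> > 0"
  shows "integral {-\<alpha>..\<alpha>} (\<lambda>s. (9/4 - s\<^sup>2) * gauss s) \<le> integral {-3/2..3/2} (\<lambda>s. (9/4 - s\<^sup>2) * gauss s)"
proof -
  let ?f = "\<lambda>s. (9/4 - s\<^sup>2) * gauss s"
  have inside: "?f s \<ge> 0" if "\<bar>s\<bar> \<le> 3/2" for s
  proof -
    have "s\<^sup>2 \<le> (3/2)\<^sup>2" using that by (metis abs_ge_zero power2_abs power_mono)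
    then show ?thesis by (simp add: power2_eq_square)
  qed
  have outside: "?f s \<le> 0" if "\<bar>s\<bar> \<ge> 3/2" for s
  proof -
    have "(3/2)\<^sup>2 \<le> s\<^sup>2" using power_mono[OF that, of 2] by simp
    then show ?thesis by (intro mult_nonpos_nonneg) (simp_all add: power2_eq_square)
  qed
  show ?thesis
  proof (cases "\<alpha> \<le> 3/2")
    case True
    show ?thesis
      by (rule integral_subset_le) (use True inside in \<open>auto intro!: weighted_gauss_integrable simp: abs_le_iff\<close>)
  next
    case False
    have "integral {-\<alpha>..\<alpha>} ?f = integral {-\<alpha>..-3/2} ?f + integral {-3/2..\<alpha>} ?f"
      using False by (intro Henstock_Kurzweil_Integration.integral_combine[symmetric] weighted_gauss_integrable) auto
    also have "integral {-3/2..\<alpha>} ?f = integral {-3/2..3/2} ?f + integral {3/2..\<alpha>} ?f"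
      using False by (intro Henstock_Kurzweil_Integration.integral_combine[symmetric] weighted_gauss_integrable) auto
    moreover have "integral {-\<alpha>..-3/2} ?f \<le> integral {-\<alpha>..-3/2} (\<lambda>_. 0)"
      by (intro integral_le weighted_gauss_integrable outside) auto
    moreover have "integral {3/2..\<alpha>} ?f \<le> integral {3/2..\<alpha>} (\<lambda>_. 0)"
      by (intro integral_le weighted_gauss_integrable outside) auto
    ultimately show ?thesis by simp
  qed
qed

lemma sqrt_2pi_bounds: "2.506 \<le> sqrt (2 * pi)" "sqrt (2 * pi) \<le> 2.51"
proof -
  have "2.506\<^sup>2 \<le> 2 * pi" using pi_approx(1) by (simp add: power2_eq_square)
  then show "2.506 \<le> sqrt (2 * pi)" by (rule real_le_rsqrt)
  have "2 * pi \<le> 2.51\<^sup>2" using pi_approx(2) by (simp add: power2_eq_square)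
  then have "sqrt (2 * pi) \<le> sqrt (2.51\<^sup>2)" by (rule real_sqrt_le_mono)
  then show "sqrt (2 * pi) \<le> 2.51" by simp
qed

text \<open>Integrate \<open>s\<^sup>2 = 9/4 - (9/4 - s\<^sup>2)\<close>: the first term is known from the mass, the second is bounded by
  \<open>bathtub\<close>.\<close>

lemma second_moment_bound:
  assumes "\<alpha> > 0" and mass: "1 / sqrt (2 * pi) * integral {-\<alpha>..\<alpha>} gauss = 0.8744"
  shows "1 / sqrt (2 * pi) * integral {-\<alpha>..\<alpha>} (\<lambda>s. gauss s * s\<^sup>2) \<ge> 0.494"
proof -
  define c where "c = 1 / sqrt (2 * pi)"
  have c0: "c > 0" by (simp add: c_def)
  have c1: "c \<le> 1 / 2.506" unfolding c_def by (rule divide_left_mono[OF sqrt_2pi_bounds(1)]) auto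
  define I0 I2 J where "I0 = integral {-\<alpha>..\<alpha>} gauss" and "I2 = integral {-\<alpha>..\<alpha>} (\<lambda>s. gauss s * s\<^sup>2)"
    and "J = integral {-\<alpha>..\<alpha>} (\<lambda>s. (9/4 - s\<^sup>2) * gauss s)"
  have "J = integral {-\<alpha>..\<alpha>} (\<lambda>s. 9/4 * gauss s - gauss s * s\<^sup>2)"
    unfolding J_def by (simp add: algebra_simps)
  also have "\<dots> = integral {-\<alpha>..\<alpha>} (\<lambda>s. 9/4 * gauss s) - I2"
    unfolding I2_def
    by (intro Henstock_Kurzweil_Integration.integral_diff integrable_on_mult_right gauss_integrable gauss2_integrable)
  also have "integral {-\<alpha>..\<alpha>} (\<lambda>s. 9/4 * gauss s) = 9/4 * I0" unfolding I0_def by (rule integral_mult_right)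
  finally have "I2 = 9/4 * I0 - J" by linarith
  then have "c * I2 = 9/4 * (c * I0) - c * J" by (simp add: right_diff_distrib)
  moreover have "c * I0 = 0.8744" using mass by (simp add: c_def I0_def)
  moreover have "c * J \<le> c * (369/100)"
    using c0 order_trans[OF bathtub[OF assms(1)] bathtub_integral_bound] unfolding J_def by (intro mult_left_mono) auto
  moreover have "c * (369/100) \<le> 1 / 2.506 * (369/100)" using c1 by (rule mult_right_mono) simp
  ultimately have "c * I2 \<ge> 0.494" by simp
  then show ?thesis unfolding c_def I2_def .
qed

lemma truncation_level_exists:
  obtains \<alpha> where "\<alpha> > 0" "1 / sqrt (2 * pi) * integral {-\<alpha>..\<alpha>} gauss = 0.8744"
proof -
  define F where "F = (\<lambda>\<alpha>. integral {-\<alpha>..\<alpha>} gauss)"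
  have F: "F \<alpha> = integral {-2..\<alpha>} gauss - integral {-2..-\<alpha>} gauss" if "\<alpha> \<in> {0..2}" for \<alpha>
    using Henstock_Kurzweil_Integration.integral_combine[of "-2" "-\<alpha>" \<alpha> gauss] that gauss_integrable by (simp add: F_def)
  have cont: "continuous_on {-2..2} (\<lambda>x. integral {-2..x} gauss)"
    by (rule indefinite_integral_continuous_1[OF gauss_integrable])
  have "continuous_on {0..2} (\<lambda>\<alpha>. integral {-2..\<alpha>} gauss - integral {-2..-\<alpha>} gauss)"
  proof (rule continuous_on_diff)
    show "continuous_on {0..2} (\<lambda>\<alpha>. integral {-2..\<alpha>} gauss)"
      by (rule continuous_on_subset[OF cont]) auto
    show "continuous_on {0..2} (\<lambda>\<alpha>. integral {-2..-\<alpha>} gauss)"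
      by (rule continuous_on_compose2[OF cont, where f = uminus]) (auto intro: continuous_intros)
  qed
  then have cF: "continuous_on {0..2} F" using F by (subst continuous_on_cong[OF refl F]) auto
  have F0: "F 0 = 0" by (simp add: F_def)
  have F2: "0.8744 * sqrt (2 * pi) \<le> F 2"
    using gauss_integral_lower sqrt_2pi_bounds(2) by (simp add: F_def)
  have "0 \<le> 0.8744 * sqrt (2 * pi)" by simp
  then obtain \<alpha> where \<alpha>: "0 \<le> \<alpha>" "F \<alpha> = 0.8744 * sqrt (2 * pi)"
    using IVT'[of F 0 "0.8744 * sqrt (2 * pi)" 2] F0 F2 cF by auto
  have "0.8744 * sqrt (2 * pi) > 0" by simp
  then have "\<alpha> \<noteq> 0" using \<alpha>(2) F0 by auto
  then show ?thesis using that[of \<alpha>] \<alpha> by (simp add: F_def)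
qed

lemma singular_ratio_threshold: "0.0056 / (1 - 0.88 - 0.0056) + 2 * sqrt (0.0056 / (1 - 0.88 - 0.0056)) < (0.493 :: real)"
proof -
  have "sqrt (7/143) \<le> 0.222" by (rule real_le_lsqrt) (auto simp: power2_eq_square)
  then have "sqrt (7/143) \<le> 0.2215" by (intro real_le_lsqrt) (auto simp: power2_eq_square)
  then show ?thesis by simp
qed

section \<open>Convergence with high probability\<close>

lemma prob_tends_to_1_mono:
  assumes "prob_tends_to_1 P" "\<And>A. P A \<Longrightarrow> R A"
  shows "prob_tends_to_1 R"
proof -
  have "random_matrix_prob_ge m n p R" if "random_matrix_prob_ge m n p P" for m n p
    using that assms(2) unfolding random_matrix_prob_ge_def by blast
  with assms(1) show ?thesis unfolding prob_tends_to_1_def by blast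
qed

lemma prob_tends_to_1_antimono_corruption:
  assumes "prob_tends_to_1 (converges_for_all_corruptions q \<delta>)" "\<beta> \<le> \<delta>"
  shows "prob_tends_to_1 (converges_for_all_corruptions q \<beta>)"
  using assms(1) by (rule prob_tends_to_1_mono) (rule converges_antimono[OF _ assms(2)])

abbreviation mat_of_rows_fun :: "nat \<Rightarrow> nat \<Rightarrow> (nat \<Rightarrow> nat \<Rightarrow> real) \<Rightarrow> rmat" where
  "mat_of_rows_fun m n a \<equiv> Matrix.mat m n (\<lambda>(i, j). a i j)"

lemma row_mat_of_rows_fun:
  assumes "i < m" "v \<in> carrier_vec n"
  shows "Matrix.row (mat_of_rows_fun m n a) i \<bullet> v = ip n (a i) (\<lambda>j. v $ j)"
  using assms by (simp add: scalar_prod_def lessThan_atLeast0)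

lemma row_mat_of_rows_fun_self:
  assumes "i < m"
  shows "Matrix.row (mat_of_rows_fun m n a) i \<bullet> Matrix.row (mat_of_rows_fun m n a) i = sq n (a i)"
  using assms by (simp add: scalar_prod_def lessThan_atLeast0 power2_eq_square)

lemma good_rows_converge:
  assumes a: "good_rows p \<rho> m n a" and m: "m > 0"
    and q: "0 < q" "p \<le> q - \<beta>" and \<beta>: "0 \<le> \<beta>" "\<beta> < 1 - q"
    and gap: "\<beta> / (1 - q - \<beta>) + 2 * sqrt (\<beta> / (1 - q - \<beta>)) < \<rho>"
  shows "converges_for_all_corruptions q \<beta> (mat_of_rows_fun m n a)"
proof -
  let ?A = "mat_of_rows_fun m n a"
  obtain L where L: "L > 0" and unit: "\<And>i. i < m \<Longrightarrow> sq n (a i) = 1"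
    and up: "\<And>y. (\<Sum>i<m. (ip n (a i) y)\<^sup>2) \<le> L * sq n y"
    and low: "\<And>y S. S \<subseteq> {..<m} \<Longrightarrow> p * m \<le> card S \<Longrightarrow> \<rho> * L * sq n y \<le> (\<Sum>i\<in>S. (ip n (a i) y)\<^sup>2)"
    using a unfolding good_rows_def by blast
  interpret quantile_system ?A m n q \<beta> "\<rho> * L" L
  proof
    show "?A \<in> carrier_mat m n" by simp
    show "Matrix.row ?A i \<bullet> Matrix.row ?A i = 1" if "i < m" for i
      using unit[OF that] row_mat_of_rows_fun_self[OF that] by metis
    fix v :: rvec assume v: "v \<in> carrier_vec n"
    have "(\<Sum>i<m. (Matrix.row ?A i \<bullet> v)\<^sup>2) = (\<Sum>i<m. (ip n (a i) (\<lambda>j. v $ j))\<^sup>2)"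
      by (intro sum.cong refl arg_cong[where f = "\<lambda>t. t\<^sup>2"] row_mat_of_rows_fun v) simp
    then show "(\<Sum>i<m. (Matrix.row ?A i \<bullet> v)\<^sup>2) \<le> L * (v \<bullet> v)"
      using up[of "\<lambda>j. v $ j"] unfolding self_scalar_prod[OF v] by linarith
    fix S assume S: "S \<subseteq> {..<m}" "(q - \<beta>) * real m \<le> real (card S)"
    have "p * m \<le> (q - \<beta>) * real m" using q by (intro mult_right_mono) auto
    then have "\<rho> * L * sq n (\<lambda>j. v $ j) \<le> (\<Sum>i\<in>S. (ip n (a i) (\<lambda>j. v $ j))\<^sup>2)"
      using S by (intro low) auto
    also have "\<dots> = (\<Sum>i\<in>S. (Matrix.row ?A i \<bullet> v)\<^sup>2)"
      using S(1) by (intro sum.cong refl arg_cong[where f = "\<lambda>t. t\<^sup>2"] row_mat_of_rows_fun[symmetric] v) auto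
    finally show "\<rho> * L * (v \<bullet> v) \<le> (\<Sum>i\<in>S. (Matrix.row ?A i \<bullet> v)\<^sup>2)"
      unfolding self_scalar_prod[OF v] .
  next
    show "L * (\<beta> / (1 - q - \<beta>) + 2 * sqrt (\<beta> / (1 - q - \<beta>))) < \<rho> * L"
      using mult_strict_left_mono[OF gap L] by (simp add: mult.commute)
  qed (use m q \<beta> L in auto)
  show ?thesis by (rule converges)
qed

lemma small_corruption_level:
  fixes q \<rho> :: real
  assumes q: "0 < q" "q < 1" and \<rho>: "\<rho> > 0"
  obtains \<delta> where "\<delta> > 0" "\<delta> \<le> q / 2" "\<delta> < 1 - q"
    "\<delta> / (1 - q - \<delta>) + 2 * sqrt (\<delta> / (1 - q - \<delta>)) < \<rho>"
proof -
  have "((\<lambda>\<delta>. \<delta> / (1 - q - \<delta>) + 2 * sqrt (\<delta> / (1 - q - \<delta>))) \<longlongrightarrow> 0 / (1 - q - 0) + 2 * sqrt (0 / (1 - q - 0))) (at_right 0)"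
    using q by (intro tendsto_intros) auto
  then have "eventually (\<lambda>\<delta>. \<delta> / (1 - q - \<delta>) + 2 * sqrt (\<delta> / (1 - q - \<delta>)) < \<rho>) (at_right 0)"
    using \<rho> by (intro order_tendstoD(2)) auto
  moreover have "eventually (\<lambda>\<delta>. \<delta> \<in> {0<..<min (q / 2) (1 - q)}) (at_right 0)"
    using q by (intro eventually_at_right_real) auto
  ultimately have "eventually (\<lambda>\<delta>. 0 < \<delta> \<and> \<delta> \<le> q / 2 \<and> \<delta> < 1 - q \<and> \<delta> / (1 - q - \<delta>) + 2 * sqrt (\<delta> / (1 - q - \<delta>)) < \<rho>) (at_right (0::real))"
    by eventually_elim auto
  from eventually_happens'[OF _ this] that show ?thesis by auto
qed

lemma convergence_small_corruption:
  assumes q: "0 < q" "q < 1"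
  shows "\<exists>\<delta>>0. \<forall>\<beta>. 0 \<le> \<beta> \<and> \<beta> \<le> \<delta> \<longrightarrow> prob_tends_to_1 (converges_for_all_corruptions q \<beta>)"
proof -
  obtain \<rho> where \<rho>: "\<rho> > 0" and good: "\<And>\<epsilon>. \<epsilon> > 0 \<Longrightarrow> \<exists>N::real. \<forall>m n. N \<le> real m \<and> N \<le> real n \<and> N \<le> real m / real n \<longrightarrow>
    (\<exists>E\<in>sets (row_law m n). (\<forall>a\<in>E. good_rows (q / 2) \<rho> m n a) \<and> 1 - \<epsilon> \<le> measure (row_law m n) E)"
    using random_good_rows[of "q / 2"] q by auto
  obtain \<delta> where \<delta>: "\<delta> > 0" "\<delta> \<le> q / 2" "\<delta> < 1 - q"
    "\<delta> / (1 - q - \<delta>) + 2 * sqrt (\<delta> / (1 - q - \<delta>)) < \<rho>"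
    using small_corruption_level[OF q \<rho>] by blast
  have "prob_tends_to_1 (converges_for_all_corruptions q \<delta>)"
    unfolding prob_tends_to_1_def
  proof (intro allI impI)
    fix \<epsilon> :: real assume "\<epsilon> > 0"
    from good[OF this] obtain N :: real where N: "\<And>m n. N \<le> real m \<and> N \<le> real n \<and> N \<le> real m / real n \<Longrightarrow>
      \<exists>E\<in>sets (row_law m n). (\<forall>a\<in>E. good_rows (q / 2) \<rho> m n a) \<and> 1 - \<epsilon> \<le> measure (row_law m n) E" by blast
    show "\<exists>N::real. \<forall>m n. N \<le> real m \<and> N \<le> real n \<and> N \<le> real m / real n \<longrightarrow>
        random_matrix_prob_ge m n (1 - \<epsilon>) (converges_for_all_corruptions q \<delta>)"
    proof (rule exI[of _ "max 1 N"], intro allI impI)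
      fix m n assume mn: "max 1 N \<le> real m \<and> max 1 N \<le> real n \<and> max 1 N \<le> real m / real n"
      then have m: "m > 0" by auto
      from mn have "N \<le> real m \<and> N \<le> real n \<and> N \<le> real m / real n" by simp
      from N[OF this] obtain E where E: "E \<in> sets (row_law m n)" "\<And>a. a \<in> E \<Longrightarrow> good_rows (q / 2) \<rho> m n a"
        "1 - \<epsilon> \<le> measure (row_law m n) E" by blast
      have "converges_for_all_corruptions q \<delta> (mat_of_rows_fun m n a)" if "a \<in> E" for a
        using E(2)[OF that] m q \<delta> by (intro good_rows_converge) auto
      then show "random_matrix_prob_ge m n (1 - \<epsilon>) (converges_for_all_corruptions q \<delta>)"
        unfolding random_matrix_prob_ge_def using E by blast
    qed
  qed
  then show ?thesis using \<delta>(1) prob_tends_to_1_antimono_corruption by blast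
qed

text \<open>If the largest singular value were \<open>0\<close> the quotient would be \<open>0\<close> by convention, which the strict lower bound
  excludes.\<close>

lemma singular_ratio_converges:
  assumes unit: "\<And>i. i < m \<Longrightarrow> sq n (a i) = 1" and m: "m > 0" and n: "n > 0"
    and q: "0 < q" and \<beta>: "0 \<le> \<beta>" "\<beta> < 1 - q"
    and ratio: "\<beta> / (1 - q - \<beta>) + 2 * sqrt (\<beta> / (1 - q - \<beta>))
      < (sigma_sub_min (q - \<beta>) (mat_of_rows_fun m n a))\<^sup>2 / (sigma_max (mat_of_rows_fun m n a))\<^sup>2"
  shows "converges_for_all_corruptions q \<beta> (mat_of_rows_fun m n a)"
proof -
  let ?A = "mat_of_rows_fun m n a"
  have A: "?A \<in> carrier_mat m n" by simp
  have w: "0 \<le> \<beta> / (1 - q - \<beta>) + 2 * sqrt (\<beta> / (1 - q - \<beta>))" using \<beta> by simp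
  with ratio have "(sigma_max ?A)\<^sup>2 \<noteq> 0" by (metis div_by_0 not_le)
  then have L: "(sigma_max ?A)\<^sup>2 > 0" by simp
  interpret quantile_system ?A m n q \<beta> "(sigma_sub_min (q - \<beta>) ?A)\<^sup>2" "(sigma_max ?A)\<^sup>2"
  proof
    show "Matrix.row ?A i \<bullet> Matrix.row ?A i = 1" if "i < m" for i
      using unit[OF that] row_mat_of_rows_fun_self[OF that] by metis
    show "(sigma_max ?A)\<^sup>2 * (\<beta> / (1 - q - \<beta>) + 2 * sqrt (\<beta> / (1 - q - \<beta>))) < (sigma_sub_min (q - \<beta>) ?A)\<^sup>2"
      using ratio L by (simp add: pos_less_divide_eq mult.commute)
  qed (use m q \<beta> A sigma_max_upper[OF A n] sigma_sub_min_lower[OF A] in auto)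
  show ?thesis by (rule converges)
qed

text \<open>Rows have norm one only almost surely, so this event has to be intersected with the given ones.\<close>

lemma prob_tends_to_1_unit_rows:
  assumes "prob_tends_to_1 P"
    and "\<And>m n a. m > 0 \<Longrightarrow> n > 0 \<Longrightarrow> (\<And>i. i < m \<Longrightarrow> sq n (a i) = 1) \<Longrightarrow> P (mat_of_rows_fun m n a) \<Longrightarrow> R (mat_of_rows_fun m n a)"
  shows "prob_tends_to_1 R"
  unfolding prob_tends_to_1_def
proof (intro allI impI)
  fix \<epsilon> :: real assume "\<epsilon> > 0"
  with assms(1) obtain N :: real where N: "\<And>m n. N \<le> real m \<and> N \<le> real n \<and> N \<le> real m / real n \<Longrightarrow>
      random_matrix_prob_ge m n (1 - \<epsilon>) P" unfolding prob_tends_to_1_def by blast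
  show "\<exists>N::real. \<forall>m n. N \<le> real m \<and> N \<le> real n \<and> N \<le> real m / real n \<longrightarrow> random_matrix_prob_ge m n (1 - \<epsilon>) R"
  proof (rule exI[of _ "max 1 N"], intro allI impI)
    fix m n assume mn: "max 1 N \<le> real m \<and> max 1 N \<le> real n \<and> max 1 N \<le> real m / real n"
    then have m: "m > 0" and n: "n > 0" by auto
    from mn have "N \<le> real m \<and> N \<le> real n \<and> N \<le> real m / real n" by simp
    from N[OF this] obtain E where E: "E \<in> sets (row_law m n)" "\<And>a. a \<in> E \<Longrightarrow> P (mat_of_rows_fun m n a)"
      "1 - \<epsilon> \<le> measure (row_law m n) E" unfolding random_matrix_prob_ge_def by blast
    interpret prob_space "row_law m n" by (rule prob_space_row_law[OF n])
    define U where "U = {a \<in> space (row_law m n). \<forall>i<m. sq n (a i) = 1}"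
    have U: "U \<in> sets (row_law m n)" and "emeasure (row_law m n) U = 1"
      unfolding U_def by (rule row_law_unit[OF n])+
    then have U1: "prob U = 1" by (simp add: measure_def)
    have "prob (E - U) \<le> prob (space (row_law m n) - U)"
      using E(1) U sets.sets_into_space[OF E(1)] by (intro finite_measure_mono) auto
    also have "\<dots> = 0" using prob_compl[OF U] U1 by simp
    finally have "prob (E - U) = 0" using measure_nonneg[of "row_law m n" "E - U"] by linarith
    then have "prob (E \<inter> U) = prob E" using finite_measure_Diff'[OF E(1) U] by simp
    then have "1 - \<epsilon> \<le> prob (E \<inter> U)" using E(3) by simp
    moreover have "R (mat_of_rows_fun m n a)" if "a \<in> E \<inter> U" for a
      using that E(2) by (intro assms(2)[OF m n]) (auto simp: U_def)
    ultimately show "random_matrix_prob_ge m n (1 - \<epsilon>) R"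
      unfolding random_matrix_prob_ge_def using sets.Int[OF E(1) U] by blast
  qed
qed

theorem mainTheorem2:
  shows
    "(\<forall>q::real. 0 < q \<and> q < 1 \<longrightarrow>
       (\<exists>\<delta>>0. \<forall>\<beta>. 0 \<le> \<beta> \<and> \<beta> \<le> \<delta> \<longrightarrow>
          prob_tends_to_1 (converges_for_all_corruptions q \<beta>)))
     \<and>
     ((\<forall>\<beta> \<alpha> :: real. 0 \<le> \<beta> \<and> \<beta> \<le> 0.0056 \<and> 0 < \<alpha> \<and>
          1 / sqrt (2 * pi) * integral {-\<alpha>..\<alpha>} (\<lambda>s. exp (- (s\<^sup>2 / 2))) = 0.88 - \<beta> \<longrightarrow>
          tends_in_probability
            (\<lambda>A. (sigma_sub_min (0.88 - \<beta>) A)\<^sup>2 / (sigma_max A)\<^sup>2)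
            (1 / sqrt (2 * pi) * integral {-\<alpha>..\<alpha>} (\<lambda>s. exp (- (s\<^sup>2 / 2)) * s\<^sup>2)))
      \<longrightarrow>
       (\<exists>\<delta>\<ge>0.0056. \<forall>\<beta>. 0 \<le> \<beta> \<and> \<beta> \<le> \<delta> \<longrightarrow>
          prob_tends_to_1 (converges_for_all_corruptions 0.88 \<beta>)))"
proof (intro conjI impI)
  show "\<forall>q::real. 0 < q \<and> q < 1 \<longrightarrow>
       (\<exists>\<delta>>0. \<forall>\<beta>. 0 \<le> \<beta> \<and> \<beta> \<le> \<delta> \<longrightarrow> prob_tends_to_1 (converges_for_all_corruptions q \<beta>))"
    using convergence_small_corruption by blast
next
  assume hyp: "\<forall>\<beta> \<alpha> :: real. 0 \<le> \<beta> \<and> \<beta> \<le> 0.0056 \<and> 0 < \<alpha> \<and>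
          1 / sqrt (2 * pi) * integral {-\<alpha>..\<alpha>} (\<lambda>s. exp (- (s\<^sup>2 / 2))) = 0.88 - \<beta> \<longrightarrow>
          tends_in_probability
            (\<lambda>A. (sigma_sub_min (0.88 - \<beta>) A)\<^sup>2 / (sigma_max A)\<^sup>2)
            (1 / sqrt (2 * pi) * integral {-\<alpha>..\<alpha>} (\<lambda>s. exp (- (s\<^sup>2 / 2)) * s\<^sup>2))"
  obtain \<alpha> where \<alpha>: "\<alpha> > 0" "1 / sqrt (2 * pi) * integral {-\<alpha>..\<alpha>} gauss = 0.8744"
    by (rule truncation_level_exists)
  define M where "M = 1 / sqrt (2 * pi) * integral {-\<alpha>..\<alpha>} (\<lambda>s. gauss s * s\<^sup>2)"
  have M: "M \<ge> 0.494" unfolding M_def by (rule second_moment_bound[OF \<alpha>])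
  have "1 / sqrt (2 * pi) * integral {-\<alpha>..\<alpha>} gauss = 0.88 - 0.0056" using \<alpha>(2) by simp
  then have "tends_in_probability (\<lambda>A. (sigma_sub_min (0.88 - 0.0056) A)\<^sup>2 / (sigma_max A)\<^sup>2) M"
    unfolding M_def using \<alpha>(1) by (intro hyp[rule_format]) auto
  note conv = this[unfolded tends_in_probability_def, rule_format]
  have near: "prob_tends_to_1 (\<lambda>A. \<bar>(sigma_sub_min (0.88 - 0.0056) A)\<^sup>2 / (sigma_max A)\<^sup>2 - M\<bar> < 0.001)"
    by (rule conv) simp
  have "prob_tends_to_1 (converges_for_all_corruptions 0.88 0.0056)"
  proof (rule prob_tends_to_1_unit_rows[OF near])
    fix m n a
    assume mn: "m > 0" "n > 0" and unit: "\<And>i. i < m \<Longrightarrow> sq n (a i) = 1"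
      and "\<bar>(sigma_sub_min (0.88 - 0.0056) (mat_of_rows_fun m n a))\<^sup>2 / (sigma_max (mat_of_rows_fun m n a))\<^sup>2 - M\<bar> < 0.001"
    then have "0.493 < (sigma_sub_min (0.88 - 0.0056) (mat_of_rows_fun m n a))\<^sup>2 / (sigma_max (mat_of_rows_fun m n a))\<^sup>2"
      using M by linarith
    with singular_ratio_threshold have "0.0056 / (1 - 0.88 - 0.0056) + 2 * sqrt (0.0056 / (1 - 0.88 - 0.0056))
      < (sigma_sub_min (0.88 - 0.0056) (mat_of_rows_fun m n a))\<^sup>2 / (sigma_max (mat_of_rows_fun m n a))\<^sup>2"
      by (rule less_trans)
    then show "converges_for_all_corruptions 0.88 0.0056 (mat_of_rows_fun m n a)"
      using mn unit by (intro singular_ratio_converges) auto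
  qed
  then show "\<exists>\<delta>\<ge>0.0056. \<forall>\<beta>. 0 \<le> \<beta> \<and> \<beta> \<le> \<delta> \<longrightarrow> prob_tends_to_1 (converges_for_all_corruptions 0.88 \<beta>)"
    by (intro exI[of _ "0.0056"]) (auto intro: prob_tends_to_1_antimono_corruption)
qed

end
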